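(* Let $(P(B)^C,(J_i)_{i\in I})$ be a locally $C$-coalgebra Galois extension, with canonical surjections $\pi_i:P\to P_i=P/J_i$ and $\pi_{ij}:P\to P_{ij}=P/(J_i+J_j)$. (1) If $(\ker(\pi_i\otimes_B\pi_i))_{i\in I}$ is a complete covering of $P\otimes_B P$ and, for all $i,j\in I$, $$\ker(\pi_{ij}\otimes_B\pi_{ij})=\ker(\pi_i\otimes_B\pi_i)+\ker(\pi_j\otimes_B\pi_j),\qquad(\ast)$$ then $P(B)^C$ is a $C$-coalgebra Galois extension. (2) Suppose that $C$ is flat as a $\mathbb{K}$-module. Then the family $(\ker(\pi_i\otimes_B\pi_i))_{i\in I}$ is a cover of $P\otimes_B P$ if and only if the canonical map $\mathrm{can}^C_P:P\otimes_BP\to P\otimes C$ is injective. (3) If $P(B)^C$ is a $C$-coalgebra Galois extension and $C$ is flat as a $\mathbb{K}$-module, then condition $(\ast)$ holds for all $i,j\in I$ and $(\ker(\pi_i\otimes_B\pi_i))_{i\in I}$ is a complete covering of $P\otimes_BP$.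
   Context: $\mathbb{K}$ is a commutative unital ring with $2\neq 0$, $3\neq 0$ in $\mathbb{K}$, and every $\mathbb{K}$-module $M$ considered satisfies $2M=M$, $3M=M$. Algebras are unital associative and coalgebras counital coassociative over $\mathbb{K}$; $\otimes=\otimes_{\mathbb K}$; ideals are two-sided. Sweedler notation for a right coaction: $\rho^C(p)=p_{(0)}\otimes p_{(1)}$. Coinvariants: for an algebra $P$ that is also a right $C$-comodule, $P^{\mathrm{co}\,C}=\{b\in P\mid \rho^C(bp)=b\rho^C(p)\ \text{for all } p\in P\}$, a subalgebra of $P$. Coalgebra Galois extension: with $B=P^{\mathrm{co}\,C}$, the canonical map is $\mathrm{can}^C_P:P\otimes_BP\to P\otimes C$, $p\otimes_B p'\mapsto pp'_{(0)}\otimes p'_{(1)}$; $P(B)^C$ is a $C$-coalgebra Galois extension of $B$ if $\mathrm{can}^C_P$ is bijective. Covers: a cover (covering) of an object $M$ (module, algebra, algebra and comodule, ...) is a finite family $(J_i)_{i\in I}$ of subobjects (submodules, ideals, ideals which are right $C$-subcomodules, ...) with $\bigcap_{i}J_i=\{0\}$. It is complete if the (injective) map $M\to\{(m_i)_i\in\bigoplus_{i\in I} M/J_i\mid m_i \text{ and } m_j \text{ have the same image in } M/(J_i+J_j)\ \forall i,j\}$, $m\mapsto (m+J_i)_{i\in I}$, is surjective. Locally $C$-coalgebra Galois extension: a pair $(P(B)^C,(J_i)_{i\in I})$ such that: (i) $P$ is an algebra and a right $C$-comodule and $B=P^{\mathrm{co}\,C}$; (ii) $(J_i)_{i\in I}$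 is a finite family of ideals and right $C$-subcomodules of $P$ which is a complete cover of $P$; (iii) for all $i$, $\pi_i(B)=P_i^{\mathrm{co}\,C}$ and $P_i(\pi_i(B))^C$ is a $C$-coalgebra Galois extension; (iv) for all $i,j$, $\pi_{ij}(B)=P_{ij}^{\mathrm{co}\,C}$. The spaces $P_i,P_{ij}$ are $B$-bimodules via $\pi_i,\pi_{ij}$, and $\pi_i\otimes_B\pi_i:P\otimes_BP\to P_i\otimes_BP_i$, $\pi_{ij}\otimes_B\pi_{ij}:P\otimes_BP\to P_{ij}\otimes_BP_{ij}$. *)

theory Defs
  imports "HOL-Algebra.QuotRing" "HOL-Algebra.Module"
begin

section \<open>Modules, algebras and quotients over a commutative ring\<close>

text \<open>
  \<open>K\<close> is the ground ring. A \<open>K\<close>-module is a record satisfying the locale predicate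
  \<^locale>\<open>module\<close> of HOL-Algebra; the \<open>mult\<close> and \<open>one\<close> fields of such a record are only
  meaningful when it carries an algebra structure.
\<close>

definition linear_maps ::
    "('k, 'r) ring_scheme \<Rightarrow> ('k, 'm, 'x) module_scheme \<Rightarrow> ('k, 'n, 'y) module_scheme \<Rightarrow> ('m \<Rightarrow> 'n) set"
  where "linear_maps K M N = {f \<in> carrier M \<rightarrow> carrier N.
    (\<forall>x\<in>carrier M. \<forall>y\<in>carrier M. f (x \<oplus>\<^bsub>M\<^esub> y) = f x \<oplus>\<^bsub>N\<^esub> f y) \<and>
    (\<forall>k\<in>carrier K. \<forall>x\<in>carrier M. f (k \<odot>\<^bsub>M\<^esub> x) = k \<odot>\<^bsub>N\<^esub> f x)}"

text \<open>The locale \<^locale>\<open>algebra\<close> of HOL-Algebra is about commutative algebras only.\<close>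

definition unital_algebra :: "('k, 'r) ring_scheme \<Rightarrow> ('k, 'p, 'x) module_scheme \<Rightarrow> bool"
  where "unital_algebra K A \<longleftrightarrow> module K A \<and> ring A \<and>
    (\<forall>k\<in>carrier K. \<forall>x\<in>carrier A. \<forall>y\<in>carrier A.
      (k \<odot>\<^bsub>A\<^esub> x) \<otimes>\<^bsub>A\<^esub> y = k \<odot>\<^bsub>A\<^esub> (x \<otimes>\<^bsub>A\<^esub> y) \<and>
      x \<otimes>\<^bsub>A\<^esub> (k \<odot>\<^bsub>A\<^esub> y) = k \<odot>\<^bsub>A\<^esub> (x \<otimes>\<^bsub>A\<^esub> y))"

definition submodule_span ::
    "('k, 'r) ring_scheme \<Rightarrow> ('k, 'm, 'x) module_scheme \<Rightarrow> 'm set \<Rightarrow> 'm set"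
  where "submodule_span K M S = \<Inter> {N. submodule N K M \<and> S \<subseteq> N}"

definition quot_module :: "('k, 'm, 'x) module_scheme \<Rightarrow> 'm set \<Rightarrow> ('k, 'm set) module"
  where "quot_module M N =
    \<lparr>carrier = carrier (M Quot N), mult = mult (M Quot N), one = one (M Quot N),
     zero = zero (M Quot N), add = add (M Quot N),
     smult = (\<lambda>k X. \<Union>x\<in>X. N +>\<^bsub>M\<^esub> (k \<odot>\<^bsub>M\<^esub> x))\<rparr>"

definition multiples_exhaust :: "nat \<Rightarrow> ('k, 'm, 'x) module_scheme \<Rightarrow> bool"
  \<comment> \<open>\<open>n M = M\<close>\<close>
  where "multiples_exhaust n M \<longleftrightarrow> (\<lambda>x. add_pow M n x) ` carrier M = carrier M"


section \<open>Tensor products\<close>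

text \<open>
  A tensor product is the quotient of the free \<open>K\<close>-module on pairs by the submodule generated by
  the defining relations; its elements are cosets of finitely supported functions.
\<close>

type_synonym ('k, 'm, 'n) tens = "('m \<times> 'n \<Rightarrow> 'k) set"

definition free_module :: "('k, 'r) ring_scheme \<Rightarrow> 's set \<Rightarrow> ('k, 's \<Rightarrow> 'k) module"
  where "free_module K S =
    \<lparr>carrier = {f. (\<forall>s. f s \<in> carrier K) \<and> finite {s. f s \<noteq> \<zero>\<^bsub>K\<^esub>} \<and> (\<forall>s. s \<notin> S \<longrightarrow> f s = \<zero>\<^bsub>K\<^esub>)},
     mult = undefined, one = undefined,
     zero = (\<lambda>s. \<zero>\<^bsub>K\<^esub>), add = (\<lambda>f g s. f s \<oplus>\<^bsub>K\<^esub> g s),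
     smult = (\<lambda>k f s. k \<otimes>\<^bsub>K\<^esub> f s)\<rparr>"

definition free_basis :: "('k, 'r) ring_scheme \<Rightarrow> 's \<Rightarrow> 's \<Rightarrow> 'k"
  where "free_basis K s = (\<lambda>t. if t = s then \<one>\<^bsub>K\<^esub> else \<zero>\<^bsub>K\<^esub>)"

text \<open>
  \<open>B\<close> is a set of scalars acting on \<open>M\<close> from the right by \<open>ra\<close> and on \<open>N\<close> from the left by \<open>la\<close>;
  the last family of relations makes the tensor product balanced over \<open>B\<close>.
\<close>

definition tensor_relations ::
    "('k, 'r) ring_scheme \<Rightarrow> 'b set \<Rightarrow> ('m \<Rightarrow> 'b \<Rightarrow> 'm) \<Rightarrow> ('b \<Rightarrow> 'n \<Rightarrow> 'n) \<Rightarrow>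
     ('k, 'm, 'x) module_scheme \<Rightarrow> ('k, 'n, 'y) module_scheme \<Rightarrow> ('k, 'm, 'n) tens"
  where "tensor_relations K B ra la M N =
    (let F = free_module K (carrier M \<times> carrier N); e = (\<lambda>m n. free_basis K (m, n)) in
      {e (m \<oplus>\<^bsub>M\<^esub> m') n \<ominus>\<^bsub>F\<^esub> (e m n \<oplus>\<^bsub>F\<^esub> e m' n) | m m' n.
         m \<in> carrier M \<and> m' \<in> carrier M \<and> n \<in> carrier N} \<union>
      {e m (n \<oplus>\<^bsub>N\<^esub> n') \<ominus>\<^bsub>F\<^esub> (e m n \<oplus>\<^bsub>F\<^esub> e m n') | m n n'.
         m \<in> carrier M \<and> n \<in> carrier N \<and> n' \<in> carrier N} \<union>
      {e (k \<odot>\<^bsub>M\<^esub> m) n \<ominus>\<^bsub>F\<^esub> (k \<odot>\<^bsub>F\<^esub> e m n) | k m n.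
         k \<in> carrier K \<and> m \<in> carrier M \<and> n \<in> carrier N} \<union>
      {e m (k \<odot>\<^bsub>N\<^esub> n) \<ominus>\<^bsub>F\<^esub> (k \<odot>\<^bsub>F\<^esub> e m n) | k m n.
         k \<in> carrier K \<and> m \<in> carrier M \<and> n \<in> carrier N} \<union>
      {e (ra m b) n \<ominus>\<^bsub>F\<^esub> e m (la b n) | m b n.
         m \<in> carrier M \<and> b \<in> B \<and> n \<in> carrier N})"

definition tensor_kernel ::
    "('k, 'r) ring_scheme \<Rightarrow> 'b set \<Rightarrow> ('m \<Rightarrow> 'b \<Rightarrow> 'm) \<Rightarrow> ('b \<Rightarrow> 'n \<Rightarrow> 'n) \<Rightarrow>
     ('k, 'm, 'x) module_scheme \<Rightarrow> ('k, 'n, 'y) module_scheme \<Rightarrow> ('k, 'm, 'n) tens"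
  where "tensor_kernel K B ra la M N =
    submodule_span K (free_module K (carrier M \<times> carrier N)) (tensor_relations K B ra la M N)"

definition balanced_tensor ::
    "('k, 'r) ring_scheme \<Rightarrow> 'b set \<Rightarrow> ('m \<Rightarrow> 'b \<Rightarrow> 'm) \<Rightarrow> ('b \<Rightarrow> 'n \<Rightarrow> 'n) \<Rightarrow>
     ('k, 'm, 'x) module_scheme \<Rightarrow> ('k, 'n, 'y) module_scheme \<Rightarrow> ('k, ('k, 'm, 'n) tens) module"
  where "balanced_tensor K B ra la M N =
    quot_module (free_module K (carrier M \<times> carrier N)) (tensor_kernel K B ra la M N)"

definition balanced_pure ::
    "('k, 'r) ring_scheme \<Rightarrow> 'b set \<Rightarrow> ('m \<Rightarrow> 'b \<Rightarrow> 'm) \<Rightarrow> ('b \<Rightarrow> 'n \<Rightarrow> 'n) \<Rightarrow>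
     ('k, 'm, 'x) module_scheme \<Rightarrow> ('k, 'n, 'y) module_scheme \<Rightarrow> 'm \<Rightarrow> 'n \<Rightarrow> ('k, 'm, 'n) tens"
  where "balanced_pure K B ra la M N m n =
    tensor_kernel K B ra la M N +>\<^bsub>free_module K (carrier M \<times> carrier N)\<^esub> free_basis K (m, n)"

text \<open>\<open>M \<otimes>\<^sub>K N\<close> and its elements \<open>m \<otimes> n\<close>.\<close>

definition tensor ::
    "('k, 'r) ring_scheme \<Rightarrow> ('k, 'm, 'x) module_scheme \<Rightarrow> ('k, 'n, 'y) module_scheme \<Rightarrow>
     ('k, ('k, 'm, 'n) tens) module"
  where "tensor K M N = balanced_tensor K (carrier K) (\<lambda>m k. k \<odot>\<^bsub>M\<^esub> m) (\<lambda>k n. k \<odot>\<^bsub>N\<^esub> n) M N"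

definition pure_tensor ::
    "('k, 'r) ring_scheme \<Rightarrow> ('k, 'm, 'x) module_scheme \<Rightarrow> ('k, 'n, 'y) module_scheme \<Rightarrow>
     'm \<Rightarrow> 'n \<Rightarrow> ('k, 'm, 'n) tens"
  where "pure_tensor K M N = balanced_pure K (carrier K) (\<lambda>m k. k \<odot>\<^bsub>M\<^esub> m) (\<lambda>k n. k \<odot>\<^bsub>N\<^esub> n) M N"

text \<open>
  \<open>A \<otimes>\<^sub>B A\<close> for an algebra \<open>A\<close> that is a \<open>B\<close>-bimodule via a map \<open>h\<close> from \<open>B\<close> to \<open>A\<close>. The scalars
  \<open>B\<close> will be a subalgebra of a \<open>K\<close>-algebra and \<open>h\<close> is an algebra map, so \<open>K\<close>-bilinearity
  imposes nothing beyond being balanced over \<open>B\<close>.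
\<close>

definition self_tensor ::
    "('k, 'r) ring_scheme \<Rightarrow> 'b set \<Rightarrow> ('b \<Rightarrow> 'p) \<Rightarrow> ('k, 'p, 'x) module_scheme \<Rightarrow>
     ('k, ('k, 'p, 'p) tens) module"
  where "self_tensor K B h A =
    balanced_tensor K B (\<lambda>x b. x \<otimes>\<^bsub>A\<^esub> h b) (\<lambda>b y. h b \<otimes>\<^bsub>A\<^esub> y) A A"

definition self_pure ::
    "('k, 'r) ring_scheme \<Rightarrow> 'b set \<Rightarrow> ('b \<Rightarrow> 'p) \<Rightarrow> ('k, 'p, 'x) module_scheme \<Rightarrow>
     'p \<Rightarrow> 'p \<Rightarrow> ('k, 'p, 'p) tens"
  where "self_pure K B h A =
    balanced_pure K B (\<lambda>x b. x \<otimes>\<^bsub>A\<^esub> h b) (\<lambda>b y. h b \<otimes>\<^bsub>A\<^esub> y) A A"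

text \<open>
  The map out of a tensor product, with values in \<open>T\<close>, given on generators by \<open>m \<otimes> n \<mapsto> g m n\<close>. When
  \<open>g\<close> is bilinear and balanced, the extension of \<open>g\<close> to the free module is constant on each coset
  \<open>X\<close>, so that the image below is a singleton.
\<close>

definition tensor_lift ::
    "('k, 't, 'x) module_scheme \<Rightarrow> ('k, 'r) ring_scheme \<Rightarrow> ('m \<Rightarrow> 'n \<Rightarrow> 't) \<Rightarrow>
     ('k, 'm, 'n) tens \<Rightarrow> 't"
  where "tensor_lift T K g X = the_elem
    ((\<lambda>f. \<Oplus>\<^bsub>T\<^esub>s\<in>{s. f s \<noteq> \<zero>\<^bsub>K\<^esub>}. f s \<odot>\<^bsub>T\<^esub> g (fst s) (snd s)) ` X)"

text \<open>The map \<open>f \<otimes> g\<close> into \<open>M' \<otimes>\<^sub>K N'\<close>.\<close>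

definition tensor_map ::
    "('k, 'r) ring_scheme \<Rightarrow> ('k, 'm, 'x) module_scheme \<Rightarrow> ('k, 'n, 'y) module_scheme \<Rightarrow>
     ('m0 \<Rightarrow> 'm) \<Rightarrow> ('n0 \<Rightarrow> 'n) \<Rightarrow> ('k, 'm0, 'n0) tens \<Rightarrow> ('k, 'm, 'n) tens"
  where "tensor_map K M' N' f g =
    tensor_lift (tensor K M' N') K (\<lambda>m n. pure_tensor K M' N' (f m) (g n))"

text \<open>The associativity isomorphism from \<open>(L \<otimes> M) \<otimes> N\<close> to \<open>L \<otimes> (M \<otimes> N)\<close>.\<close>

definition tensor_assoc ::
    "('k, 'r) ring_scheme \<Rightarrow> ('k, 'l, 'x) module_scheme \<Rightarrow> ('k, 'm, 'y) module_scheme \<Rightarrow>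
     ('k, 'n, 'z) module_scheme \<Rightarrow> ('k, ('k, 'l, 'm) tens, 'n) tens \<Rightarrow> ('k, 'l, ('k, 'm, 'n) tens) tens"
  where "tensor_assoc K L M N =
    (let T = tensor K L (tensor K M N) in
      tensor_lift T K (\<lambda>x n.
        tensor_lift T K (\<lambda>l m. pure_tensor K L (tensor K M N) l (pure_tensor K M N m n)) x))"

text \<open>
  Flatness: tensoring with \<open>C\<close> preserves injectivity. HOL cannot quantify over all types here, so the
  test modules have carriers in \<open>(nat \<Rightarrow> 'k) set\<close>. This is no restriction: that type contains a copy
  of every quotient of \<open>K\<^sup>n\<close> for natural numbers \<open>n\<close>, and of all its submodules, and it suffices to
  test injections into finitely generated modules.
\<close>

definition flat_module :: "('k, 'r) ring_scheme \<Rightarrow> ('k, 'c, 'x) module_scheme \<Rightarrow> bool"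
  where "flat_module K C \<longleftrightarrow> module K C \<and>
    (\<forall>(M :: ('k, (nat \<Rightarrow> 'k) set) module) (N :: ('k, (nat \<Rightarrow> 'k) set) module) f.
      module K M \<and> module K N \<and> f \<in> linear_maps K M N \<and> inj_on f (carrier M) \<longrightarrow>
        inj_on (tensor_map K N C f (\<lambda>c. c)) (carrier (tensor K M C)))"


section \<open>Coalgebras and comodules\<close>

record ('k, 'c) coalg = "('k, 'c) module" +
  comult :: "'c \<Rightarrow> ('k, 'c, 'c) tens"
  counit :: "'c \<Rightarrow> 'k"

definition coalgebra :: "('k, 'r) ring_scheme \<Rightarrow> ('k, 'c, 'x) coalg_scheme \<Rightarrow> bool"
  where "coalgebra K C \<longleftrightarrow> module K C \<and>
    comult C \<in> linear_maps K C (tensor K C C) \<and>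
    counit C \<in> carrier C \<rightarrow> carrier K \<and>
    (\<forall>x\<in>carrier C. \<forall>y\<in>carrier C. counit C (x \<oplus>\<^bsub>C\<^esub> y) = counit C x \<oplus>\<^bsub>K\<^esub> counit C y) \<and>
    (\<forall>k\<in>carrier K. \<forall>x\<in>carrier C. counit C (k \<odot>\<^bsub>C\<^esub> x) = k \<otimes>\<^bsub>K\<^esub> counit C x) \<and>
    (\<forall>c\<in>carrier C.
      tensor_assoc K C C C (tensor_map K (tensor K C C) C (comult C) (\<lambda>x. x) (comult C c)) =
        tensor_map K C (tensor K C C) (\<lambda>x. x) (comult C) (comult C c)) \<and>
    (\<forall>c\<in>carrier C. tensor_lift C K (\<lambda>x y. counit C x \<odot>\<^bsub>C\<^esub> y) (comult C c) = c) \<and>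
    (\<forall>c\<in>carrier C. tensor_lift C K (\<lambda>x y. counit C y \<odot>\<^bsub>C\<^esub> x) (comult C c) = c)"

record ('k, 'p, 'c) comod = "('k, 'p) module" +
  coact :: "'p \<Rightarrow> ('k, 'p, 'c) tens"

definition right_comodule ::
    "('k, 'r) ring_scheme \<Rightarrow> ('k, 'c, 'x) coalg_scheme \<Rightarrow> ('k, 'p, 'c, 'y) comod_scheme \<Rightarrow> bool"
  where "right_comodule K C P \<longleftrightarrow> module K P \<and>
    coact P \<in> linear_maps K P (tensor K P C) \<and>
    (\<forall>p\<in>carrier P.
      tensor_assoc K P C C (tensor_map K (tensor K P C) C (coact P) (\<lambda>c. c) (coact P p)) =
        tensor_map K P (tensor K C C) (\<lambda>x. x) (comult C) (coact P p)) \<and>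
    (\<forall>p\<in>carrier P. tensor_lift P K (\<lambda>x c. counit C c \<odot>\<^bsub>P\<^esub> x) (coact P p) = p)"

text \<open>No compatibility between multiplication and coaction is required.\<close>

definition algebra_comodule ::
    "('k, 'r) ring_scheme \<Rightarrow> ('k, 'c, 'x) coalg_scheme \<Rightarrow> ('k, 'p, 'c, 'y) comod_scheme \<Rightarrow> bool"
  where "algebra_comodule K C P \<longleftrightarrow> unital_algebra K P \<and> right_comodule K C P"

text \<open>
  The condition on the coaction is \<open>\<rho>(J) \<subseteq> J \<otimes> C\<close>, where \<open>J \<otimes> C\<close> is read as a submodule of \<open>P \<otimes> C\<close>
  (the image of the abstract tensor product if \<open>C\<close> is not flat).
\<close>

definition subcomodule ::
    "('k, 'r) ring_scheme \<Rightarrow> ('k, 'c, 'x) coalg_scheme \<Rightarrow> ('k, 'p, 'c, 'y) comod_scheme \<Rightarrow>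
     'p set \<Rightarrow> bool"
  where "subcomodule K C P J \<longleftrightarrow> submodule J K P \<and>
    coact P ` J \<subseteq> submodule_span K (tensor K P C)
      {pure_tensor K P C x c | x c. x \<in> J \<and> c \<in> carrier C}"

text \<open>The quotient by an ideal and subcomodule: \<open>\<rho>(p + J) = (p\<^sub>0 + J) \<otimes> p\<^sub>1\<close>.\<close>

definition quot_comod ::
    "('k, 'r) ring_scheme \<Rightarrow> ('k, 'c, 'x) coalg_scheme \<Rightarrow> ('k, 'p, 'c, 'y) comod_scheme \<Rightarrow>
     'p set \<Rightarrow> ('k, 'p set, 'c) comod"
  where "quot_comod K C P J = module.extend (quot_module P J)
    (comod.fields (\<lambda>X. the_elem
      ((\<lambda>p. tensor_map K (quot_module P J) C (\<lambda>x. J +>\<^bsub>P\<^esub> x) (\<lambda>c. c) (coact P p)) ` X)))"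

text \<open>The left \<open>P\<close>-module structure of \<open>P \<otimes> C\<close>.\<close>

definition left_act ::
    "('k, 'r) ring_scheme \<Rightarrow> ('k, 'c, 'x) coalg_scheme \<Rightarrow> ('k, 'p, 'c, 'y) comod_scheme \<Rightarrow>
     'p \<Rightarrow> ('k, 'p, 'c) tens \<Rightarrow> ('k, 'p, 'c) tens"
  where "left_act K C P b = tensor_map K P C (\<lambda>p. b \<otimes>\<^bsub>P\<^esub> p) (\<lambda>c. c)"

definition coinvariants ::
    "('k, 'r) ring_scheme \<Rightarrow> ('k, 'c, 'x) coalg_scheme \<Rightarrow> ('k, 'p, 'c, 'y) comod_scheme \<Rightarrow> 'p set"
  where "coinvariants K C P =
    {b \<in> carrier P. \<forall>p\<in>carrier P. coact P (b \<otimes>\<^bsub>P\<^esub> p) = left_act K C P b (coact P p)}"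

definition canonical_map ::
    "('k, 'r) ring_scheme \<Rightarrow> ('k, 'c, 'x) coalg_scheme \<Rightarrow> ('k, 'p, 'c, 'y) comod_scheme \<Rightarrow>
     ('k, 'p, 'p) tens \<Rightarrow> ('k, 'p, 'c) tens"
  where "canonical_map K C P =
    tensor_lift (tensor K P C) K (\<lambda>p p'. left_act K C P p (coact P p'))"

definition coalgebra_galois ::
    "('k, 'r) ring_scheme \<Rightarrow> ('k, 'c, 'x) coalg_scheme \<Rightarrow> ('k, 'p, 'c, 'y) comod_scheme \<Rightarrow>
     'p set \<Rightarrow> bool"
  where "coalgebra_galois K C P B \<longleftrightarrow>
    algebra_comodule K C P \<and> B = coinvariants K C P \<and>
    bij_betw (canonical_map K C P)
      (carrier (self_tensor K B (\<lambda>b. b) P)) (carrier (tensor K P C))"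


section \<open>Covers\<close>

text \<open>The intersection with the carrier matters only for an empty family.\<close>

definition cover ::
    "('k, 'r) ring_scheme \<Rightarrow> ('k, 'm, 'x) module_scheme \<Rightarrow> 'i set \<Rightarrow> ('i \<Rightarrow> 'm set) \<Rightarrow> bool"
  where "cover K M I J \<longleftrightarrow> finite I \<and> (\<forall>i\<in>I. submodule (J i) K M) \<and>
    carrier M \<inter> (\<Inter>i\<in>I. J i) = {\<zero>\<^bsub>M\<^esub>}"

text \<open>
  Compatible families \<open>(m\<^sub>i)\<close>; the canonical map from \<open>M/J\<close> to \<open>M/N\<close>, for \<open>J\<close> contained in \<open>N\<close>, sends
  a coset \<open>X\<close> to the union of the cosets \<open>N + x\<close> with \<open>x\<close> in \<open>X\<close>.
\<close>

definition glued_families ::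
    "('k, 'm, 'x) module_scheme \<Rightarrow> 'i set \<Rightarrow> ('i \<Rightarrow> 'm set) \<Rightarrow> ('i \<Rightarrow> 'm set) set"
  where "glued_families M I J = {m \<in> (\<Pi>\<^sub>E i\<in>I. carrier (quot_module M (J i))).
    \<forall>i\<in>I. \<forall>j\<in>I.
      (\<Union>x\<in>m i. (J i <+>\<^bsub>M\<^esub> J j) +>\<^bsub>M\<^esub> x) = (\<Union>x\<in>m j. (J i <+>\<^bsub>M\<^esub> J j) +>\<^bsub>M\<^esub> x)}"

definition complete_cover ::
    "('k, 'r) ring_scheme \<Rightarrow> ('k, 'm, 'x) module_scheme \<Rightarrow> 'i set \<Rightarrow> ('i \<Rightarrow> 'm set) \<Rightarrow> bool"
  where "complete_cover K M I J \<longleftrightarrow> cover K M I J \<and>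
    (\<lambda>x. \<lambda>i\<in>I. J i +>\<^bsub>M\<^esub> x) ` carrier M = glued_families M I J"


section \<open>Locally coalgebra Galois extensions\<close>

definition locally_coalgebra_galois ::
    "('k, 'r) ring_scheme \<Rightarrow> ('k, 'c, 'x) coalg_scheme \<Rightarrow> ('k, 'p, 'c, 'y) comod_scheme \<Rightarrow>
     'p set \<Rightarrow> 'i set \<Rightarrow> ('i \<Rightarrow> 'p set) \<Rightarrow> bool"
  where "locally_coalgebra_galois K C P B I J \<longleftrightarrow>
    algebra_comodule K C P \<and> B = coinvariants K C P \<and>
    (\<forall>i\<in>I. ideal (J i) P \<and> subcomodule K C P (J i)) \<and> complete_cover K P I J \<and>
    (\<forall>i\<in>I. (\<lambda>b. J i +>\<^bsub>P\<^esub> b) ` B = coinvariants K C (quot_comod K C P (J i)) \<and>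
      coalgebra_galois K C (quot_comod K C P (J i)) ((\<lambda>b. J i +>\<^bsub>P\<^esub> b) ` B)) \<and>
    (\<forall>i\<in>I. \<forall>j\<in>I. (\<lambda>b. (J i <+>\<^bsub>P\<^esub> J j) +>\<^bsub>P\<^esub> b) ` B =
      coinvariants K C (quot_comod K C P (J i <+>\<^bsub>P\<^esub> J j)))"

text \<open>
  The kernel of \<open>\<pi> \<otimes>\<^sub>B \<pi>\<close> from \<open>P \<otimes>\<^sub>B P\<close> to \<open>(P/J) \<otimes>\<^sub>B (P/J)\<close>, where \<open>\<pi>\<close> is the projection to \<open>P/J\<close>
  and \<open>B\<close> acts on \<open>P/J\<close> via \<open>\<pi>\<close>.
\<close>

definition proj_tensor_ker ::
    "('k, 'r) ring_scheme \<Rightarrow> ('k, 'p, 'x) module_scheme \<Rightarrow> 'p set \<Rightarrow> 'p set \<Rightarrow> ('k, 'p, 'p) tens set"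
  where "proj_tensor_ker K P B J =
    (let Q = quot_module P J; \<pi> = (\<lambda>x. J +>\<^bsub>P\<^esub> x) in
      a_kernel (self_tensor K B (\<lambda>b. b) P) (self_tensor K B \<pi> Q)
        (tensor_lift (self_tensor K B \<pi> Q) K (\<lambda>x y. self_pure K B \<pi> Q (\<pi> x) (\<pi> y))))"

definition kernel_sum_condition ::
    "('k, 'r) ring_scheme \<Rightarrow> ('k, 'p, 'x) module_scheme \<Rightarrow> 'p set \<Rightarrow> 'i set \<Rightarrow> ('i \<Rightarrow> 'p set) \<Rightarrow> bool"
  where "kernel_sum_condition K P B I J \<longleftrightarrow> (\<forall>i\<in>I. \<forall>j\<in>I.
    proj_tensor_ker K P B (J i <+>\<^bsub>P\<^esub> J j) =
      proj_tensor_ker K P B (J i) <+>\<^bsub>self_tensor K B (\<lambda>b. b) P\<^esub> proj_tensor_ker K P B (J j))"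

end

theory Submission
  imports Defs
begin

text \<open>
  Let \<open>K\<^sub>i\<close> be the kernel of \<open>\<pi>\<^sub>i \<otimes> id\<close> on \<open>P \<otimes> C\<close> and \<open>N\<^sub>i\<close> that of \<open>\<pi>\<^sub>i \<otimes>\<^sub>B \<pi>\<^sub>i\<close>. Since the canonical
  maps of the \<open>P\<^sub>i\<close> are bijective, \<open>N\<^sub>i\<close> is the preimage of \<open>K\<^sub>i\<close> under the canonical map \<open>can\<close> of
  \<open>P\<close>, and \<open>P \<otimes> C = im can + K\<^sub>i\<close>. The kernel of \<open>can\<close> is thus contained in the intersection of the
  \<open>N\<^sub>i\<close>. Moreover \<open>im can\<close> is a left \<open>P\<close>-submodule and \<open>K\<^sub>i = J\<^sub>i (P \<otimes> C)\<close>, so iterating gives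
  \<open>P \<otimes> C = im can + J\<^sub>1 \<cdots> J\<^sub>n (P \<otimes> C) = im can\<close>: the canonical map is surjective in every case.
  The condition on the sums of kernels holds in every case too, by right exactness.

  If \<open>C\<close> is flat, the equational criterion allows one to choose, for finitely many elements of
  \<open>P \<otimes> C\<close>, common second factors so that prescribed linear relations modulo ideals hold between the
  first factors. This carries the completeness of \<open>(J\<^sub>i)\<close> over to \<open>(K\<^sub>i)\<close>, and \<open>can\<close> carries it back
  to \<open>(N\<^sub>i)\<close>.
\<close>

section \<open>Linear maps, submodules and quotient modules\<close>

text \<open>The definition of flatness tests injections between modules carried by one fixed type,
  whereas \<open>P\<close>, its quotients and their tensor products live in other types, so exact
  sequences of arbitrary modules cannot be tensored with \<open>C\<close> directly. The equational
  criterion removes this obstacle: it turns the vanishing of one finite sum into finitely many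
  linear equations with coefficients in \<open>K\<close>, and these make sense in modules over any
  type. In these terms completeness of a cover is a finite system of congruences, and solving it in
  P \<otimes> C amounts to solving it for each first factor separately.

  No multiplicativity of the coaction is available, so P \<otimes> C is treated only as a left
  P-module. This suffices for surjectivity: p \<otimes> c = p(1 \<otimes> c), and if 1 \<otimes> c
  agrees with an element of im can modulo \<open>J\<^sub>j (P \<otimes> C)\<close>, then multiplying
  by p from an ideal L leaves an error in \<open>L J\<^sub>j (P \<otimes> C)\<close> only.\<close>

lemma (in abelian_group) minus_eq_zero_iff:
  assumes "x \<in> carrier G" "y \<in> carrier G"
  shows "x \<ominus> y = \<zero> \<longleftrightarrow> x = y"
  using assms add.inv_solve_right'[of \<zero> x y] by (auto simp: a_minus_def r_neg)

lemma linear_mapsI: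
  assumes "\<And>x. x \<in> carrier M \<Longrightarrow> f x \<in> carrier N"
    and "\<And>x y. x \<in> carrier M \<Longrightarrow> y \<in> carrier M \<Longrightarrow> f (x \<oplus>\<^bsub>M\<^esub> y) = f x \<oplus>\<^bsub>N\<^esub> f y"
    and "\<And>k x. k \<in> carrier K \<Longrightarrow> x \<in> carrier M \<Longrightarrow> f (k \<odot>\<^bsub>M\<^esub> x) = k \<odot>\<^bsub>N\<^esub> f x"
  shows "f \<in> linear_maps K M N"
  using assms by (auto simp: linear_maps_def)

lemma linear_maps_closed: "f \<in> linear_maps K M N \<Longrightarrow> x \<in> carrier M \<Longrightarrow> f x \<in> carrier N"
  and linear_maps_add: "f \<in> linear_maps K M N \<Longrightarrow> x \<in> carrier M \<Longrightarrow> y \<in> carrier M \<Longrightarrow>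
    f (x \<oplus>\<^bsub>M\<^esub> y) = f x \<oplus>\<^bsub>N\<^esub> f y"
  and linear_maps_smult: "f \<in> linear_maps K M N \<Longrightarrow> k \<in> carrier K \<Longrightarrow> x \<in> carrier M \<Longrightarrow>
    f (k \<odot>\<^bsub>M\<^esub> x) = k \<odot>\<^bsub>N\<^esub> f x"
  by (auto simp: linear_maps_def)

lemma linear_maps_comp:
  "f \<in> linear_maps K L M \<Longrightarrow> g \<in> linear_maps K M N \<Longrightarrow> (\<lambda>x. g (f x)) \<in> linear_maps K L N"
  by (auto simp: linear_maps_def Pi_iff)

lemma linear_maps_id: "(\<lambda>x. x) \<in> linear_maps K M M"
  by (auto simp: linear_maps_def)

text \<open>Bridge to the homomorphism locale of HOL-Algebra, from which preservation of zero and of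
  inverses is taken.\<close>

lemma linear_maps_abelian_group_hom:
  assumes "module K M" "module K N" "f \<in> linear_maps K M N"
  shows "abelian_group_hom M N f"
proof -
  interpret M: module K M by fact
  interpret N: module K N by fact
  show ?thesis
    using assms(3) by (intro abelian_group_homI M.abelian_group_axioms N.abelian_group_axioms group_hom.intro
      group_hom_axioms.intro M.a_group N.a_group) (auto simp: hom_def linear_maps_def)
qed

lemma linear_maps_zero:
  "module K M \<Longrightarrow> module K N \<Longrightarrow> f \<in> linear_maps K M N \<Longrightarrow> f \<zero>\<^bsub>M\<^esub> = \<zero>\<^bsub>N\<^esub>"
  by (rule abelian_group_hom.hom_zero[OF linear_maps_abelian_group_hom])

lemma linear_maps_a_inv:
  "module K M \<Longrightarrow> module K N \<Longrightarrow> f \<in> linear_maps K M N \<Longrightarrow> x \<in> carrier M \<Longrightarrow>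
    f (\<ominus>\<^bsub>M\<^esub> x) = \<ominus>\<^bsub>N\<^esub> f x"
  by (rule abelian_group_hom.hom_a_inv[OF linear_maps_abelian_group_hom])

lemma linear_maps_minus:
  assumes "module K M" "module K N" "f \<in> linear_maps K M N" "x \<in> carrier M" "y \<in> carrier M"
  shows "f (x \<ominus>\<^bsub>M\<^esub> y) = f x \<ominus>\<^bsub>N\<^esub> f y"
proof -
  interpret M: module K M by fact
  show ?thesis
    using assms by (simp add: a_minus_def linear_maps_add linear_maps_a_inv)
qed

lemma linear_maps_finsum:
  assumes "module K M" "module K N" "f \<in> linear_maps K M N" "finite A" "u \<in> A \<rightarrow> carrier M"
  shows "f (\<Oplus>\<^bsub>M\<^esub>i\<in>A. u i) = (\<Oplus>\<^bsub>N\<^esub>i\<in>A. f (u i))"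
proof -
  interpret M: module K M by fact
  interpret N: module K N by fact
  show ?thesis
    using assms(4,5)
  proof (induction rule: finite_induct)
    case empty
    then show ?case by (simp add: linear_maps_zero[OF assms(1-3)])
  next
    case (insert a A)
    then have "(\<lambda>i. f (u i)) \<in> A \<rightarrow> carrier N"
      using linear_maps_closed[OF assms(3)] by auto
    with insert show ?case
      by (simp add: Pi_iff linear_maps_add[OF assms(3)] linear_maps_closed[OF assms(3)])
  qed
qed

lemma linear_kernel_submodule:
  assumes "module K M" "module K N" "f \<in> linear_maps K M N"
  shows "submodule {x \<in> carrier M. f x = \<zero>\<^bsub>N\<^esub>} K M"
proof -
  interpret M: module K M by fact
  interpret N: module K N by fact
  show ?thesis
    by (rule M.submoduleI)
      (auto simp: linear_maps_zero[OF assms] linear_maps_a_inv[OF assms] linear_maps_add[OF assms(3)]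
        linear_maps_smult[OF assms(3)])
qed

section \<open>Submodules and generated submodules\<close>

lemma submodule_subset: "submodule N K M \<Longrightarrow> N \<subseteq> carrier M"
  by (rule subgroup.subset[of _ "add_monoid M", simplified]) (rule submodule.axioms)

lemma submodule_zero: "submodule N K M \<Longrightarrow> \<zero>\<^bsub>M\<^esub> \<in> N"
  using subgroup.one_closed[OF submodule.axioms(1)] by fastforce

lemma submodule_add: "submodule N K M \<Longrightarrow> x \<in> N \<Longrightarrow> y \<in> N \<Longrightarrow> x \<oplus>\<^bsub>M\<^esub> y \<in> N"
  using subgroup.m_closed[OF submodule.axioms(1)] by fastforce

lemma linear_preimage_submodule:
  assumes "module K M" "module K N" "f \<in> linear_maps K M N" "submodule L K N"
  shows "submodule {x \<in> carrier M. f x \<in> L} K M"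
proof -
  interpret M: module K M by fact
  show ?thesis
    by (rule M.submoduleI)
      (auto simp: linear_maps_zero[OF assms(1-3)] linear_maps_a_inv[OF assms(1-3)]
        linear_maps_add[OF assms(3)] linear_maps_smult[OF assms(3)] module.submoduleE(6)[OF assms(2,4)]
        submodule_zero[OF assms(4)] submodule_add[OF assms(4)] submodule.smult_closed[OF assms(4)])
qed

lemma submodule_abelian_subgroup:
  assumes "module K M" "submodule N K M"
  shows "abelian_subgroup N M"
proof -
  interpret M: module K M by fact
  show ?thesis
    using assms(2)
    by (intro abelian_subgroupI3 additive_subgroup.intro M.abelian_group_axioms submodule.axioms)
qed

lemma span_incl: "S \<subseteq> submodule_span K M S"
  by (auto simp: submodule_span_def)

lemma span_least: "submodule N K M \<Longrightarrow> S \<subseteq> N \<Longrightarrow> submodule_span K M S \<subseteq> N"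
  by (auto simp: submodule_span_def)

text \<open>The inclusion in the carrier makes the carrier itself a member of the intersected
  family. Otherwise no submodule would contain \<open>S\<close>, and the intersection over the empty
  family is the whole type.\<close>

lemma span_submodule:
  assumes "module K M" "S \<subseteq> carrier M"
  shows "submodule (submodule_span K M S) K M"
proof -
  interpret M: module K M by fact
  have "submodule_span K M S \<subseteq> carrier M"
    using M.carrier_is_submodule assms(2) by (rule span_least)
  then show ?thesis
    by (intro M.submoduleI) (auto simp: submodule_span_def submodule_zero submodule_add
        submodule.smult_closed M.submoduleE(6))
qed

section \<open>Cosets and quotient modules\<close>

lemma coset_eq_iff:
  assumes "module K M" "submodule N K M" "x \<in> carrier M" "y \<in> carrier M"
  shows "N +>\<^bsub>M\<^esub> x = N +>\<^bsub>M\<^esub> y \<longleftrightarrow> x \<ominus>\<^bsub>M\<^esub> y \<in> N"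
proof -
  interpret M: module K M by fact
  interpret N: abelian_subgroup N M
    using assms(1,2) by (rule submodule_abelian_subgroup)
  have "N +>\<^bsub>M\<^esub> x = N +>\<^bsub>M\<^esub> y \<longleftrightarrow> x \<in> N +>\<^bsub>M\<^esub> y"
    using assms(3,4) N.a_rcos_self N.a_repr_independence' by blast
  also have "\<dots> \<longleftrightarrow> x \<ominus>\<^bsub>M\<^esub> y \<in> N"
    using N.a_rcos_module[OF assms(4,3)] by (simp add: a_minus_def)
  finally show ?thesis .
qed

lemma mem_coset_iff:
  assumes "module K M" "submodule N K M" "y \<in> carrier M"
  shows "x \<in> N +>\<^bsub>M\<^esub> y \<longleftrightarrow> x \<in> carrier M \<and> N +>\<^bsub>M\<^esub> x = N +>\<^bsub>M\<^esub> y"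
proof -
  interpret M: module K M by fact
  interpret N: abelian_subgroup N M
    using assms(1,2) by (rule submodule_abelian_subgroup)
  show ?thesis
    using assms(3) N.a_rcos_self N.a_repr_independence' N.a_elemrcos_carrier by metis
qed

lemma quot_carrier: "carrier (quot_module M N) = (\<lambda>x. N +>\<^bsub>M\<^esub> x) ` carrier M"
  by (auto simp: quot_module_def FactRing_def A_RCOSETS_def')

lemma quot_zero: "\<zero>\<^bsub>quot_module M N\<^esub> = N"
  by (simp add: quot_module_def FactRing_def)

lemma quot_add:
  assumes "module K M" "submodule N K M" "x \<in> carrier M" "y \<in> carrier M"
  shows "(N +>\<^bsub>M\<^esub> x) \<oplus>\<^bsub>quot_module M N\<^esub> (N +>\<^bsub>M\<^esub> y) = N +>\<^bsub>M\<^esub> (x \<oplus>\<^bsub>M\<^esub> y)"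
  using abelian_subgroup.a_rcos_sum[OF submodule_abelian_subgroup[OF assms(1,2)] assms(3,4)]
  by (simp add: quot_module_def FactRing_def)

text \<open>Operations on quotients are defined as unions over all representatives of a coset; if
  the terms do not depend on the representative, the union collapses to one of them. Applied to
  scalar multiplication and to the canonical maps M/N \<rightarrow> M/L in
  \<open>glued_families\<close>.\<close>

lemma UN_coset_const:
  assumes "module K M" "submodule N K M" "x \<in> carrier M"
    and "\<And>y. y \<in> carrier M \<Longrightarrow> N +>\<^bsub>M\<^esub> y = N +>\<^bsub>M\<^esub> x \<Longrightarrow> g y = g x"
  shows "(\<Union>y\<in>N +>\<^bsub>M\<^esub> x. g y) = g x"
proof -
  have "g y = g x" if "y \<in> N +>\<^bsub>M\<^esub> x" for y
    using that assms(4) mem_coset_iff[OF assms(1-3)] by blast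
  moreover have "x \<in> N +>\<^bsub>M\<^esub> x"
    using assms(3) mem_coset_iff[OF assms(1-3)] by blast
  ultimately show ?thesis
    by blast
qed

lemma quot_smult:
  assumes "module K M" "submodule N K M" "k \<in> carrier K" "x \<in> carrier M"
  shows "k \<odot>\<^bsub>quot_module M N\<^esub> (N +>\<^bsub>M\<^esub> x) = N +>\<^bsub>M\<^esub> (k \<odot>\<^bsub>M\<^esub> x)"
proof -
  interpret M: module K M by fact
  have "N +>\<^bsub>M\<^esub> (k \<odot>\<^bsub>M\<^esub> y) = N +>\<^bsub>M\<^esub> (k \<odot>\<^bsub>M\<^esub> x)"
    if "y \<in> carrier M" "N +>\<^bsub>M\<^esub> y = N +>\<^bsub>M\<^esub> x" for y
  proof -
    have "k \<odot>\<^bsub>M\<^esub> (y \<ominus>\<^bsub>M\<^esub> x) \<in> N"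
      using that assms by (auto simp: coset_eq_iff intro: submodule.smult_closed)
    also have "k \<odot>\<^bsub>M\<^esub> (y \<ominus>\<^bsub>M\<^esub> x) = k \<odot>\<^bsub>M\<^esub> y \<ominus>\<^bsub>M\<^esub> k \<odot>\<^bsub>M\<^esub> x"
      using that assms by (simp add: a_minus_def M.smult_r_distr M.smult_r_minus)
    finally show ?thesis
      using that assms by (subst coset_eq_iff) auto
  qed
  then show ?thesis
    using UN_coset_const[OF assms(1,2,4), of "\<lambda>x. N +>\<^bsub>M\<^esub> (k \<odot>\<^bsub>M\<^esub> x)"]
    by (simp add: quot_module_def)
qed

lemma coset_zero:
  assumes "module K M" "submodule N K M"
  shows "N +>\<^bsub>M\<^esub> \<zero>\<^bsub>M\<^esub> = N"
proof -
  interpret M: module K M by fact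
  show ?thesis
    using submodule_subset[OF assms(2)] by simp
qed

lemma coset_eq_zero_iff:
  assumes "module K M" "submodule N K M" "x \<in> carrier M"
  shows "N +>\<^bsub>M\<^esub> x = \<zero>\<^bsub>quot_module M N\<^esub> \<longleftrightarrow> x \<in> N"
proof -
  interpret M: module K M by fact
  have "x \<ominus>\<^bsub>M\<^esub> \<zero>\<^bsub>M\<^esub> = x"
    using assms(3) by (simp add: a_minus_def)
  then show ?thesis
    using coset_eq_iff[OF assms M.zero_closed] by (simp add: quot_zero coset_zero[OF assms(1,2)])
qed

lemma quot_module_module:
  assumes "module K M" "submodule N K M"
  shows "module K (quot_module M N)"
proof -
  interpret M: module K M by fact
  note [simp] = quot_add[OF assms] quot_smult[OF assms]
  have z: "\<zero>\<^bsub>quot_module M N\<^esub> = N +>\<^bsub>M\<^esub> \<zero>\<^bsub>M\<^esub>"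
    by (simp add: quot_zero coset_zero[OF assms])
  show ?thesis
  proof (rule moduleI[OF M.is_cring abelian_groupI])
    fix X assume "X \<in> carrier (quot_module M N)"
    then obtain x where "x \<in> carrier M" "X = N +>\<^bsub>M\<^esub> x"
      by (auto simp: quot_carrier)
    then show "\<exists>Y\<in>carrier (quot_module M N). Y \<oplus>\<^bsub>quot_module M N\<^esub> X = \<zero>\<^bsub>quot_module M N\<^esub>"
      by (intro bexI[of _ "N +>\<^bsub>M\<^esub> (\<ominus>\<^bsub>M\<^esub> x)"]) (auto simp: quot_carrier z M.l_neg)
  next
    show "\<zero>\<^bsub>quot_module M N\<^esub> \<in> carrier (quot_module M N)"
      by (auto simp: quot_carrier z)
  qed (auto simp: quot_carrier z M.a_ac M.smult_l_distr M.smult_r_distr M.smult_assoc1)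
qed

lemma coset_linear:
  assumes "module K M" "submodule N K M"
  shows "(\<lambda>x. N +>\<^bsub>M\<^esub> x) \<in> linear_maps K M (quot_module M N)"
  by (rule linear_mapsI) (auto simp: quot_carrier quot_add[OF assms] quot_smult[OF assms])

lemma a_kernel_eq: "a_kernel G H h = {x \<in> carrier G. h x = \<zero>\<^bsub>H\<^esub>}"
  by (simp add: a_kernel_def kernel_def)

section \<open>Sums of submodules\<close>

lemma set_add_iff: "x \<in> A <+>\<^bsub>M\<^esub> B \<longleftrightarrow> (\<exists>a\<in>A. \<exists>b\<in>B. x = a \<oplus>\<^bsub>M\<^esub> b)"
  by (auto simp: set_add_def')

lemma set_add_submodule:
  assumes "module K M" "submodule N K M" "submodule L K M"
  shows "submodule (N <+>\<^bsub>M\<^esub> L) K M"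
proof -
  interpret M: module K M by fact
  have sub: "N \<subseteq> carrier M" "L \<subseteq> carrier M"
    using assms by (auto dest: submodule_subset)
  show ?thesis
  proof (rule M.submoduleI)
    show "N <+>\<^bsub>M\<^esub> L \<subseteq> carrier M"
      using sub by (auto simp: set_add_iff subset_iff)
    show "\<zero>\<^bsub>M\<^esub> \<in> N <+>\<^bsub>M\<^esub> L"
      using submodule_zero[OF assms(2)] submodule_zero[OF assms(3)] M.l_zero[OF M.zero_closed]
      unfolding set_add_iff by metis
    fix x assume "x \<in> N <+>\<^bsub>M\<^esub> L"
    then obtain n l where x: "n \<in> N" "l \<in> L" "x = n \<oplus>\<^bsub>M\<^esub> l"
      by (auto simp: set_add_iff)
    show "\<ominus>\<^bsub>M\<^esub> x \<in> N <+>\<^bsub>M\<^esub> L"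
      using x M.submoduleE(6)[OF assms(2)] M.submoduleE(6)[OF assms(3)] sub
      by (auto simp: set_add_iff M.minus_add subset_iff)
    show "k \<odot>\<^bsub>M\<^esub> x \<in> N <+>\<^bsub>M\<^esub> L" if "k \<in> carrier K" for k
      using x that submodule.smult_closed[OF assms(2)] submodule.smult_closed[OF assms(3)] sub
      unfolding set_add_iff x(3) by (metis M.smult_r_distr subsetD)
    fix y assume "y \<in> N <+>\<^bsub>M\<^esub> L"
    then obtain n' l' where y: "n' \<in> N" "l' \<in> L" "y = n' \<oplus>\<^bsub>M\<^esub> l'"
      by (auto simp: set_add_iff)
    have "x \<oplus>\<^bsub>M\<^esub> y = (n \<oplus>\<^bsub>M\<^esub> n') \<oplus>\<^bsub>M\<^esub> (l \<oplus>\<^bsub>M\<^esub> l')"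
      using x y sub by (simp add: M.a_ac subset_iff)
    then show "x \<oplus>\<^bsub>M\<^esub> y \<in> N <+>\<^bsub>M\<^esub> L"
      using x(1,2) y(1,2) submodule_add[OF assms(2)] submodule_add[OF assms(3)]
      unfolding set_add_iff by blast
  qed
qed

lemma set_add_incl:
  assumes "module K M" "submodule N K M" "submodule L K M"
  shows "N \<subseteq> N <+>\<^bsub>M\<^esub> L" "L \<subseteq> N <+>\<^bsub>M\<^esub> L"
proof -
  interpret M: module K M by fact
  show "N \<subseteq> N <+>\<^bsub>M\<^esub> L" "L \<subseteq> N <+>\<^bsub>M\<^esub> L"
    using submodule_subset[OF assms(2)] submodule_subset[OF assms(3)]
      submodule_zero[OF assms(2)] submodule_zero[OF assms(3)]
    by (force simp: set_add_iff subset_iff)+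
qed

section \<open>Free modules\<close>

lemma free_carrier: "f \<in> carrier (free_module K S) \<longleftrightarrow>
    (\<forall>s. f s \<in> carrier K) \<and> finite {s. f s \<noteq> \<zero>\<^bsub>K\<^esub>} \<and> (\<forall>s. s \<notin> S \<longrightarrow> f s = \<zero>\<^bsub>K\<^esub>)"
  and free_zero: "\<zero>\<^bsub>free_module K S\<^esub> = (\<lambda>s. \<zero>\<^bsub>K\<^esub>)"
  and free_add: "f \<oplus>\<^bsub>free_module K S\<^esub> g = (\<lambda>s. f s \<oplus>\<^bsub>K\<^esub> g s)"
  and free_smult: "k \<odot>\<^bsub>free_module K S\<^esub> f = (\<lambda>s. k \<otimes>\<^bsub>K\<^esub> f s)"
  by (simp_all add: free_module_def)

lemma free_module_module:
  assumes "cring K"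
  shows "module K (free_module K S)"
proof -
  interpret cring K by fact
  have fin: "finite {s. f s \<oplus>\<^bsub>K\<^esub> g s \<noteq> \<zero>\<^bsub>K\<^esub>}"
    if "finite {s. f s \<noteq> \<zero>\<^bsub>K\<^esub>}" "finite {s. g s \<noteq> \<zero>\<^bsub>K\<^esub>}" for f g :: "'c \<Rightarrow> 'a"
    using that by (rule_tac finite_subset[of _ "{s. f s \<noteq> \<zero>\<^bsub>K\<^esub>} \<union> {s. g s \<noteq> \<zero>\<^bsub>K\<^esub>}"]) auto
  show ?thesis
  proof (rule moduleI[OF assms abelian_groupI])
    fix f assume f: "f \<in> carrier (free_module K S)"
    have "finite {s. \<ominus>\<^bsub>K\<^esub> f s \<noteq> \<zero>\<^bsub>K\<^esub>}"
      using f by (rule_tac finite_subset[of _ "{s. f s \<noteq> \<zero>\<^bsub>K\<^esub>}"]) (auto simp: free_carrier)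
    then show "\<exists>g\<in>carrier (free_module K S). g \<oplus>\<^bsub>free_module K S\<^esub> f = \<zero>\<^bsub>free_module K S\<^esub>"
      using f by (intro bexI[of _ "\<lambda>s. \<ominus>\<^bsub>K\<^esub> f s"]) (auto simp: free_carrier free_add free_zero l_neg)
  next
    fix k f assume f: "f \<in> carrier (free_module K S)" and k: "k \<in> carrier K"
    have "finite {s. k \<otimes>\<^bsub>K\<^esub> f s \<noteq> \<zero>\<^bsub>K\<^esub>}"
      using f k by (rule_tac finite_subset[of _ "{s. f s \<noteq> \<zero>\<^bsub>K\<^esub>}"]) (auto simp: free_carrier)
    then show "k \<odot>\<^bsub>free_module K S\<^esub> f \<in> carrier (free_module K S)"
      using f k by (auto simp: free_carrier free_smult)
  qed (auto simp: free_carrier free_zero free_add free_smult fin a_ac l_distr r_distr m_assoc)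
qed

lemma free_basis_carrier:
  assumes "cring K" "s \<in> S"
  shows "free_basis K s \<in> carrier (free_module K S)"
proof -
  interpret cring K by fact
  have "{t. free_basis K s t \<noteq> \<zero>\<^bsub>K\<^esub>} \<subseteq> {s}"
    by (auto simp: free_basis_def)
  then show ?thesis
    using assms(2) finite_subset by (fastforce simp: free_carrier free_basis_def)
qed

text \<open>Induction on the support: resetting the value at one point \<open>s\<close> of the
  support to zero leaves a function with smaller support, and the difference is \<open>f s\<close>
  times the basis vector at \<open>s\<close>.\<close>

lemma free_induct [consumes 2, case_names zero add]:
  assumes "cring K" "f \<in> carrier (free_module K S)"
    and "Q \<zero>\<^bsub>free_module K S\<^esub>"
    and "\<And>f k s. f \<in> carrier (free_module K S) \<Longrightarrow> Q f \<Longrightarrow> k \<in> carrier K \<Longrightarrow> s \<in> S \<Longrightarrow>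
      Q (f \<oplus>\<^bsub>free_module K S\<^esub> (k \<odot>\<^bsub>free_module K S\<^esub> free_basis K s))"
  shows "Q f"
proof -
  interpret cring K by fact
  have "finite A \<Longrightarrow> {s. f s \<noteq> \<zero>\<^bsub>K\<^esub>} = A \<Longrightarrow> f \<in> carrier (free_module K S) \<Longrightarrow> Q f" for A f
  proof (induction A arbitrary: f rule: finite_induct)
    case empty
    then have "f = \<zero>\<^bsub>free_module K S\<^esub>"
      by (auto simp: free_zero)
    then show ?case
      using assms(3) by simp
  next
    case (insert s A)
    define g where "g = f(s := \<zero>\<^bsub>K\<^esub>)"
    have supp: "{s. g s \<noteq> \<zero>\<^bsub>K\<^esub>} = A"
      using insert by (auto simp: g_def)
    then have g: "g \<in> carrier (free_module K S)"
      using insert by (auto simp: free_carrier g_def)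
    have f: "f s \<in> carrier K" "s \<in> S"
      using insert by (auto simp: free_carrier)
    have "f = g \<oplus>\<^bsub>free_module K S\<^esub> (f s \<odot>\<^bsub>free_module K S\<^esub> free_basis K s)"
    proof
      fix t
      show "f t = (g \<oplus>\<^bsub>free_module K S\<^esub> (f s \<odot>\<^bsub>free_module K S\<^esub> free_basis K s)) t"
        using insert.prems(2) by (cases "t = s") (auto simp: free_add free_smult free_basis_def g_def free_carrier)
    qed
    then show ?case
      using assms(4)[OF g _ f] insert.IH[OF supp g] by simp
  qed
  then show ?thesis
    using assms(2) by (auto simp: free_carrier)
qed

text \<open>The sum inside \<open>tensor_lift\<close>, isolated so that it can be studied as a
  linear map on the whole free module before passing to cosets.\<close>

definition free_ext ::
    "('k, 'r) ring_scheme \<Rightarrow> ('k, 't, 'x) module_scheme \<Rightarrow> ('s \<Rightarrow> 't) \<Rightarrow> ('s \<Rightarrow> 'k) \<Rightarrow> 't"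
  where "free_ext K T u f = (\<Oplus>\<^bsub>T\<^esub>s\<in>{s. f s \<noteq> \<zero>\<^bsub>K\<^esub>}. f s \<odot>\<^bsub>T\<^esub> u s)"

text \<open>The defining sum runs over the support, which changes under addition and scaling. Over a
  larger finite set the extra terms vanish, so several functions can be summed over one common index
  set.\<close>

lemma free_ext_eq:
  assumes "module K T" "u \<in> S \<rightarrow> carrier T" "f \<in> carrier (free_module K S)"
    and "finite A" "{s. f s \<noteq> \<zero>\<^bsub>K\<^esub>} \<subseteq> A" "A \<subseteq> S"
  shows "free_ext K T u f = (\<Oplus>\<^bsub>T\<^esub>s\<in>A. f s \<odot>\<^bsub>T\<^esub> u s)"
proof -
  interpret T: module K T by fact
  show ?thesis
    unfolding free_ext_def
  proof (rule T.add.finprod_mono_neutral_cong_left[OF assms(4,5)])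
    fix s assume "s \<in> A - {s. f s \<noteq> \<zero>\<^bsub>K\<^esub>}"
    then show "f s \<odot>\<^bsub>T\<^esub> u s = \<zero>\<^bsub>T\<^esub>"
      using assms(2,6) by (auto simp: Pi_iff subset_iff)
  qed (use assms in \<open>auto simp: free_carrier Pi_iff subset_iff\<close>)
qed

lemma free_support:
  assumes "f \<in> carrier (free_module K S)"
  shows "finite {s. f s \<noteq> \<zero>\<^bsub>K\<^esub>}" "{s. f s \<noteq> \<zero>\<^bsub>K\<^esub>} \<subseteq> S"
  using assms by (auto simp: free_carrier)

lemma free_ext_linear:
  assumes "module K T" "u \<in> S \<rightarrow> carrier T"
  shows "free_ext K T u \<in> linear_maps K (free_module K S) T"
proof -
  interpret T: module K T by fact
  interpret F: module K "free_module K S"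
    by (rule free_module_module) (rule T.is_cring)
  show ?thesis
  proof (rule linear_mapsI)
    fix f assume f: "f \<in> carrier (free_module K S)"
    show "free_ext K T u f \<in> carrier T"
      unfolding free_ext_def using f assms(2) by (auto simp: free_carrier Pi_iff intro!: T.finsum_closed T.smult_closed)
    let ?A = "{s. f s \<noteq> \<zero>\<^bsub>K\<^esub>}"
    note A = free_support[OF f]
    have uA: "u s \<in> carrier T" "f s \<in> carrier K" if "s \<in> ?A" for s
      using A(2) assms(2) f that by (auto simp: free_carrier Pi_iff subset_iff)
    show "free_ext K T u (k \<odot>\<^bsub>free_module K S\<^esub> f) = k \<odot>\<^bsub>T\<^esub> free_ext K T u f"
      if k: "k \<in> carrier K" for k
    proof -
      have "free_ext K T u (k \<odot>\<^bsub>free_module K S\<^esub> f) =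
          (\<Oplus>\<^bsub>T\<^esub>s\<in>?A. (k \<odot>\<^bsub>free_module K S\<^esub> f) s \<odot>\<^bsub>T\<^esub> u s)"
        using A k by (intro free_ext_eq[OF assms F.smult_closed[OF k f]]) (auto simp: free_smult)
      also have "\<dots> = (\<Oplus>\<^bsub>T\<^esub>s\<in>?A. k \<odot>\<^bsub>T\<^esub> (f s \<odot>\<^bsub>T\<^esub> u s))"
        using uA k by (intro T.finsum_cong') (auto simp: free_smult T.smult_assoc1)
      also have "\<dots> = k \<odot>\<^bsub>T\<^esub> free_ext K T u f"
        unfolding free_ext_def using uA k A by (intro T.finsum_smult_ldistr[symmetric]) auto
      finally show ?thesis .
    qed
    fix g assume g: "g \<in> carrier (free_module K S)"
    let ?B = "?A \<union> {s. g s \<noteq> \<zero>\<^bsub>K\<^esub>}"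
    have B: "finite ?B" "?B \<subseteq> S"
      using A free_support[OF g] by auto
    have uB: "u s \<in> carrier T" "f s \<in> carrier K" "g s \<in> carrier K" if "s \<in> ?B" for s
      using B(2) assms(2) f g that by (auto simp: free_carrier Pi_iff subset_iff)
    have "free_ext K T u (f \<oplus>\<^bsub>free_module K S\<^esub> g) =
        (\<Oplus>\<^bsub>T\<^esub>s\<in>?B. (f \<oplus>\<^bsub>free_module K S\<^esub> g) s \<odot>\<^bsub>T\<^esub> u s)"
      using B by (intro free_ext_eq[OF assms F.a_closed[OF f g]]) (auto simp: free_add)
    also have "\<dots> = (\<Oplus>\<^bsub>T\<^esub>s\<in>?B. f s \<odot>\<^bsub>T\<^esub> u s \<oplus>\<^bsub>T\<^esub> g s \<odot>\<^bsub>T\<^esub> u s)"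
      using uB by (intro T.finsum_cong') (auto simp: free_add T.smult_l_distr)
    also have "\<dots> = (\<Oplus>\<^bsub>T\<^esub>s\<in>?B. f s \<odot>\<^bsub>T\<^esub> u s) \<oplus>\<^bsub>T\<^esub> (\<Oplus>\<^bsub>T\<^esub>s\<in>?B. g s \<odot>\<^bsub>T\<^esub> u s)"
      using uB by (intro T.finsum_addf) auto
    also have "\<dots> = free_ext K T u f \<oplus>\<^bsub>T\<^esub> free_ext K T u g"
      using B by (simp add: free_ext_eq[OF assms f, of ?B] free_ext_eq[OF assms g, of ?B])
    finally show "free_ext K T u (f \<oplus>\<^bsub>free_module K S\<^esub> g) = free_ext K T u f \<oplus>\<^bsub>T\<^esub> free_ext K T u g" .
  qed
qed

lemma free_ext_basis:
  assumes "module K T" "u \<in> S \<rightarrow> carrier T" "s \<in> S"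
  shows "free_ext K T u (free_basis K s) = u s"
proof -
  interpret T: module K T by fact
  have "u s \<in> carrier T"
    using assms(2,3) by auto
  have "free_ext K T u (free_basis K s) = (\<Oplus>\<^bsub>T\<^esub>t\<in>{s}. free_basis K s t \<odot>\<^bsub>T\<^esub> u t)"
    using assms by (intro free_ext_eq[OF assms(1,2)] free_basis_carrier T.is_cring)
      (auto simp: free_basis_def)
  with \<open>u s \<in> carrier T\<close> show ?thesis
    by (simp add: free_basis_def)
qed

section \<open>Tensor products\<close>

text \<open>Additivity and homogeneity in each argument together with balancedness correspond to the
  five families in \<open>tensor_relations\<close>; for such a \<open>g\<close> the extension to the
  free module kills every relator.\<close>

definition balanced_bilinear ::
    "('k, 'r) ring_scheme \<Rightarrow> 'b set \<Rightarrow> ('m \<Rightarrow> 'b \<Rightarrow> 'm) \<Rightarrow> ('b \<Rightarrow> 'n \<Rightarrow> 'n) \<Rightarrow>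
     ('k, 'm, 'x) module_scheme \<Rightarrow> ('k, 'n, 'y) module_scheme \<Rightarrow> ('k, 't, 'z) module_scheme \<Rightarrow>
     ('m \<Rightarrow> 'n \<Rightarrow> 't) \<Rightarrow> bool"
  where "balanced_bilinear K B ra la M N T g \<longleftrightarrow>
    (\<forall>n\<in>carrier N. (\<lambda>m. g m n) \<in> linear_maps K M T) \<and>
    (\<forall>m\<in>carrier M. g m \<in> linear_maps K N T) \<and>
    (\<forall>m\<in>carrier M. \<forall>b\<in>B. \<forall>n\<in>carrier N. g (ra m b) n = g m (la b n))"

lemma balanced_bilinearI:
  assumes "\<And>n. n \<in> carrier N \<Longrightarrow> (\<lambda>m. g m n) \<in> linear_maps K M T"
    and "\<And>m. m \<in> carrier M \<Longrightarrow> g m \<in> linear_maps K N T"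
    and "\<And>m b n. m \<in> carrier M \<Longrightarrow> b \<in> B \<Longrightarrow> n \<in> carrier N \<Longrightarrow> g (ra m b) n = g m (la b n)"
  shows "balanced_bilinear K B ra la M N T g"
  using assms by (auto simp: balanced_bilinear_def)

lemma balanced_bilinearD:
  assumes "balanced_bilinear K B ra la M N T g"
  shows "n \<in> carrier N \<Longrightarrow> (\<lambda>m. g m n) \<in> linear_maps K M T"
    and "m \<in> carrier M \<Longrightarrow> g m \<in> linear_maps K N T"
    and "m \<in> carrier M \<Longrightarrow> b \<in> B \<Longrightarrow> n \<in> carrier N \<Longrightarrow> g (ra m b) n = g m (la b n)"
  using assms by (auto simp: balanced_bilinear_def)

lemma tensor_lift_eq: "tensor_lift T K g X = the_elem (free_ext K T (\<lambda>s. g (fst s) (snd s)) ` X)"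
  by (simp add: tensor_lift_def free_ext_def)

text \<open>Closure of both actions keeps the relators inside the free module, so that their span is
  a submodule and the quotient a module. As \<open>B\<close> is a bare set, the locale covers the
  ground ring acting by scalars as well as the coinvariants acting by multiplication.\<close>

locale balanced_pair = M: module K M + N: module K N
  for K :: "('k, 'r) ring_scheme"
    and B :: "'b set" and ra :: "'m \<Rightarrow> 'b \<Rightarrow> 'm" and la :: "'b \<Rightarrow> 'n \<Rightarrow> 'n"
    and M :: "('k, 'm, 'x) module_scheme" and N :: "('k, 'n, 'y) module_scheme" +
  assumes ra_closed: "m \<in> carrier M \<Longrightarrow> b \<in> B \<Longrightarrow> ra m b \<in> carrier M"
    and la_closed: "n \<in> carrier N \<Longrightarrow> b \<in> B \<Longrightarrow> la b n \<in> carrier N"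
begin

abbreviation "pairs \<equiv> free_module K (carrier M \<times> carrier N)"
abbreviation "ker \<equiv> tensor_kernel K B ra la M N"
abbreviation "T \<equiv> balanced_tensor K B ra la M N"
abbreviation "pure \<equiv> balanced_pure K B ra la M N"

lemma pairs_module: "module K pairs"
  by (rule free_module_module) (rule M.is_cring)

lemma basis_closed: "m \<in> carrier M \<Longrightarrow> n \<in> carrier N \<Longrightarrow> free_basis K (m, n) \<in> carrier pairs"
  by (rule free_basis_carrier) (auto intro: M.is_cring)

lemma relations_subset: "tensor_relations K B ra la M N \<subseteq> carrier pairs"
proof -
  interpret F: module K pairs by (rule pairs_module)
  show ?thesis
    unfolding tensor_relations_def Let_def
    by (auto intro!: F.minus_closed F.a_closed F.smult_closed basis_closed ra_closed la_closed)
qed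

lemma ker_submodule: "submodule ker K pairs"
  unfolding tensor_kernel_def by (rule span_submodule[OF pairs_module relations_subset])

lemma module_T: "module K T"
  unfolding balanced_tensor_def by (rule quot_module_module[OF pairs_module ker_submodule])

sublocale T: module K T
  by (rule module_T)

lemma pure_closed: "m \<in> carrier M \<Longrightarrow> n \<in> carrier N \<Longrightarrow> pure m n \<in> carrier T"
  by (auto simp: balanced_tensor_def balanced_pure_def quot_carrier intro: basis_closed)

lemma coset_eqI:
  assumes "f \<ominus>\<^bsub>pairs\<^esub> g \<in> tensor_relations K B ra la M N" "f \<in> carrier pairs" "g \<in> carrier pairs"
  shows "ker +>\<^bsub>pairs\<^esub> f = ker +>\<^bsub>pairs\<^esub> g"
  using assms span_incl[of "tensor_relations K B ra la M N" K pairs]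
  by (subst coset_eq_iff[OF pairs_module ker_submodule]) (auto simp: tensor_kernel_def)

lemma pure_bilinear: "balanced_bilinear K B ra la M N T pure"
proof -
  interpret F: module K pairs by (rule pairs_module)
  note [intro] = basis_closed ra_closed la_closed
  have a1: "pure (m \<oplus>\<^bsub>M\<^esub> m') n = pure m n \<oplus>\<^bsub>T\<^esub> pure m' n"
    if "m \<in> carrier M" "m' \<in> carrier M" "n \<in> carrier N" for m m' n
  proof -
    have "ker +>\<^bsub>pairs\<^esub> free_basis K (m \<oplus>\<^bsub>M\<^esub> m', n) =
        ker +>\<^bsub>pairs\<^esub> (free_basis K (m, n) \<oplus>\<^bsub>pairs\<^esub> free_basis K (m', n))"
      using that by (intro coset_eqI F.a_closed basis_closed M.a_closed N.a_closed M.smult_closed N.smult_closed)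
        ((unfold tensor_relations_def Let_def)?, blast)+
    then show ?thesis
      using that by (simp add: balanced_tensor_def balanced_pure_def
        quot_add[OF pairs_module ker_submodule] basis_closed)
  qed
  have a2: "pure m (n \<oplus>\<^bsub>N\<^esub> n') = pure m n \<oplus>\<^bsub>T\<^esub> pure m n'"
    if "m \<in> carrier M" "n \<in> carrier N" "n' \<in> carrier N" for m n n'
  proof -
    have "ker +>\<^bsub>pairs\<^esub> free_basis K (m, n \<oplus>\<^bsub>N\<^esub> n') =
        ker +>\<^bsub>pairs\<^esub> (free_basis K (m, n) \<oplus>\<^bsub>pairs\<^esub> free_basis K (m, n'))"
      using that by (intro coset_eqI F.a_closed basis_closed M.a_closed N.a_closed M.smult_closed N.smult_closed)
        ((unfold tensor_relations_def Let_def)?, blast)+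
    then show ?thesis
      using that by (simp add: balanced_tensor_def balanced_pure_def
        quot_add[OF pairs_module ker_submodule] basis_closed)
  qed
  have s1: "pure (k \<odot>\<^bsub>M\<^esub> m) n = k \<odot>\<^bsub>T\<^esub> pure m n"
    if "k \<in> carrier K" "m \<in> carrier M" "n \<in> carrier N" for k m n
  proof -
    have "ker +>\<^bsub>pairs\<^esub> free_basis K (k \<odot>\<^bsub>M\<^esub> m, n) =
        ker +>\<^bsub>pairs\<^esub> (k \<odot>\<^bsub>pairs\<^esub> free_basis K (m, n))"
      using that by (intro coset_eqI F.smult_closed basis_closed M.a_closed N.a_closed M.smult_closed N.smult_closed)
        ((unfold tensor_relations_def Let_def)?, blast)+
    then show ?thesis
      using that by (simp add: balanced_tensor_def balanced_pure_def
        quot_smult[OF pairs_module ker_submodule] basis_closed)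
  qed
  have s2: "pure m (k \<odot>\<^bsub>N\<^esub> n) = k \<odot>\<^bsub>T\<^esub> pure m n"
    if "k \<in> carrier K" "m \<in> carrier M" "n \<in> carrier N" for k m n
  proof -
    have "ker +>\<^bsub>pairs\<^esub> free_basis K (m, k \<odot>\<^bsub>N\<^esub> n) =
        ker +>\<^bsub>pairs\<^esub> (k \<odot>\<^bsub>pairs\<^esub> free_basis K (m, n))"
      using that by (intro coset_eqI F.smult_closed basis_closed M.a_closed N.a_closed M.smult_closed N.smult_closed)
        ((unfold tensor_relations_def Let_def)?, blast)+
    then show ?thesis
      using that by (simp add: balanced_tensor_def balanced_pure_def
        quot_smult[OF pairs_module ker_submodule] basis_closed)
  qed
  have b: "pure (ra m b) n = pure m (la b n)"
    if "m \<in> carrier M" "b \<in> B" "n \<in> carrier N" for m b n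
    unfolding balanced_pure_def
    using that by (intro coset_eqI basis_closed ra_closed la_closed)
      (auto simp: tensor_relations_def Let_def)
  show ?thesis
    by (intro balanced_bilinearI linear_mapsI) (auto simp: a1 a2 s1 s2 b pure_closed)
qed

text \<open>Scalars need no case of their own, since k(m \<otimes> n) = (km) \<otimes> n is again
  pure, and zero is 0 \<otimes> 0; what remains of \<open>free_induct\<close> is the step for
  sums.\<close>

lemma tensor_induct [consumes 1, case_names pure add]:
  assumes x: "x \<in> carrier T"
    and pure: "\<And>m n. m \<in> carrier M \<Longrightarrow> n \<in> carrier N \<Longrightarrow> Q (pure m n)"
    and add: "\<And>x y. x \<in> carrier T \<Longrightarrow> y \<in> carrier T \<Longrightarrow> Q x \<Longrightarrow> Q y \<Longrightarrow> Q (x \<oplus>\<^bsub>T\<^esub> y)"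
  shows "Q x"
proof -
  interpret F: module K pairs by (rule pairs_module)
  let ?c = "\<lambda>f. ker +>\<^bsub>pairs\<^esub> f"
  have lin: "?c \<in> linear_maps K pairs T"
    unfolding balanced_tensor_def by (rule coset_linear[OF pairs_module ker_submodule])
  note pb = balanced_bilinearD[OF pure_bilinear]
  have "Q (?c f)" if "f \<in> carrier pairs" for f
    using M.is_cring that
  proof (induction f rule: free_induct)
    case zero
    have "pure \<zero>\<^bsub>M\<^esub> \<zero>\<^bsub>N\<^esub> = \<zero>\<^bsub>T\<^esub>"
      by (rule linear_maps_zero[OF M.module_axioms T.module_axioms pb(1)]) simp
    then show ?case
      using pure[of "\<zero>\<^bsub>M\<^esub>" "\<zero>\<^bsub>N\<^esub>"] linear_maps_zero[OF pairs_module T.module_axioms lin] by simp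
  next
    case (add f k s)
    obtain m n where s: "s = (m, n)" "m \<in> carrier M" "n \<in> carrier N"
      using add.hyps by auto
    have cs: "?c (k \<odot>\<^bsub>pairs\<^esub> free_basis K s) = pure (k \<odot>\<^bsub>M\<^esub> m) n"
      using s add.hyps basis_closed linear_maps_smult[OF lin, of k] linear_maps_smult[OF pb(1)]
      by (simp add: balanced_pure_def)
    have "?c (f \<oplus>\<^bsub>pairs\<^esub> (k \<odot>\<^bsub>pairs\<^esub> free_basis K s)) = ?c f \<oplus>\<^bsub>T\<^esub> ?c (k \<odot>\<^bsub>pairs\<^esub> free_basis K s)"
      using s add.hyps basis_closed by (intro linear_maps_add[OF lin]) auto
    also have "Q \<dots>"
      unfolding cs using s add.hyps add.IH
      by (intro assms(3) pure linear_maps_closed[OF lin] pure_closed) auto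
    finally show ?case .
  qed
  then show ?thesis
    using x by (auto simp: balanced_tensor_def quot_carrier)
qed

lemma linear_eqI:
  assumes "module K L" "f \<in> linear_maps K T L" "g \<in> linear_maps K T L"
    and "\<And>m n. m \<in> carrier M \<Longrightarrow> n \<in> carrier N \<Longrightarrow> f (pure m n) = g (pure m n)"
    and "x \<in> carrier T"
  shows "f x = g x"
  using assms(5)
  by (induction rule: tensor_induct)
    (simp_all add: assms(4) linear_maps_add[OF assms(2)] linear_maps_add[OF assms(3)])

context
  fixes L :: "('k, 't, 'z) module_scheme" and g :: "'m \<Rightarrow> 'n \<Rightarrow> 't"
  assumes L: "module K L" and g: "balanced_bilinear K B ra la M N L g"
begin

interpretation L: module K L by (rule L)

lemma ext_linear: "free_ext K L (\<lambda>s. g (fst s) (snd s)) \<in> linear_maps K pairs L"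
  by (rule free_ext_linear[OF L])
    (auto intro: linear_maps_closed[OF balanced_bilinearD(2)[OF g]])

lemma ext_basis:
  "m \<in> carrier M \<Longrightarrow> n \<in> carrier N \<Longrightarrow> free_ext K L (\<lambda>s. g (fst s) (snd s)) (free_basis K (m, n)) = g m n"
  by (subst free_ext_basis[OF L, of _ "carrier M \<times> carrier N"])
    (auto intro: linear_maps_closed[OF balanced_bilinearD(2)[OF g]])

lemma ext_ker:
  assumes "f \<in> ker"
  shows "free_ext K L (\<lambda>s. g (fst s) (snd s)) f = \<zero>\<^bsub>L\<^esub>"
proof -
  interpret F: module K pairs by (rule pairs_module)
  let ?e = "free_ext K L (\<lambda>s. g (fst s) (snd s))"
  note lin = linear_maps_minus[OF pairs_module L ext_linear] linear_maps_add[OF ext_linear]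
    linear_maps_smult[OF ext_linear]
  note gb = balanced_bilinearD[OF g]
  note closed = linear_maps_closed[OF gb(2)]
  have self: "x \<ominus>\<^bsub>L\<^esub> x = \<zero>\<^bsub>L\<^esub>" if "x \<in> carrier L" for x
    using that by (simp add: a_minus_def L.r_neg)
  have "tensor_relations K B ra la M N \<subseteq> {f \<in> carrier pairs. ?e f = \<zero>\<^bsub>L\<^esub>}"
  proof
    fix f assume f: "f \<in> tensor_relations K B ra la M N"
    have "?e f = \<zero>\<^bsub>L\<^esub>"
      using f unfolding tensor_relations_def Let_def
      by (auto simp: lin basis_closed ra_closed la_closed ext_basis linear_maps_add[OF gb(1)]
          linear_maps_add[OF gb(2)] linear_maps_smult[OF gb(1)] linear_maps_smult[OF gb(2)]
          gb(3) closed self)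
    with f show "f \<in> {f \<in> carrier pairs. ?e f = \<zero>\<^bsub>L\<^esub>}"
      using relations_subset by blast
  qed
  then have "ker \<subseteq> {f \<in> carrier pairs. ?e f = \<zero>\<^bsub>L\<^esub>}"
    unfolding tensor_kernel_def
    by (intro span_least linear_kernel_submodule[OF pairs_module L ext_linear])
  then show ?thesis
    using assms by auto
qed

text \<open>The extension of \<open>g\<close> vanishes on \<open>ker\<close> and is therefore
  constant on each coset, so that \<open>the_elem\<close> in \<open>tensor_lift\<close> is applied
  to a singleton.\<close>

lemma lift_coset:
  assumes "f \<in> carrier pairs"
  shows "tensor_lift L K g (ker +>\<^bsub>pairs\<^esub> f) = free_ext K L (\<lambda>s. g (fst s) (snd s)) f"
proof -
  let ?e = "free_ext K L (\<lambda>s. g (fst s) (snd s))"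
  have "?e h = ?e f" if "h \<in> ker +>\<^bsub>pairs\<^esub> f" for h
  proof -
    have h: "h \<in> carrier pairs" "h \<ominus>\<^bsub>pairs\<^esub> f \<in> ker"
      using that assms coset_eq_iff[OF pairs_module ker_submodule, of h f]
      by (simp_all add: mem_coset_iff[OF pairs_module ker_submodule])
    have "?e h \<ominus>\<^bsub>L\<^esub> ?e f = \<zero>\<^bsub>L\<^esub>"
      using ext_ker[OF h(2)] h(1) assms by (simp add: linear_maps_minus[OF pairs_module L ext_linear])
    then show ?thesis
      using h assms linear_maps_closed[OF ext_linear] L.minus_eq_zero_iff by blast
  qed
  moreover have "f \<in> ker +>\<^bsub>pairs\<^esub> f"
    using assms by (simp add: mem_coset_iff[OF pairs_module ker_submodule])
  ultimately have "?e ` (ker +>\<^bsub>pairs\<^esub> f) = {?e f}"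
    by blast
  then show ?thesis
    by (simp add: tensor_lift_eq)
qed

lemma lift_pure: "m \<in> carrier M \<Longrightarrow> n \<in> carrier N \<Longrightarrow> tensor_lift L K g (pure m n) = g m n"
  unfolding balanced_pure_def by (simp add: lift_coset basis_closed ext_basis)

lemma lift_linear: "tensor_lift L K g \<in> linear_maps K T L"
proof -
  interpret F: module K pairs by (rule pairs_module)
  show ?thesis
    by (rule linear_mapsI)
      (auto simp: balanced_tensor_def quot_carrier quot_add[OF pairs_module ker_submodule]
        quot_smult[OF pairs_module ker_submodule] lift_coset linear_maps_closed[OF ext_linear]
        linear_maps_add[OF ext_linear] linear_maps_smult[OF ext_linear])
qed

end

end

text \<open>Setting for \<phi> \<otimes> \<psi> with one set of scalars acting on source and target.
  It is instantiated with the projection P \<rightarrow> P/J in both factors, balanced over the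
  coinvariants, and over the ground ring with maps such as the projection in the first factor and
  the identity of \<open>C\<close> in the second.\<close>

locale balanced_pair_map = P: balanced_pair K B ra la M N + P': balanced_pair K B ra' la' M' N'
  for K :: "('k, 'r) ring_scheme" and B :: "'b set"
    and ra :: "'m \<Rightarrow> 'b \<Rightarrow> 'm" and la :: "'b \<Rightarrow> 'n \<Rightarrow> 'n"
    and M :: "('k, 'm, 'x) module_scheme" and N :: "('k, 'n, 'y) module_scheme"
    and ra' :: "'m' \<Rightarrow> 'b \<Rightarrow> 'm'" and la' :: "'b \<Rightarrow> 'n' \<Rightarrow> 'n'"
    and M' :: "('k, 'm', 'x') module_scheme" and N' :: "('k, 'n', 'y') module_scheme" +
  fixes \<phi> :: "'m \<Rightarrow> 'm'" and \<psi> :: "'n \<Rightarrow> 'n'"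
  assumes \<phi>: "\<phi> \<in> linear_maps K M M'" and \<psi>: "\<psi> \<in> linear_maps K N N'"
    and \<phi>_act: "m \<in> carrier M \<Longrightarrow> b \<in> B \<Longrightarrow> \<phi> (ra m b) = ra' (\<phi> m) b"
    and \<psi>_act: "n \<in> carrier N \<Longrightarrow> b \<in> B \<Longrightarrow> \<psi> (la b n) = la' b (\<psi> n)"
begin

definition "tmap = tensor_lift P'.T K (\<lambda>m n. P'.pure (\<phi> m) (\<psi> n))"

lemma tmap_bilinear: "balanced_bilinear K B ra la M N P'.T (\<lambda>m n. P'.pure (\<phi> m) (\<psi> n))"
proof -
  note pb = balanced_bilinearD[OF P'.pure_bilinear]
  show ?thesis
    by (rule balanced_bilinearI)
      (auto simp: \<phi>_act \<psi>_act linear_maps_closed[OF \<phi>] linear_maps_closed[OF \<psi>] pb(3)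
        intro: linear_maps_comp[OF \<phi> pb(1)] linear_maps_comp[OF \<psi> pb(2)])
qed

lemma tmap_linear: "tmap \<in> linear_maps K P.T P'.T"
  unfolding tmap_def by (rule P.lift_linear[OF P'.module_T tmap_bilinear])

lemma tmap_pure: "m \<in> carrier M \<Longrightarrow> n \<in> carrier N \<Longrightarrow> tmap (P.pure m n) = P'.pure (\<phi> m) (\<psi> n)"
  unfolding tmap_def by (rule P.lift_pure[OF P'.module_T tmap_bilinear])

context
  assumes \<phi>_surj: "\<phi> ` carrier M = carrier M'" and \<psi>_surj: "\<psi> ` carrier N = carrier N'"
begin

lemma tmap_surj:
  assumes "y \<in> carrier P'.T"
  shows "\<exists>x\<in>carrier P.T. tmap x = y"
  using assms
proof (induction rule: P'.tensor_induct)
  case (pure m' n')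
  then obtain m n where "m \<in> carrier M" "m' = \<phi> m" "n \<in> carrier N" "n' = \<psi> n"
    using \<phi>_surj \<psi>_surj by blast
  then show ?case
    by (intro bexI[of _ "P.pure m n"]) (auto simp: tmap_pure P.pure_closed)
next
  case (add y y')
  then obtain x x' where "x \<in> carrier P.T" "tmap x = y" "x' \<in> carrier P.T" "tmap x' = y'"
    by blast
  then show ?case
    by (intro bexI[of _ "x \<oplus>\<^bsub>P.T\<^esub> x'"]) (auto simp: linear_maps_add[OF tmap_linear])
qed

text \<open>Right exactness: sections of \<open>\<phi>\<close> and \<open>\<psi>\<close> induce an inverse of the map that \<open>\<phi> \<otimes> \<psi>\<close>
  induces on the quotient by the span on the right.\<close>

lemma tmap_kernel:
  assumes x: "x \<in> carrier P.T" "tmap x = \<zero>\<^bsub>P'.T\<^esub>"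
  shows "x \<in> submodule_span K P.T
    {P.pure m n | m n. m \<in> carrier M \<and> n \<in> carrier N \<and> (\<phi> m = \<zero>\<^bsub>M'\<^esub> \<or> \<psi> n = \<zero>\<^bsub>N'\<^esub>)}"
    (is "_ \<in> submodule_span K P.T ?S")
proof -
  define Z where "Z = submodule_span K P.T ?S"
  let ?L = "quot_module P.T Z"
  have Z: "submodule Z K P.T"
    unfolding Z_def by (rule span_submodule[OF P.module_T]) (auto intro: P.pure_closed)
  note L = quot_module_module[OF P.module_T Z]
  interpret L: module K ?L by (rule L)
  note lin = linear_maps_closed[OF coset_linear[OF P.module_T Z]]
    linear_maps_add[OF coset_linear[OF P.module_T Z], symmetric]
    linear_maps_smult[OF coset_linear[OF P.module_T Z], symmetric]
  note pb = balanced_bilinearD[OF P.pure_bilinear]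
  \<comment> \<open>The two pure tensors differ by (m - m') \<otimes> n + m' \<otimes> (n - n'), and
    both summands are generators of \<open>Z\<close>.\<close>
  have cong: "Z +>\<^bsub>P.T\<^esub> P.pure m n = Z +>\<^bsub>P.T\<^esub> P.pure m' n'"
    if m: "m \<in> carrier M" "m' \<in> carrier M" "\<phi> m = \<phi> m'"
      and n: "n \<in> carrier N" "n' \<in> carrier N" "\<psi> n = \<psi> n'" for m m' n n'
  proof -
    have "\<phi> (m \<ominus>\<^bsub>M\<^esub> m') = \<zero>\<^bsub>M'\<^esub>" "\<psi> (n \<ominus>\<^bsub>N\<^esub> n') = \<zero>\<^bsub>N'\<^esub>"
      using m n
      by (simp_all add: linear_maps_minus[OF P.M.module_axioms P'.M.module_axioms \<phi>]
        linear_maps_minus[OF P.N.module_axioms P'.N.module_axioms \<psi>] linear_maps_closed[OF \<phi>]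
        linear_maps_closed[OF \<psi>] P'.M.minus_eq_zero_iff P'.N.minus_eq_zero_iff)
    then have "P.pure (m \<ominus>\<^bsub>M\<^esub> m') n \<in> Z" "P.pure m' (n \<ominus>\<^bsub>N\<^esub> n') \<in> Z"
      using m n unfolding Z_def by (auto intro!: subsetD[OF span_incl])
    then have "Z +>\<^bsub>P.T\<^esub> P.pure m n = Z +>\<^bsub>P.T\<^esub> P.pure m' n"
      "Z +>\<^bsub>P.T\<^esub> P.pure m' n = Z +>\<^bsub>P.T\<^esub> P.pure m' n'"
      using m n linear_maps_minus[OF P.M.module_axioms P.module_T pb(1)[of n], of m m']
        linear_maps_minus[OF P.N.module_axioms P.module_T pb(2)[of m'], of n n']
      by (simp_all add: coset_eq_iff[OF P.module_T Z] P.pure_closed)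
    then show ?thesis
      by simp
  qed
  \<comment> \<open>\<open>inv_into\<close> picks preimages without any linearity. By
    \<open>cong\<close> the choice does not matter modulo \<open>Z\<close>, and this independence is
    what makes \<open>g\<close> bilinear and balanced.\<close>
  define g where "g m' n' = Z +>\<^bsub>P.T\<^esub> P.pure (inv_into (carrier M) \<phi> m') (inv_into (carrier N) \<psi> n')"
    for m' n'
  have g: "g (\<phi> m) (\<psi> n) = Z +>\<^bsub>P.T\<^esub> P.pure m n" if "m \<in> carrier M" "n \<in> carrier N" for m n
    unfolding g_def using that by (intro cong) (auto intro: inv_into_into f_inv_into_f)
  have g_closed: "g m' n' \<in> carrier ?L" if "m' \<in> carrier M'" "n' \<in> carrier N'" for m' n'
    using that \<phi>_surj \<psi>_surj by (auto simp: g_def intro!: lin P.pure_closed inv_into_into)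
  have bil: "balanced_bilinear K B ra' la' M' N' ?L g"
  proof (intro balanced_bilinearI linear_mapsI)
    fix m' n' assume "m' \<in> carrier M'" "n' \<in> carrier N'"
    then obtain m n where m: "m \<in> carrier M" "m' = \<phi> m" and n: "n \<in> carrier N" "n' = \<psi> n"
      using \<phi>_surj \<psi>_surj by blast
    show "g (k \<odot>\<^bsub>M'\<^esub> m') n' = k \<odot>\<^bsub>?L\<^esub> g m' n'" if k: "k \<in> carrier K" for k
      using m n k g[of "k \<odot>\<^bsub>M\<^esub> m" n]
      by (simp add: linear_maps_smult[OF \<phi>] g lin P.pure_closed linear_maps_smult[OF pb(1)])
    show "g m' (k \<odot>\<^bsub>N'\<^esub> n') = k \<odot>\<^bsub>?L\<^esub> g m' n'" if k: "k \<in> carrier K" for k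
      using m n k g[of m "k \<odot>\<^bsub>N\<^esub> n"]
      by (simp add: linear_maps_smult[OF \<psi>] g lin P.pure_closed linear_maps_smult[OF pb(2)])
    show "g (ra' m' b) n' = g m' (la' b n')" if b: "b \<in> B" for b
    proof -
      have "g (ra' m' b) n' = Z +>\<^bsub>P.T\<^esub> P.pure (ra m b) n"
        using g[OF P.ra_closed[OF m(1) b] n(1)] \<phi>_act[OF m(1) b] m n by metis
      also have "\<dots> = Z +>\<^bsub>P.T\<^esub> P.pure m (la b n)"
        by (subst pb(3)[OF m(1) b n(1)]) (rule refl)
      also have "\<dots> = g m' (la' b n')"
        using g[OF m(1) P.la_closed[OF n(1) b]] \<psi>_act[OF n(1) b] m n by metis
      finally show ?thesis .
    qed
    show "g (m' \<oplus>\<^bsub>M'\<^esub> m2') n' = g m' n' \<oplus>\<^bsub>?L\<^esub> g m2' n'" if m2': "m2' \<in> carrier M'" for m2'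
    proof -
      obtain m2 where m2: "m2 \<in> carrier M" "m2' = \<phi> m2"
        using \<phi>_surj m2' by blast
      show ?thesis
        using m n m2 g[OF P.M.a_closed[OF m(1) m2(1)] n(1)] linear_maps_add[OF \<phi> m(1) m2(1)]
          linear_maps_add[OF pb(1)[OF n(1)] m(1) m2(1)] lin(2)[OF P.pure_closed P.pure_closed] g
        by (metis (full_types))
    qed
    show "g m' (n' \<oplus>\<^bsub>N'\<^esub> n2') = g m' n' \<oplus>\<^bsub>?L\<^esub> g m' n2'" if n2': "n2' \<in> carrier N'" for n2'
    proof -
      obtain n2 where n2: "n2 \<in> carrier N" "n2' = \<psi> n2"
        using \<psi>_surj n2' by blast
      show ?thesis
        using m n n2 g[OF m(1) P.N.a_closed[OF n(1) n2(1)]] linear_maps_add[OF \<psi> n(1) n2(1)]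
          linear_maps_add[OF pb(2)[OF m(1)] n(1) n2(1)] lin(2)[OF P.pure_closed P.pure_closed] g
        by (metis (full_types))
    qed
  qed (auto intro: g_closed)
  have H: "tensor_lift ?L K g \<in> linear_maps K P'.T ?L"
    by (rule P'.lift_linear[OF L bil])
  \<comment> \<open>The composite with \<open>tmap\<close> agrees with the projection modulo
    \<open>Z\<close> on pure tensors, hence everywhere, so an element killed by \<open>tmap\<close>
    lies in \<open>Z\<close>.\<close>
  have "tensor_lift ?L K g (tmap x) = Z +>\<^bsub>P.T\<^esub> x"
    by (rule P.linear_eqI[OF L linear_maps_comp[OF tmap_linear H] coset_linear[OF P.module_T Z] _ x(1)])
      (simp add: tmap_pure P'.lift_pure[OF L bil] linear_maps_closed[OF \<phi>] linear_maps_closed[OF \<psi>] g)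
  then have "Z +>\<^bsub>P.T\<^esub> x = \<zero>\<^bsub>?L\<^esub>"
    using linear_maps_zero[OF P'.module_T L H] x(2) by simp
  then show ?thesis
    using coset_eq_zero_iff[OF P.module_T Z x(1)] by (simp add: Z_def)
qed

end

end

subsection \<open>Tensor products over the ground ring\<close>

context
  fixes K :: "('k, 'r) ring_scheme"
    and M :: "('k, 'm, 'x) module_scheme" and N :: "('k, 'n, 'y) module_scheme"
  assumes M: "module K M" and N: "module K N"
begin

lemma tensor_pair:
  "balanced_pair K (carrier K) (\<lambda>m k. k \<odot>\<^bsub>M\<^esub> m) (\<lambda>k n. k \<odot>\<^bsub>N\<^esub> n) M N"
  by (intro balanced_pair.intro balanced_pair_axioms.intro M N)
    (auto intro: module.smult_closed[OF M] module.smult_closed[OF N])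

interpretation balanced_pair K "carrier K" "\<lambda>m k. k \<odot>\<^bsub>M\<^esub> m" "\<lambda>k n. k \<odot>\<^bsub>N\<^esub> n" M N
  by (rule tensor_pair)

lemmas tensor_module = module_T[folded tensor_def]
lemmas pure_tensor_closed = pure_closed[folded tensor_def pure_tensor_def]
lemmas pure_tensor_linear =
  balanced_bilinearD(1,2)[OF pure_bilinear, folded tensor_def pure_tensor_def]
lemmas pure_tensor_induct =
  tensor_induct[folded tensor_def pure_tensor_def]

text \<open>Over the ground ring balancedness follows from bilinearity: a scalar may be pulled out
  of either argument.\<close>

lemma pure_tensor_lift:
  assumes "module K L" "\<And>n. n \<in> carrier N \<Longrightarrow> (\<lambda>m. g m n) \<in> linear_maps K M L"
    "\<And>m. m \<in> carrier M \<Longrightarrow> g m \<in> linear_maps K N L"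
  shows "tensor_lift L K g \<in> linear_maps K (tensor K M N) L"
    and "m \<in> carrier M \<Longrightarrow> n \<in> carrier N \<Longrightarrow> tensor_lift L K g (pure_tensor K M N m n) = g m n"
proof -
  have "balanced_bilinear K (carrier K) (\<lambda>m k. k \<odot>\<^bsub>M\<^esub> m) (\<lambda>k n. k \<odot>\<^bsub>N\<^esub> n) M N L g"
    by (intro balanced_bilinearI assms(2,3))
      (auto simp: linear_maps_smult[OF assms(2)] linear_maps_smult[OF assms(3)])
  from lift_linear[OF assms(1) this] lift_pure[OF assms(1) this]
  show "tensor_lift L K g \<in> linear_maps K (tensor K M N) L"
    and "m \<in> carrier M \<Longrightarrow> n \<in> carrier N \<Longrightarrow> tensor_lift L K g (pure_tensor K M N m n) = g m n"
    by (simp_all add: tensor_def pure_tensor_def)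
qed

end

context
  fixes K :: "('k, 'r) ring_scheme"
    and M :: "('k, 'm, 'x) module_scheme" and N :: "('k, 'n, 'y) module_scheme"
    and M' :: "('k, 'm', 'x') module_scheme" and N' :: "('k, 'n', 'y') module_scheme"
    and \<phi> \<psi>
  assumes M: "module K M" and N: "module K N" and M': "module K M'" and N': "module K N'"
    and \<phi>: "\<phi> \<in> linear_maps K M M'" and \<psi>: "\<psi> \<in> linear_maps K N N'"
begin

lemma tensor_map_pair: "balanced_pair_map K (carrier K) (\<lambda>m k. k \<odot>\<^bsub>M\<^esub> m) (\<lambda>k n. k \<odot>\<^bsub>N\<^esub> n) M N
    (\<lambda>m k. k \<odot>\<^bsub>M'\<^esub> m) (\<lambda>k n. k \<odot>\<^bsub>N'\<^esub> n) M' N' \<phi> \<psi>"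
  by (intro balanced_pair_map.intro balanced_pair_map_axioms.intro tensor_pair M N M' N' \<phi> \<psi>)
    (auto simp: linear_maps_smult[OF \<phi>] linear_maps_smult[OF \<psi>])

interpretation balanced_pair_map K "carrier K" "\<lambda>m k. k \<odot>\<^bsub>M\<^esub> m" "\<lambda>k n. k \<odot>\<^bsub>N\<^esub> n" M N
  "\<lambda>m k. k \<odot>\<^bsub>M'\<^esub> m" "\<lambda>k n. k \<odot>\<^bsub>N'\<^esub> n" M' N' \<phi> \<psi>
  by (rule tensor_map_pair)

lemma tensor_map_eq_tmap: "tensor_map K M' N' \<phi> \<psi> = tmap"
  by (simp add: tensor_map_def tmap_def tensor_def pure_tensor_def)

lemmas tensor_map_linear = tmap_linear[folded tensor_map_eq_tmap tensor_def pure_tensor_def]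
lemmas tensor_map_pure = tmap_pure[folded tensor_map_eq_tmap tensor_def pure_tensor_def]
lemmas tensor_map_kernel = tmap_kernel[folded tensor_map_eq_tmap tensor_def pure_tensor_def]

end

subsection \<open>Finite sums of pure tensors\<close>

text \<open>Concatenation of two sequences, the second shifted by \<open>r\<close>. It adds two sums
  over initial segments of the naturals without leaving that format.\<close>

lemma (in abelian_monoid) finsum_lessThan_append:
  fixes r s :: nat
  assumes "\<And>k. u k \<in> carrier G" "\<And>k. v k \<in> carrier G"
  shows "(\<Oplus>k\<in>{..<r + s}. if k < r then u k else v (k - r)) =
    (\<Oplus>k\<in>{..<r}. u k) \<oplus> (\<Oplus>k\<in>{..<s}. v k)"
proof (induction s)
  case 0
  have "(\<Oplus>k\<in>{..<r}. if k < r then u k else v (k - r)) = (\<Oplus>k\<in>{..<r}. u k)"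
    using assms by (intro finsum_cong') auto
  then show ?case
    using assms by simp
next
  case (Suc s)
  then show ?case
    using assms by (simp add: lessThan_Suc a_ac Pi_iff)
qed

lemma (in abelian_monoid) finsum_swap:
  assumes "finite A" "finite B" "\<And>i j. i \<in> A \<Longrightarrow> j \<in> B \<Longrightarrow> f i j \<in> carrier G"
  shows "(\<Oplus>i\<in>A. \<Oplus>j\<in>B. f i j) = (\<Oplus>j\<in>B. \<Oplus>i\<in>A. f i j)"
  using assms(1,3)
proof (induction rule: finite_induct)
  case empty
  then show ?case by simp
next
  case (insert a A)
  have c: "(\<lambda>j. f a j) \<in> B \<rightarrow> carrier G" "(\<lambda>j. \<Oplus>i\<in>A. f i j) \<in> B \<rightarrow> carrier G"
    using insert by (auto intro!: finsum_closed)
  have "(\<Oplus>j\<in>B. \<Oplus>i\<in>insert a A. f i j) = (\<Oplus>j\<in>B. f a j \<oplus> (\<Oplus>i\<in>A. f i j))"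
    using insert c by (intro finsum_cong') (auto simp: Pi_iff)
  also have "\<dots> = (\<Oplus>j\<in>B. f a j) \<oplus> (\<Oplus>j\<in>B. \<Oplus>i\<in>A. f i j)"
    using c by (intro finsum_addf)
  also have "\<dots> = (\<Oplus>i\<in>insert a A. \<Oplus>j\<in>B. f i j)"
    using insert by (subst finsum_insert) (auto intro!: finsum_closed)
  finally show ?case ..
qed

lemma (in abelian_monoid) finsum_delta:
  assumes "finite A" "\<And>i. i \<in> A \<Longrightarrow> f i \<in> carrier G"
  shows "(\<Oplus>i\<in>A. if t = i then f i else \<zero>) = (if t \<in> A then f t else \<zero>)"
proof (cases "t \<in> A")
  case True
  then show ?thesis
    using assms add.finprod_singleton[of t A f] by auto
next
  case False
  then have "(\<Oplus>i\<in>A. if t = i then f i else \<zero>) = (\<Oplus>i\<in>A. \<zero>)"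
    by (intro finsum_cong') auto
  with False show ?thesis
    by simp
qed

text \<open>The families \<open>p\<close> and \<open>c\<close> are total on the naturals, with
  arbitrary carrier elements from index \<open>r\<close> on; membership can then be used without a
  bound on the index.\<close>

lemma tensor_finite_sum:
  assumes M: "module K M" and N: "module K N" and y: "y \<in> carrier (tensor K M N)"
  shows "\<exists>(r :: nat) p c. (\<forall>k. p k \<in> carrier M) \<and> (\<forall>k. c k \<in> carrier N) \<and>
    y = (\<Oplus>\<^bsub>tensor K M N\<^esub>k\<in>{..<r}. pure_tensor K M N (p k) (c k))"
proof -
  interpret T: module K "tensor K M N" by (rule tensor_module[OF M N])
  note [simp] = pure_tensor_closed[OF M N]
  from y show ?thesis
  proof (induction rule: pure_tensor_induct[OF M N, consumes 1, case_names pure add])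
    case (pure m n)
    then show ?case
      by (intro exI[of _ 1] exI[of _ "\<lambda>_. m"] exI[of _ "\<lambda>_. n"]) (simp add: lessThan_Suc)
  next
    case (add x y)
    from add(3) obtain r :: nat and p c where "(\<forall>k. p k \<in> carrier M) \<and> (\<forall>k. c k \<in> carrier N) \<and>
        x = (\<Oplus>\<^bsub>tensor K M N\<^esub>k\<in>{..<r}. pure_tensor K M N (p k) (c k))"
      by (elim exE) (rule that)
    then have x: "\<And>k. p k \<in> carrier M" "\<And>k. c k \<in> carrier N"
        "x = (\<Oplus>\<^bsub>tensor K M N\<^esub>k\<in>{..<r}. pure_tensor K M N (p k) (c k))"
      by auto
    from add(4) obtain s :: nat and p' c' where "(\<forall>k. p' k \<in> carrier M) \<and> (\<forall>k. c' k \<in> carrier N) \<and>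
        y = (\<Oplus>\<^bsub>tensor K M N\<^esub>k\<in>{..<s}. pure_tensor K M N (p' k) (c' k))"
      by (elim exE) (rule that)
    then have y: "\<And>k. p' k \<in> carrier M" "\<And>k. c' k \<in> carrier N"
        "y = (\<Oplus>\<^bsub>tensor K M N\<^esub>k\<in>{..<s}. pure_tensor K M N (p' k) (c' k))"
      by auto
    have "x \<oplus>\<^bsub>tensor K M N\<^esub> y = (\<Oplus>\<^bsub>tensor K M N\<^esub>k\<in>{..<r + s}.
        if k < r then pure_tensor K M N (p k) (c k) else pure_tensor K M N (p' (k - r)) (c' (k - r)))"
      unfolding x(3) y(3)
      by (rule T.finsum_lessThan_append[where u = "\<lambda>k. pure_tensor K M N (p k) (c k)"
        and v = "\<lambda>k. pure_tensor K M N (p' k) (c' k)", symmetric]) (simp_all add: x(1,2) y(1,2))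
    also have "\<dots> = (\<Oplus>\<^bsub>tensor K M N\<^esub>k\<in>{..<r + s}. pure_tensor K M N
        (if k < r then p k else p' (k - r)) (if k < r then c k else c' (k - r)))"
      using x(1,2) y(1,2) by (intro T.finsum_cong') auto
    finally show ?case
      using x(1,2) y(1,2)
      by (intro exI[of _ "r + s"] exI[of _ "\<lambda>k. if k < r then p k else p' (k - r)"]
        exI[of _ "\<lambda>k. if k < r then c k else c' (k - r)"]) auto
  qed
qed

text \<open>Concatenating the lists of second factors and padding the first factors with zeros
  changes no sum, because 0 \<otimes> c = 0. With common second factors, differences of tensors
  become differences of first factors, the form in which the equational criterion is
  applied.\<close>

lemma tensor_common_finite_sum:
  assumes M: "module K M" and N: "module K N"
    and "finite I" "\<And>i. i \<in> I \<Longrightarrow> y i \<in> carrier (tensor K M N)"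
  shows "\<exists>(r :: nat) p c. (\<forall>i k. p i k \<in> carrier M) \<and> (\<forall>k. c k \<in> carrier N) \<and>
    (\<forall>i\<in>I. y i = (\<Oplus>\<^bsub>tensor K M N\<^esub>k\<in>{..<r}. pure_tensor K M N (p i k) (c k)))"
  using assms(3,4)
proof (induction rule: finite_induct)
  case empty
  have "\<zero>\<^bsub>M\<^esub> \<in> carrier M" "\<zero>\<^bsub>N\<^esub> \<in> carrier N"
    using module.carrier_is_submodule[OF M] module.carrier_is_submodule[OF N]
    by (auto intro: submodule_zero)
  then show ?case
    by (intro exI[of _ 0] exI[of _ "\<lambda>_ _. \<zero>\<^bsub>M\<^esub>"] exI[of _ "\<lambda>_. \<zero>\<^bsub>N\<^esub>"]) auto
next
  case (insert j I)
  interpret M: module K M by (rule M)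
  interpret N: module K N by (rule N)
  interpret T: module K "tensor K M N" by (rule tensor_module[OF M N])
  note [simp] = pure_tensor_closed[OF M N]
  have pure_zero: "pure_tensor K M N \<zero>\<^bsub>M\<^esub> n = \<zero>\<^bsub>tensor K M N\<^esub>" if "n \<in> carrier N" for n
    using that by (rule linear_maps_zero[OF M T.module_axioms pure_tensor_linear(1)[OF M N]])
  have "\<exists>(r :: nat) p c. (\<forall>i k. p i k \<in> carrier M) \<and> (\<forall>k. c k \<in> carrier N) \<and>
    (\<forall>i\<in>I. y i = (\<Oplus>\<^bsub>tensor K M N\<^esub>k\<in>{..<r}. pure_tensor K M N (p i k) (c k)))"
    by (rule insert.IH) (rule insert.prems, simp)
  then obtain r :: nat and p c where "(\<forall>i k. p i k \<in> carrier M) \<and> (\<forall>k. c k \<in> carrier N) \<and>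
    (\<forall>i\<in>I. y i = (\<Oplus>\<^bsub>tensor K M N\<^esub>k\<in>{..<r}. pure_tensor K M N (p i k) (c k)))"
    by (elim exE) (rule that)
  then have p: "\<And>i k. p i k \<in> carrier M" "\<And>k. c k \<in> carrier N"
    "\<And>i. i \<in> I \<Longrightarrow> y i = (\<Oplus>\<^bsub>tensor K M N\<^esub>k\<in>{..<r}. pure_tensor K M N (p i k) (c k))"
    by auto
  obtain s :: nat and p' c' where "(\<forall>k. p' k \<in> carrier M) \<and> (\<forall>k. c' k \<in> carrier N) \<and>
    y j = (\<Oplus>\<^bsub>tensor K M N\<^esub>k\<in>{..<s}. pure_tensor K M N (p' k) (c' k))"
    using tensor_finite_sum[OF M N insert.prems[OF insertI1]] by (elim exE) (rule that)
  then have p': "\<And>k. p' k \<in> carrier M" "\<And>k. c' k \<in> carrier N"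
    "y j = (\<Oplus>\<^bsub>tensor K M N\<^esub>k\<in>{..<s}. pure_tensor K M N (p' k) (c' k))"
    by auto
  define q where "q i k = (if i = j then (if k < r then \<zero>\<^bsub>M\<^esub> else p' (k - r))
    else (if k < r then p i k else \<zero>\<^bsub>M\<^esub>))" for i k
  define d where "d k = (if k < r then c k else c' (k - r))" for k
  have q: "q i k \<in> carrier M" "d k \<in> carrier N" for i k
    using p p' by (auto simp: q_def d_def)
  have "y i = (\<Oplus>\<^bsub>tensor K M N\<^esub>k\<in>{..<r + s}. pure_tensor K M N (q i k) (d k))" if "i \<in> insert j I" for i
  proof -
    have "(\<Oplus>\<^bsub>tensor K M N\<^esub>k\<in>{..<r + s}. pure_tensor K M N (q i k) (d k)) =
      (\<Oplus>\<^bsub>tensor K M N\<^esub>k\<in>{..<r + s}.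
        if k < r then pure_tensor K M N (if i = j then \<zero>\<^bsub>M\<^esub> else p i k) (c k)
        else pure_tensor K M N (if i = j then p' (k - r) else \<zero>\<^bsub>M\<^esub>) (c' (k - r)))"
      using p p' by (intro T.finsum_cong') (auto simp: q_def d_def)
    also have "\<dots> =
      (\<Oplus>\<^bsub>tensor K M N\<^esub>k\<in>{..<r}. pure_tensor K M N (if i = j then \<zero>\<^bsub>M\<^esub> else p i k) (c k)) \<oplus>\<^bsub>tensor K M N\<^esub>
      (\<Oplus>\<^bsub>tensor K M N\<^esub>k\<in>{..<s}. pure_tensor K M N (if i = j then p' k else \<zero>\<^bsub>M\<^esub>) (c' k))"
      by (rule T.finsum_lessThan_append[where u = "\<lambda>k. pure_tensor K M N (if i = j then \<zero>\<^bsub>M\<^esub> else p i k) (c k)"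
        and v = "\<lambda>k. pure_tensor K M N (if i = j then p' k else \<zero>\<^bsub>M\<^esub>) (c' k)"])
        (simp_all add: p(1,2) p'(1,2))
    also have "\<dots> = y i"
    proof (cases "i = j")
      case True
      then show ?thesis
        using p p' by (simp add: pure_zero)
    next
      case False
      then show ?thesis
        using p p' that by (simp add: pure_zero Pi_iff)
    qed
    finally show ?thesis ..
  qed
  with q show ?case
    by blast
qed

subsection \<open>Vanishing of sums of pure tensors\<close>

lemma linear_image_submodule:
  assumes "module K M" "module K N" "f \<in> linear_maps K M N"
  shows "submodule (f ` carrier M) K N"
proof -
  interpret M: module K M by fact
  interpret N: module K N by fact
  note lin = linear_maps_zero[OF assms, symmetric] linear_maps_a_inv[OF assms, symmetric]
    linear_maps_add[OF assms(3), symmetric] linear_maps_smult[OF assms(3), symmetric]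
  show ?thesis
    by (rule N.submoduleI) (auto simp: lin linear_maps_closed[OF assms(3)])
qed

text \<open>The product of copies of \<open>C\<close> indexed by a whole type. It serves as an
  ambient module for coefficient vectors; admitting all functions instead of finitely supported ones
  spares any bookkeeping of supports.\<close>

definition fun_module :: "('k, 'c, 'x) module_scheme \<Rightarrow> ('k, 's \<Rightarrow> 'c) module"
  where "fun_module C = \<lparr>carrier = {f. \<forall>s. f s \<in> carrier C}, mult = undefined, one = undefined,
     zero = (\<lambda>s. \<zero>\<^bsub>C\<^esub>), add = (\<lambda>f g s. f s \<oplus>\<^bsub>C\<^esub> g s), smult = (\<lambda>k f s. k \<odot>\<^bsub>C\<^esub> f s)\<rparr>"

lemma fun_module_simps:
  "f \<in> carrier (fun_module C) \<longleftrightarrow> (\<forall>s. f s \<in> carrier C)"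
  "\<zero>\<^bsub>fun_module C\<^esub> = (\<lambda>s. \<zero>\<^bsub>C\<^esub>)"
  "f \<oplus>\<^bsub>fun_module C\<^esub> g = (\<lambda>s. f s \<oplus>\<^bsub>C\<^esub> g s)"
  "k \<odot>\<^bsub>fun_module C\<^esub> f = (\<lambda>s. k \<odot>\<^bsub>C\<^esub> f s)"
  by (simp_all add: fun_module_def)

lemma fun_module_module:
  fixes C :: "('k, 'c, 'x) module_scheme"
  assumes "module K C"
  shows "module K (fun_module C)"
proof -
  interpret C: module K C by fact
  show ?thesis
  proof (rule moduleI[OF C.is_cring abelian_groupI])
    fix f assume "f \<in> carrier (fun_module C)"
    then show "\<exists>g\<in>carrier (fun_module C). g \<oplus>\<^bsub>fun_module C\<^esub> f = \<zero>\<^bsub>fun_module C\<^esub>"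
      by (intro bexI[of _ "\<lambda>s. \<ominus>\<^bsub>C\<^esub> f s"]) (auto simp: fun_module_simps C.l_neg)
  qed (auto simp: fun_module_simps C.a_ac C.smult_l_distr C.smult_r_distr C.smult_assoc1)
qed

text \<open>For a module \<open>R\<close> of coefficient vectors this is the image of R \<otimes> C
  in the product of copies of \<open>C\<close>, under a \<otimes> x \<mapsto> (a(s) x) over all
  s.\<close>

definition relation_combinations ::
    "('s \<Rightarrow> 'k) set \<Rightarrow> ('k, 'c, 'x) module_scheme \<Rightarrow> ('s \<Rightarrow> 'c) set"
  where "relation_combinations R C = {f. \<exists>(L :: nat) a c. (\<forall>l. a l \<in> R) \<and> (\<forall>l. c l \<in> carrier C) \<and>
    f = (\<lambda>s. \<Oplus>\<^bsub>C\<^esub>l\<in>{..<L}. a l s \<odot>\<^bsub>C\<^esub> c l)}"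

lemma relation_combinations_submodule:
  fixes K :: "('k, 'r) ring_scheme" and C :: "('k, 'c, 'x) module_scheme" and R :: "('s \<Rightarrow> 'k) set"
  assumes C: "module K C" and R: "submodule R K (free_module K S)"
  shows "submodule (relation_combinations R C) K (fun_module C)"
proof -
  interpret C: module K C by (rule C)
  interpret D: module K "fun_module C :: ('k, 's \<Rightarrow> 'c) module" by (rule fun_module_module[OF C])
  have Rc: "a s \<in> carrier K" if "a \<in> R" for a s
    using submodule_subset[OF R] that by (auto simp: free_carrier)
  have smult: "k \<odot>\<^bsub>fun_module C\<^esub> f \<in> relation_combinations R C"
    if "f \<in> relation_combinations R C" "k \<in> carrier K" for k f
  proof -
    from that obtain L a c where f: "\<And>l. a l \<in> R" "\<And>l. c l \<in> carrier C"
      "f = (\<lambda>s. \<Oplus>\<^bsub>C\<^esub>l\<in>{..<L::nat}. a l s \<odot>\<^bsub>C\<^esub> c l)"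
      by (auto simp: relation_combinations_def)
    have "(k \<odot>\<^bsub>fun_module C\<^esub> f) s = (\<Oplus>\<^bsub>C\<^esub>l\<in>{..<L}. a l s \<odot>\<^bsub>C\<^esub> (k \<odot>\<^bsub>C\<^esub> c l))" for s
    proof -
      have "(k \<odot>\<^bsub>fun_module C\<^esub> f) s = (\<Oplus>\<^bsub>C\<^esub>l\<in>{..<L}. k \<odot>\<^bsub>C\<^esub> (a l s \<odot>\<^bsub>C\<^esub> c l))"
        using f that Rc by (simp add: fun_module_simps C.finsum_smult_ldistr)
      also have "\<dots> = (\<Oplus>\<^bsub>C\<^esub>l\<in>{..<L}. a l s \<odot>\<^bsub>C\<^esub> (k \<odot>\<^bsub>C\<^esub> c l))"
        using f that Rc by (intro C.finsum_cong') (auto simp: C.smult_assoc1[symmetric] C.m_comm)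
      finally show ?thesis .
    qed
    then show ?thesis
      unfolding relation_combinations_def using f that
      by (intro CollectI exI[of _ L] exI[of _ a] exI[of _ "\<lambda>l. k \<odot>\<^bsub>C\<^esub> c l"]) auto
  qed
  have sub: "relation_combinations R C \<subseteq> carrier (fun_module C)"
    using Rc by (auto simp: relation_combinations_def fun_module_simps intro!: C.finsum_closed)
  show ?thesis
  proof (rule D.submoduleI)
    show "\<zero>\<^bsub>fun_module C\<^esub> \<in> relation_combinations R C"
      unfolding relation_combinations_def using submodule_zero[OF R]
      by (intro CollectI exI[of _ 0] exI[of _ "\<lambda>_. \<zero>\<^bsub>free_module K S\<^esub>"] exI[of _ "\<lambda>_. \<zero>\<^bsub>C\<^esub>"])
        (auto simp: fun_module_simps)
    fix f assume f: "f \<in> relation_combinations R C"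
    show "\<ominus>\<^bsub>fun_module C\<^esub> f \<in> relation_combinations R C"
      using smult[OF f, of "\<ominus>\<^bsub>K\<^esub> \<one>\<^bsub>K\<^esub>"] sub f by (auto simp: D.smult_l_minus)
    fix g assume g: "g \<in> relation_combinations R C"
    from f obtain L a c where f: "\<And>l. a l \<in> R" "\<And>l. c l \<in> carrier C"
      "f = (\<lambda>s. \<Oplus>\<^bsub>C\<^esub>l\<in>{..<L::nat}. a l s \<odot>\<^bsub>C\<^esub> c l)"
      by (auto simp: relation_combinations_def)
    from g obtain L' a' c' where g: "\<And>l. a' l \<in> R" "\<And>l. c' l \<in> carrier C"
      "g = (\<lambda>s. \<Oplus>\<^bsub>C\<^esub>l\<in>{..<L'::nat}. a' l s \<odot>\<^bsub>C\<^esub> c' l)"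
      by (auto simp: relation_combinations_def)
    define b where "b l = (if l < L then a l else a' (l - L))" for l
    define d where "d l = (if l < L then c l else c' (l - L))" for l
    have "(f \<oplus>\<^bsub>fun_module C\<^esub> g) s = (\<Oplus>\<^bsub>C\<^esub>l\<in>{..<L + L'}. b l s \<odot>\<^bsub>C\<^esub> d l)" for s
    proof -
      have "(f \<oplus>\<^bsub>fun_module C\<^esub> g) s = (\<Oplus>\<^bsub>C\<^esub>l\<in>{..<L + L'}.
          if l < L then a l s \<odot>\<^bsub>C\<^esub> c l else a' (l - L) s \<odot>\<^bsub>C\<^esub> c' (l - L))"
        unfolding f(3) g(3) fun_module_simps
        by (rule C.finsum_lessThan_append[symmetric, where u = "\<lambda>l. a l s \<odot>\<^bsub>C\<^esub> c l"
          and v = "\<lambda>l. a' l s \<odot>\<^bsub>C\<^esub> c' l"]) (simp_all add: f(1,2) g(1,2) Rc)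
      also have "\<dots> = (\<Oplus>\<^bsub>C\<^esub>l\<in>{..<L + L'}. b l s \<odot>\<^bsub>C\<^esub> d l)"
        using f g Rc by (intro C.finsum_cong') (auto simp: b_def d_def)
      finally show ?thesis .
    qed
    then show "f \<oplus>\<^bsub>fun_module C\<^esub> g \<in> relation_combinations R C"
      unfolding relation_combinations_def using f g
      by (intro CollectI exI[of _ "L + L'"] exI[of _ b] exI[of _ d]) (auto simp: b_def d_def)
  qed (use sub smult in auto)
qed

lemma relation_combinationsE:
  assumes "f \<in> relation_combinations R C"
  obtains L :: nat and a c where "\<And>l. a l \<in> R" "\<And>l. c l \<in> carrier C"
    "f = (\<lambda>s. \<Oplus>\<^bsub>C\<^esub>l\<in>{..<L}. a l s \<odot>\<^bsub>C\<^esub> c l)"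
  using assms by (auto simp: relation_combinations_def)

text \<open>The family \<open>\<nu>\<close> presents \<open>N\<close> as the quotient of the free
  module on \<open>S\<close> by its relations. The map a \<otimes> x \<mapsto> (a(s) x) sends
  relations into \<open>W\<close>, the set of relation combinations, and so induces a linear map
  from N \<otimes> C to the product of copies of \<open>C\<close> modulo \<open>W\<close>. It takes
  the given sum to the class of the vector of its second factors; if the sum vanishes, that vector
  lies in \<open>W\<close>.\<close>

lemma tensor_sum_zero_relations:
  fixes K :: "('k, 'r) ring_scheme" and N :: "('k, 'n, 'y) module_scheme"
    and C :: "('k, 'c, 'x) module_scheme" and \<nu> :: "'s \<Rightarrow> 'n"
  assumes N: "module K N" and C: "module K C" and \<nu>: "\<nu> \<in> S \<rightarrow> carrier N"
    and gen: "\<And>n. n \<in> carrier N \<Longrightarrow> \<exists>b\<in>carrier (free_module K S). free_ext K N \<nu> b = n"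
    and A: "finite A" "A \<subseteq> S" and c: "\<And>s. c s \<in> carrier C"
    and zero: "(\<Oplus>\<^bsub>tensor K N C\<^esub>s\<in>A. pure_tensor K N C (\<nu> s) (c s)) = \<zero>\<^bsub>tensor K N C\<^esub>"
  shows "(\<lambda>s. if s \<in> A then c s else \<zero>\<^bsub>C\<^esub>) \<in>
    relation_combinations {a \<in> carrier (free_module K S). free_ext K N \<nu> a = \<zero>\<^bsub>N\<^esub>} C"
proof -
  interpret N: module K N by (rule N)
  interpret C: module K C by (rule C)
  define F where "F = free_module K S"
  have F: "module K F"
    unfolding F_def by (rule free_module_module) (rule N.is_cring)
  interpret F: module K F by (rule F)
  define D :: "('k, 's \<Rightarrow> 'c) module" where "D = fun_module C"
  have D: "module K D"
    unfolding D_def by (rule fun_module_module[OF C])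
  interpret D: module K D by (rule D)
  have ext: "free_ext K N \<nu> \<in> linear_maps K F N"
    unfolding F_def by (rule free_ext_linear[OF N \<nu>])
  define R where "R = {a \<in> carrier F. free_ext K N \<nu> a = \<zero>\<^bsub>N\<^esub>}"
  have "submodule R K F"
    unfolding R_def by (rule linear_kernel_submodule[OF F N ext])
  then have R: "submodule R K (free_module K S)"
    by (simp add: F_def)
  define W where "W = relation_combinations R C"
  have W: "submodule W K D"
    unfolding W_def D_def by (rule relation_combinations_submodule[OF C R])
  define Q where "Q = quot_module D W"
  have Q: "module K Q"
    unfolding Q_def by (rule quot_module_module[OF D W])
  have proj: "(\<lambda>f. W +>\<^bsub>D\<^esub> f) \<in> linear_maps K D Q"
    unfolding Q_def by (rule coset_linear[OF D W])
  have Fc: "a s \<in> carrier K" if "a \<in> carrier F" for a s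
    using that by (simp add: F_def free_carrier)
  \<comment> \<open>On a basis vector e(s) this gives the vector with entry x at s and zero
    elsewhere.\<close>
  define \<mu> where "\<mu> a x = (\<lambda>s. a s \<odot>\<^bsub>C\<^esub> x)" for a :: "'s \<Rightarrow> 'k" and x
  have \<mu>_closed: "\<mu> a x \<in> carrier D" if "a \<in> carrier F" "x \<in> carrier C" for a x
    using that by (simp add: \<mu>_def D_def fun_module_simps Fc)
  have \<mu>_add1: "\<mu> (a \<oplus>\<^bsub>F\<^esub> a') x = \<mu> a x \<oplus>\<^bsub>D\<^esub> \<mu> a' x"
    if "a \<in> carrier F" "a' \<in> carrier F" "x \<in> carrier C" for a a' x
    using that Fc by (auto simp: \<mu>_def D_def fun_module_simps F_def free_add C.smult_l_distr)
  have \<mu>_smult1: "\<mu> (k \<odot>\<^bsub>F\<^esub> a) x = k \<odot>\<^bsub>D\<^esub> \<mu> a x"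
    if "a \<in> carrier F" "x \<in> carrier C" "k \<in> carrier K" for a x k
    using that Fc by (auto simp: \<mu>_def D_def fun_module_simps F_def free_smult C.smult_assoc1)
  have \<mu>_add2: "\<mu> a (x \<oplus>\<^bsub>C\<^esub> y) = \<mu> a x \<oplus>\<^bsub>D\<^esub> \<mu> a y"
    if "a \<in> carrier F" "x \<in> carrier C" "y \<in> carrier C" for a x y
    using that Fc by (auto simp: \<mu>_def D_def fun_module_simps C.smult_r_distr)
  have \<mu>_smult2: "\<mu> a (k \<odot>\<^bsub>C\<^esub> x) = k \<odot>\<^bsub>D\<^esub> \<mu> a x"
    if "a \<in> carrier F" "x \<in> carrier C" "k \<in> carrier K" for a x k
    using that Fc by (auto simp: \<mu>_def D_def fun_module_simps C.smult_assoc1[symmetric] N.m_comm)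
  have \<mu>R: "\<mu> a x \<in> W" if "a \<in> R" "x \<in> carrier C" for a x
    unfolding W_def relation_combinations_def \<mu>_def using that
    by (intro CollectI exI[of _ 1] exI[of _ "\<lambda>_. a"] exI[of _ "\<lambda>_. x"])
      (simp add: lessThan_Suc R_def Fc)
  have \<mu>_lin: "(\<lambda>a. \<mu> a x) \<in> linear_maps K F D" if "x \<in> carrier C" for x
    using that by (intro linear_mapsI) (auto simp: \<mu>_add1 \<mu>_smult1 \<mu>_closed)
  have cong: "W +>\<^bsub>D\<^esub> \<mu> a x = W +>\<^bsub>D\<^esub> \<mu> a' x"
    if a: "a \<in> carrier F" "a' \<in> carrier F" and x: "x \<in> carrier C"
      and eq: "free_ext K N \<nu> a = free_ext K N \<nu> a'" for a a' x
  proof -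
    have "a \<ominus>\<^bsub>F\<^esub> a' \<in> R"
      using a eq linear_maps_closed[OF ext] by (simp add: R_def linear_maps_minus[OF F N ext] N.minus_eq_zero_iff)
    then have "\<mu> (a \<ominus>\<^bsub>F\<^esub> a') x \<in> W"
      using x by (rule \<mu>R)
    then show ?thesis
      using a x linear_maps_minus[OF F D \<mu>_lin[OF x] a] by (simp add: coset_eq_iff[OF D W] \<mu>_closed)
  qed
  \<comment> \<open>An arbitrary coefficient vector representing \<open>n\<close>. Two choices
    differ by a relation, so by \<open>cong\<close> the map \<open>g\<close> below does not depend
    on it.\<close>
  define b where "b n = (SOME b. b \<in> carrier F \<and> free_ext K N \<nu> b = n)" for n
  have b: "b n \<in> carrier F" "free_ext K N \<nu> (b n) = n" if "n \<in> carrier N" for n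
  proof -
    have "\<exists>b. b \<in> carrier F \<and> free_ext K N \<nu> b = n"
      using gen[OF that] by (auto simp: F_def)
    then have "b n \<in> carrier F \<and> free_ext K N \<nu> (b n) = n"
      unfolding b_def by (rule someI_ex)
    then show "b n \<in> carrier F" "free_ext K N \<nu> (b n) = n"
      by auto
  qed
  define g where "g n x = W +>\<^bsub>D\<^esub> \<mu> (b n) x" for n x
  have g: "g (free_ext K N \<nu> a) x = W +>\<^bsub>D\<^esub> \<mu> a x" if "a \<in> carrier F" "x \<in> carrier C" for a x
    unfolding g_def using that b linear_maps_closed[OF ext] by (intro cong) auto
  have g1: "(\<lambda>n. g n x) \<in> linear_maps K N Q" if x: "x \<in> carrier C" for x
  proof (rule linear_mapsI)
    fix n assume n: "n \<in> carrier N"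
    show "g n x \<in> carrier Q"
      unfolding g_def using n x by (intro linear_maps_closed[OF proj] \<mu>_closed b)
    show "g (k \<odot>\<^bsub>N\<^esub> n) x = k \<odot>\<^bsub>Q\<^esub> g n x" if k: "k \<in> carrier K" for k
    proof -
      have "g (k \<odot>\<^bsub>N\<^esub> n) x = W +>\<^bsub>D\<^esub> \<mu> (k \<odot>\<^bsub>F\<^esub> b n) x"
        using g[of "k \<odot>\<^bsub>F\<^esub> b n" x] n x k b by (simp add: linear_maps_smult[OF ext])
      also have "\<dots> = k \<odot>\<^bsub>Q\<^esub> g n x"
        unfolding g_def using n x k b
        by (simp add: \<mu>_smult1 linear_maps_smult[OF proj] \<mu>_closed)
      finally show ?thesis .
    qed
    fix n' assume n': "n' \<in> carrier N"
    have "g (n \<oplus>\<^bsub>N\<^esub> n') x = W +>\<^bsub>D\<^esub> \<mu> (b n \<oplus>\<^bsub>F\<^esub> b n') x"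
      using g[of "b n \<oplus>\<^bsub>F\<^esub> b n'" x] n n' x b by (simp add: linear_maps_add[OF ext])
    also have "\<dots> = g n x \<oplus>\<^bsub>Q\<^esub> g n' x"
      unfolding g_def using n n' x b
      by (simp add: \<mu>_add1 linear_maps_add[OF proj] \<mu>_closed)
    finally show "g (n \<oplus>\<^bsub>N\<^esub> n') x = g n x \<oplus>\<^bsub>Q\<^esub> g n' x" .
  qed
  have g2: "g n \<in> linear_maps K C Q" if n: "n \<in> carrier N" for n
    unfolding g_def
  proof (rule linear_maps_comp[OF _ proj], rule linear_mapsI)
    show "\<mu> (b n) x \<in> carrier D" if "x \<in> carrier C" for x
      using n that by (intro \<mu>_closed b)
    show "\<mu> (b n) (x \<oplus>\<^bsub>C\<^esub> y) = \<mu> (b n) x \<oplus>\<^bsub>D\<^esub> \<mu> (b n) y" if "x \<in> carrier C" "y \<in> carrier C" for x y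
      by (rule \<mu>_add2[OF b(1)[OF n] that])
    show "\<mu> (b n) (k \<odot>\<^bsub>C\<^esub> x) = k \<odot>\<^bsub>D\<^esub> \<mu> (b n) x" if "k \<in> carrier K" "x \<in> carrier C" for k x
      by (rule \<mu>_smult2[OF b(1)[OF n] that(2) that(1)])
  qed
  have lift: "tensor_lift Q K g \<in> linear_maps K (tensor K N C) Q"
    "\<And>m n. m \<in> carrier N \<Longrightarrow> n \<in> carrier C \<Longrightarrow> tensor_lift Q K g (pure_tensor K N C m n) = g m n"
    by (intro pure_tensor_lift[OF N C Q] g1 g2; assumption)+
  have e: "free_basis K s \<in> carrier F" "free_ext K N \<nu> (free_basis K s) = \<nu> s" "\<nu> s \<in> carrier N"
    if "s \<in> A" for s
    using subsetD[OF A(2) that] \<nu> free_basis_carrier[OF N.is_cring] free_ext_basis[OF N \<nu>]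
    by (auto simp: F_def)
  let ?T = "tensor K N C"
  have T: "module K ?T"
    by (rule tensor_module[OF N C])
  have "\<zero>\<^bsub>Q\<^esub> = tensor_lift Q K g (\<Oplus>\<^bsub>?T\<^esub>s\<in>A. pure_tensor K N C (\<nu> s) (c s))"
    by (simp add: zero linear_maps_zero[OF T Q lift(1)])
  also have "\<dots> = (\<Oplus>\<^bsub>Q\<^esub>s\<in>A. tensor_lift Q K g (pure_tensor K N C (\<nu> s) (c s)))"
    using e c by (intro linear_maps_finsum[OF T Q lift(1) A(1)]) (auto intro: pure_tensor_closed[OF N C])
  also have "\<dots> = (\<Oplus>\<^bsub>Q\<^esub>s\<in>A. W +>\<^bsub>D\<^esub> \<mu> (free_basis K s) (c s))"
  proof -
    interpret Q: module K Q by (rule Q)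
    show ?thesis
    proof (rule Q.finsum_cong'[OF refl])
      show "(\<lambda>s. W +>\<^bsub>D\<^esub> \<mu> (free_basis K s) (c s)) \<in> A \<rightarrow> carrier Q"
        using e c by (auto intro!: linear_maps_closed[OF proj] \<mu>_closed)
      fix s assume s: "s \<in> A"
      show "tensor_lift Q K g (pure_tensor K N C (\<nu> s) (c s)) = W +>\<^bsub>D\<^esub> \<mu> (free_basis K s) (c s)"
        using g[OF e(1)[OF s] c] lift(2)[OF e(3)[OF s] c] e(2)[OF s] by simp
    qed
  qed
  also have "\<dots> = W +>\<^bsub>D\<^esub> (\<Oplus>\<^bsub>D\<^esub>s\<in>A. \<mu> (free_basis K s) (c s))"
    using e c by (intro linear_maps_finsum[OF D Q proj A(1), symmetric]) (auto intro: \<mu>_closed)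
  finally have "W +>\<^bsub>D\<^esub> (\<Oplus>\<^bsub>D\<^esub>s\<in>A. \<mu> (free_basis K s) (c s)) = \<zero>\<^bsub>quot_module D W\<^esub>"
    by (simp add: Q_def)
  moreover have "(\<Oplus>\<^bsub>D\<^esub>s\<in>A. \<mu> (free_basis K s) (c s)) \<in> carrier D"
    using e c by (auto intro!: D.finsum_closed \<mu>_closed)
  ultimately have "(\<Oplus>\<^bsub>D\<^esub>s\<in>A. \<mu> (free_basis K s) (c s)) \<in> W"
    using coset_eq_zero_iff[OF D W] by blast
  \<comment> \<open>Evaluation at t is linear, and only the basis vector at t contributes to the
    entry there.\<close>
  moreover have "(\<Oplus>\<^bsub>D\<^esub>s\<in>A. \<mu> (free_basis K s) (c s)) = (\<lambda>s. if s \<in> A then c s else \<zero>\<^bsub>C\<^esub>)"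
  proof
    fix t
    have eval: "(\<lambda>f. f t) \<in> linear_maps K D C"
      by (auto simp: D_def fun_module_simps linear_maps_def)
    have "(\<Oplus>\<^bsub>D\<^esub>s\<in>A. \<mu> (free_basis K s) (c s)) t = (\<Oplus>\<^bsub>C\<^esub>s\<in>A. \<mu> (free_basis K s) (c s) t)"
      using e c by (intro linear_maps_finsum[OF D C eval A(1)]) (auto intro: \<mu>_closed)
    also have "\<dots> = (\<Oplus>\<^bsub>C\<^esub>s\<in>A. if t = s then c s else \<zero>\<^bsub>C\<^esub>)"
      using c by (intro C.finsum_cong') (auto simp: \<mu>_def free_basis_def)
    also have "\<dots> = (if t \<in> A then c t else \<zero>\<^bsub>C\<^esub>)"
      using A c by (intro C.finsum_delta) auto
    finally show "(\<Oplus>\<^bsub>D\<^esub>s\<in>A. \<mu> (free_basis K s) (c s)) t = (if t \<in> A then c t else \<zero>\<^bsub>C\<^esub>)" .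
  qed
  ultimately show ?thesis
    by (simp add: W_def R_def F_def)
qed

subsection \<open>Flatness\<close>

context
  fixes K :: "('k, 'r) ring_scheme" and N :: "('k, 'n, 'y) module_scheme"
    and C :: "('k, 'c, 'x) module_scheme"
  assumes flat: "flat_module K C" and N: "module K N"
begin

text \<open>The equational criterion for flatness. A sum that vanishes in \<open>N \<otimes> C\<close> already vanishes in
  \<open>N\<^sub>2 \<otimes> C\<close> for some \<open>N\<^sub>2 = K\<^sup>U / R\<close> with \<open>U\<close> a finite set of numbers, which is a test module of
  \<^const>\<open>flat_module\<close>; by flatness it vanishes in \<open>N\<^sub>1 \<otimes> C\<close> for the submodule \<open>N\<^sub>1\<close> of \<open>N\<^sub>2\<close>
  generated by the elements in the sum.\<close>

lemma flat_relations:
  assumes n: "\<And>k. n k \<in> carrier N" and c: "\<And>k. c k \<in> carrier C"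
    and zero: "(\<Oplus>\<^bsub>tensor K N C\<^esub>k\<in>{..<r :: nat}. pure_tensor K N C (n k) (c k)) = \<zero>\<^bsub>tensor K N C\<^esub>"
  shows "\<exists>(L :: nat) a c'. (\<forall>k l. a k l \<in> carrier K) \<and> (\<forall>l. c' l \<in> carrier C) \<and>
    (\<forall>k<r. c k = (\<Oplus>\<^bsub>C\<^esub>l\<in>{..<L}. a k l \<odot>\<^bsub>C\<^esub> c' l)) \<and>
    (\<forall>l. (\<Oplus>\<^bsub>N\<^esub>k\<in>{..<r}. a k l \<odot>\<^bsub>N\<^esub> n k) = \<zero>\<^bsub>N\<^esub>)"
proof -
  have C: "module K C"
    using flat by (simp add: flat_module_def)
  interpret N: module K N by (rule N)
  interpret C: module K C by (rule C)
  note cring = N.is_cring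

  \<comment> \<open>Generators come in two kinds: the tag \<open>Inl\<close> marks the given
    elements, so that repeated values keep separate indices, and the tag \<open>Inr\<close> marks
    all elements of \<open>N\<close>, which makes the presentation trivially surjective. The
    auxiliary generators get the second factor zero.\<close>
  define S where "S = Inl ` {..<r} \<union> Inr ` carrier N"
  define A :: "(nat + 'n) set" where "A = Inl ` {..<r}"
  define \<nu> where "\<nu> = case_sum n (\<lambda>x. x)"
  define d where "d = case_sum c (\<lambda>_ :: 'n. \<zero>\<^bsub>C\<^esub>)"
  have \<nu>: "\<nu> \<in> S \<rightarrow> carrier N"
    using n by (auto simp: S_def \<nu>_def)
  have A: "finite A" "A \<subseteq> S"
    by (auto simp: A_def S_def)
  have d: "d s \<in> carrier C" for s
    using c by (cases s) (auto simp: d_def)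
  have "(\<Oplus>\<^bsub>tensor K N C\<^esub>s\<in>A. pure_tensor K N C (\<nu> s) (d s)) = \<zero>\<^bsub>tensor K N C\<^esub>"
  proof -
    interpret T: module K "tensor K N C" by (rule tensor_module[OF N C])
    have "(\<Oplus>\<^bsub>tensor K N C\<^esub>s\<in>A. pure_tensor K N C (\<nu> s) (d s)) =
        (\<Oplus>\<^bsub>tensor K N C\<^esub>k\<in>{..<r}. pure_tensor K N C (\<nu> (Inl k)) (d (Inl k)))"
      unfolding A_def using n c
      by (intro T.finsum_reindex) (auto simp: \<nu>_def d_def intro!: pure_tensor_closed[OF N C])
    then show ?thesis
      using zero by (simp add: \<nu>_def d_def)
  qed
  moreover have "\<exists>b\<in>carrier (free_module K S). free_ext K N \<nu> b = x" if "x \<in> carrier N" for x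
    using that free_basis_carrier[OF cring, of "Inr x" S] free_ext_basis[OF N \<nu>, of "Inr x"]
    by (auto simp: S_def \<nu>_def)
  ultimately have "(\<lambda>s. if s \<in> A then d s else \<zero>\<^bsub>C\<^esub>) \<in>
    relation_combinations {a \<in> carrier (free_module K S). free_ext K N \<nu> a = \<zero>\<^bsub>N\<^esub>} C"
    by (intro tensor_sum_zero_relations[OF N C \<nu> _ A d])
  then obtain L :: nat and a c1
    where rel: "\<And>l. a l \<in> {a \<in> carrier (free_module K S). free_ext K N \<nu> a = \<zero>\<^bsub>N\<^esub>}"
      and c1: "\<And>l. c1 l \<in> carrier C"
      and dd: "(\<lambda>s. if s \<in> A then d s else \<zero>\<^bsub>C\<^esub>) = (\<lambda>s. \<Oplus>\<^bsub>C\<^esub>l\<in>{..<L}. a l s \<odot>\<^bsub>C\<^esub> c1 l)"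
    by (rule relation_combinationsE) (rule that)
  have a: "a l \<in> carrier (free_module K S)" "free_ext K N \<nu> (a l) = \<zero>\<^bsub>N\<^esub>" for l
    using rel[of l] by auto
  have d_eq: "d s = (\<Oplus>\<^bsub>C\<^esub>l\<in>{..<L}. a l s \<odot>\<^bsub>C\<^esub> c1 l)" if "s \<in> S" for s
    using fun_cong[OF dd, of s] that by (auto simp: A_def S_def d_def image_iff)
  have a_closed: "a l s \<in> carrier K" for l s
    using a(1)[of l] by (simp add: free_carrier)

  \<comment> \<open>Besides the given elements, only the finitely many generators that occur in the
    relations \<open>a l\<close> with \<open>l < L\<close> are kept.\<close>
  define S0 where "S0 = A \<union> (\<Union>l\<in>{..<L}. {s. a l s \<noteq> \<zero>\<^bsub>K\<^esub>})"
  have S0: "finite S0" "S0 \<subseteq> S" "A \<subseteq> S0"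
    using A free_support[OF a(1)] by (auto simp: S0_def)
  \<comment> \<open>Renaming generators by numbers puts the free module on functions from
    \<open>nat\<close> to \<open>'k\<close> and its quotient into the type of the test
    modules.\<close>
  obtain h :: "nat + 'n \<Rightarrow> nat" where h: "inj_on h S0"
    using finite_imp_inj_to_nat_seg[OF S0(1)] by blast
  define U where "U = h ` S0"
  define \<nu>' where "\<nu>' u = \<nu> (inv_into S0 h u)" for u
  have \<nu>'h: "\<nu>' (h s) = \<nu> s" if "s \<in> S0" for s
    using that h by (simp add: \<nu>'_def)
  have \<nu>': "\<nu>' \<in> U \<rightarrow> carrier N"
    using \<nu> S0 by (auto simp: U_def \<nu>'h)
  define F where "F = free_module K U"
  have F: "module K F"
    unfolding F_def by (rule free_module_module[OF cring])
  interpret F: module K F by (rule F)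
  have ext: "free_ext K N \<nu>' \<in> linear_maps K F N"
    unfolding F_def by (rule free_ext_linear[OF N \<nu>'])
  \<comment> \<open>All relations among the chosen generators are divided out, not only the
    \<open>a l\<close>. Hence the quotient embeds into \<open>N\<close>, and a combination vanishes
    in it exactly if it vanishes in \<open>N\<close>; this is
    \<open>\<epsilon>_zero_iff\<close>.\<close>
  define R where "R = {b \<in> carrier F. free_ext K N \<nu>' b = \<zero>\<^bsub>N\<^esub>}"
  have R: "submodule R K F"
    unfolding R_def by (rule linear_kernel_submodule[OF F N ext])
  define e where "e s = free_basis K (h s)" for s
  have e: "e s \<in> carrier F" "free_ext K N \<nu>' (e s) = \<nu> s" if "s \<in> S0" for s
    using that free_basis_carrier[OF cring, of "h s" U] free_ext_basis[OF N \<nu>', of "h s"]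
    by (auto simp: U_def F_def e_def \<nu>'h)
  have comb: "free_ext K N \<nu>' (\<Oplus>\<^bsub>F\<^esub>s\<in>X. b s \<odot>\<^bsub>F\<^esub> e s) = (\<Oplus>\<^bsub>N\<^esub>s\<in>X. b s \<odot>\<^bsub>N\<^esub> \<nu> s)"
    if "X \<subseteq> S0" "\<And>s. b s \<in> carrier K" for X b
  proof -
    have X: "finite X"
      using that(1) S0(1) finite_subset by blast
    have "free_ext K N \<nu>' (\<Oplus>\<^bsub>F\<^esub>s\<in>X. b s \<odot>\<^bsub>F\<^esub> e s) = (\<Oplus>\<^bsub>N\<^esub>s\<in>X. free_ext K N \<nu>' (b s \<odot>\<^bsub>F\<^esub> e s))"
      using that e by (intro linear_maps_finsum[OF F N ext X]) auto
    also have "\<dots> = (\<Oplus>\<^bsub>N\<^esub>s\<in>X. b s \<odot>\<^bsub>N\<^esub> \<nu> s)"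
    proof (rule N.finsum_cong'[OF refl])
      show "(\<lambda>s. b s \<odot>\<^bsub>N\<^esub> \<nu> s) \<in> X \<rightarrow> carrier N"
        using that \<nu> S0 by (auto simp: Pi_iff subset_iff)
      show "free_ext K N \<nu>' (b s \<odot>\<^bsub>F\<^esub> e s) = b s \<odot>\<^bsub>N\<^esub> \<nu> s" if "s \<in> X" for s
        using that \<open>X \<subseteq> S0\<close> \<open>\<And>s. b s \<in> carrier K\<close> e by (auto simp: linear_maps_smult[OF ext])
    qed
    finally show ?thesis .
  qed

  define N2 where "N2 = quot_module F R"
  have N2: "module K N2"
    unfolding N2_def by (rule quot_module_module[OF F R])
  interpret N2: module K N2 by (rule N2)
  have proj: "(\<lambda>x. R +>\<^bsub>F\<^esub> x) \<in> linear_maps K F N2"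
    unfolding N2_def by (rule coset_linear[OF F R])
  define \<epsilon> where "\<epsilon> s = R +>\<^bsub>F\<^esub> e s" for s
  have \<epsilon>: "\<epsilon> s \<in> carrier N2" if "s \<in> S0" for s
    unfolding \<epsilon>_def using e(1)[OF that] by (rule linear_maps_closed[OF proj])
  have \<epsilon>_comb: "(\<Oplus>\<^bsub>N2\<^esub>s\<in>X. b s \<odot>\<^bsub>N2\<^esub> \<epsilon> s) = R +>\<^bsub>F\<^esub> (\<Oplus>\<^bsub>F\<^esub>s\<in>X. b s \<odot>\<^bsub>F\<^esub> e s)"
    if "X \<subseteq> S0" "\<And>s. b s \<in> carrier K" for X b
  proof -
    have X: "finite X"
      using that(1) S0(1) finite_subset by blast
    have "R +>\<^bsub>F\<^esub> (\<Oplus>\<^bsub>F\<^esub>s\<in>X. b s \<odot>\<^bsub>F\<^esub> e s) = (\<Oplus>\<^bsub>N2\<^esub>s\<in>X. R +>\<^bsub>F\<^esub> (b s \<odot>\<^bsub>F\<^esub> e s))"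
      using that e by (intro linear_maps_finsum[OF F N2 proj X]) auto
    also have "\<dots> = (\<Oplus>\<^bsub>N2\<^esub>s\<in>X. b s \<odot>\<^bsub>N2\<^esub> \<epsilon> s)"
    proof (rule N2.finsum_cong'[OF refl])
      show "(\<lambda>s. b s \<odot>\<^bsub>N2\<^esub> \<epsilon> s) \<in> X \<rightarrow> carrier N2"
        using that \<epsilon> by auto
      show "R +>\<^bsub>F\<^esub> (b s \<odot>\<^bsub>F\<^esub> e s) = b s \<odot>\<^bsub>N2\<^esub> \<epsilon> s" if "s \<in> X" for s
        using that \<open>X \<subseteq> S0\<close> \<open>\<And>s. b s \<in> carrier K\<close> e by (auto simp: linear_maps_smult[OF proj] \<epsilon>_def)
    qed
    finally show ?thesis ..
  qed
  have \<epsilon>_zero_iff: "(\<Oplus>\<^bsub>N2\<^esub>s\<in>X. b s \<odot>\<^bsub>N2\<^esub> \<epsilon> s) = \<zero>\<^bsub>N2\<^esub> \<longleftrightarrow> (\<Oplus>\<^bsub>N\<^esub>s\<in>X. b s \<odot>\<^bsub>N\<^esub> \<nu> s) = \<zero>\<^bsub>N\<^esub>"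
    if X: "X \<subseteq> S0" "\<And>s. b s \<in> carrier K" for X b
  proof -
    have "(\<Oplus>\<^bsub>F\<^esub>s\<in>X. b s \<odot>\<^bsub>F\<^esub> e s) \<in> carrier F"
      using X e by (intro F.finsum_closed) auto
    then show ?thesis
      unfolding \<epsilon>_comb[OF X] unfolding N2_def coset_eq_zero_iff[OF F R \<open>_ \<in> carrier F\<close>]
      by (simp add: R_def comb[OF X])
  qed
  have a_rel: "(\<Oplus>\<^bsub>N2\<^esub>s\<in>S0. a l s \<odot>\<^bsub>N2\<^esub> \<epsilon> s) = \<zero>\<^bsub>N2\<^esub>" if "l < L" for l
  proof -
    have "{s. a l s \<noteq> \<zero>\<^bsub>K\<^esub>} \<subseteq> S0"
      using that by (auto simp: S0_def)
    then have "(\<Oplus>\<^bsub>N\<^esub>s\<in>S0. a l s \<odot>\<^bsub>N\<^esub> \<nu> s) = \<zero>\<^bsub>N\<^esub>"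
      using free_ext_eq[OF N \<nu> a(1)[of l] S0(1) _ S0(2)] a(2)[of l] by simp
    then show ?thesis
      by (subst \<epsilon>_zero_iff) (auto simp: a_closed)
  qed

  let ?T2 = "tensor K N2 C"
  interpret T2: module K ?T2 by (rule tensor_module[OF N2 C])
  note pl = pure_tensor_linear[OF N2 C]
  \<comment> \<open>Substituting the expressions for \<open>d s\<close> and exchanging the two sums
    leaves, for each \<open>l\<close>, a pure tensor whose first factor is the relation
    \<open>a l\<close> evaluated in \<open>N2\<close>, which is zero.\<close>
  have "(\<Oplus>\<^bsub>?T2\<^esub>s\<in>A. pure_tensor K N2 C (\<epsilon> s) (d s)) = (\<Oplus>\<^bsub>?T2\<^esub>s\<in>S0. pure_tensor K N2 C (\<epsilon> s) (d s))"
  proof (rule T2.add.finprod_mono_neutral_cong_left[OF S0(1,3)])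
    show "pure_tensor K N2 C (\<epsilon> s) (d s) = \<zero>\<^bsub>?T2\<^esub>" if "s \<in> S0 - A" for s
    proof -
      have "d s = \<zero>\<^bsub>C\<^esub>"
        using that S0 by (auto simp: d_def A_def S_def)
      then show ?thesis
        using that linear_maps_zero[OF C T2.module_axioms pl(2)[OF \<epsilon>]] by simp
    qed
  qed (auto intro: pure_tensor_closed[OF N2 C] \<epsilon> d)
  also have "\<dots> = (\<Oplus>\<^bsub>?T2\<^esub>s\<in>S0. \<Oplus>\<^bsub>?T2\<^esub>l\<in>{..<L}. pure_tensor K N2 C (a l s \<odot>\<^bsub>N2\<^esub> \<epsilon> s) (c1 l))"
  proof (rule T2.finsum_cong'[OF refl])
    show "(\<lambda>s. \<Oplus>\<^bsub>?T2\<^esub>l\<in>{..<L}. pure_tensor K N2 C (a l s \<odot>\<^bsub>N2\<^esub> \<epsilon> s) (c1 l)) \<in> S0 \<rightarrow> carrier ?T2"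
      by (auto intro!: T2.finsum_closed pure_tensor_closed[OF N2 C] \<epsilon> a_closed c1)
    fix s assume s: "s \<in> S0"
    have "pure_tensor K N2 C (\<epsilon> s) (d s) =
        (\<Oplus>\<^bsub>?T2\<^esub>l\<in>{..<L}. pure_tensor K N2 C (\<epsilon> s) (a l s \<odot>\<^bsub>C\<^esub> c1 l))"
      using s S0 by (subst d_eq, blast, intro linear_maps_finsum[OF C T2.module_axioms pl(2)[OF \<epsilon>]])
        (auto simp: a_closed c1)
    also have "\<dots> = (\<Oplus>\<^bsub>?T2\<^esub>l\<in>{..<L}. pure_tensor K N2 C (a l s \<odot>\<^bsub>N2\<^esub> \<epsilon> s) (c1 l))"
    proof (rule T2.finsum_cong'[OF refl])
      show "(\<lambda>l. pure_tensor K N2 C (a l s \<odot>\<^bsub>N2\<^esub> \<epsilon> s) (c1 l)) \<in> {..<L} \<rightarrow> carrier ?T2"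
        using s by (auto intro!: pure_tensor_closed[OF N2 C] \<epsilon> a_closed c1)
      show "pure_tensor K N2 C (\<epsilon> s) (a l s \<odot>\<^bsub>C\<^esub> c1 l) = pure_tensor K N2 C (a l s \<odot>\<^bsub>N2\<^esub> \<epsilon> s) (c1 l)"
        if "l \<in> {..<L}" for l
        using linear_maps_smult[OF pl(2)[OF \<epsilon>[OF s]] a_closed c1]
          linear_maps_smult[OF pl(1)[OF c1] a_closed \<epsilon>[OF s]] by simp
    qed
    finally show "pure_tensor K N2 C (\<epsilon> s) (d s) =
      (\<Oplus>\<^bsub>?T2\<^esub>l\<in>{..<L}. pure_tensor K N2 C (a l s \<odot>\<^bsub>N2\<^esub> \<epsilon> s) (c1 l))" .
  qed
  also have "\<dots> = (\<Oplus>\<^bsub>?T2\<^esub>l\<in>{..<L}. \<Oplus>\<^bsub>?T2\<^esub>s\<in>S0. pure_tensor K N2 C (a l s \<odot>\<^bsub>N2\<^esub> \<epsilon> s) (c1 l))"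
    by (rule T2.finsum_swap[OF S0(1)]) (auto intro!: pure_tensor_closed[OF N2 C] \<epsilon> a_closed c1)
  also have "\<dots> = (\<Oplus>\<^bsub>?T2\<^esub>l\<in>{..<L}. \<zero>\<^bsub>?T2\<^esub>)"
  proof (rule T2.finsum_cong'[OF refl])
    fix l assume l: "l \<in> {..<L}"
    have "(\<Oplus>\<^bsub>?T2\<^esub>s\<in>S0. pure_tensor K N2 C (a l s \<odot>\<^bsub>N2\<^esub> \<epsilon> s) (c1 l)) =
        pure_tensor K N2 C (\<Oplus>\<^bsub>N2\<^esub>s\<in>S0. a l s \<odot>\<^bsub>N2\<^esub> \<epsilon> s) (c1 l)"
      by (rule linear_maps_finsum[OF N2 T2.module_axioms pl(1)[OF c1] S0(1), symmetric])
        (auto simp: \<epsilon> a_closed)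
    also have "\<dots> = \<zero>\<^bsub>?T2\<^esub>"
      using l a_rel linear_maps_zero[OF N2 T2.module_axioms pl(1)[OF c1]] by simp
    finally show "(\<Oplus>\<^bsub>?T2\<^esub>s\<in>S0. pure_tensor K N2 C (a l s \<odot>\<^bsub>N2\<^esub> \<epsilon> s) (c1 l)) = \<zero>\<^bsub>?T2\<^esub>" .
  qed auto
  finally have zero2: "(\<Oplus>\<^bsub>?T2\<^esub>s\<in>A. pure_tensor K N2 C (\<epsilon> s) (d s)) = \<zero>\<^bsub>?T2\<^esub>"
    by simp

  have \<epsilon>A: "\<epsilon> \<in> A \<rightarrow> carrier N2"
    using \<epsilon> S0 by blast
  \<comment> \<open>Shrinking only the carrier keeps the element type, so \<open>N1\<close> is a
    test module as well. The auxiliary generators are gone: whatever relations come out of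
    \<open>N1\<close> involve the given elements alone.\<close>
  define N1 where "N1 = N2\<lparr>carrier := free_ext K N2 \<epsilon> ` carrier (free_module K A)\<rparr>"
  have sub1: "submodule (carrier N1) K N2"
    unfolding N1_def using linear_image_submodule[OF free_module_module[OF cring] N2 free_ext_linear[OF N2 \<epsilon>A]]
    by simp
  have "N1 = N2\<lparr>carrier := carrier N1\<rparr>"
    by (simp add: N1_def)
  then have N1: "module K N1"
    using submodule.submodule_is_module[OF sub1 N2] by simp
  interpret N1: module K N1 by (rule N1)
  have N1_simps: "\<zero>\<^bsub>N1\<^esub> = \<zero>\<^bsub>N2\<^esub>" "x \<oplus>\<^bsub>N1\<^esub> y = x \<oplus>\<^bsub>N2\<^esub> y" "k \<odot>\<^bsub>N1\<^esub> x = k \<odot>\<^bsub>N2\<^esub> x" for x y k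
    by (simp_all add: N1_def)
  have incl: "(\<lambda>x. x) \<in> linear_maps K N1 N2"
    using submodule_subset[OF sub1] by (intro linear_mapsI) (auto simp: N1_simps)
  have \<epsilon>1: "\<epsilon> s \<in> carrier N1" if "s \<in> A" for s
    using that free_basis_carrier[OF cring that] free_ext_basis[OF N2 \<epsilon>A that, symmetric]
    by (simp add: N1_def)
  have ext1: "free_ext K N1 \<epsilon> b = free_ext K N2 \<epsilon> b" if b: "b \<in> carrier (free_module K A)" for b
    using linear_maps_finsum[OF N1 N2 incl free_support(1)[OF b], of "\<lambda>s. b s \<odot>\<^bsub>N2\<^esub> \<epsilon> s"]
      b free_support(2)[OF b] N1.smult_closed[OF _ \<epsilon>1, unfolded N1_simps]
    by (auto simp: free_ext_def N1_simps free_carrier)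
  let ?T1 = "tensor K N1 C"
  interpret T1: module K ?T1 by (rule tensor_module[OF N1 C])
  have map_lin: "tensor_map K N2 C (\<lambda>x. x) (\<lambda>x. x) \<in> linear_maps K ?T1 ?T2"
    by (rule tensor_map_linear[OF N1 C N2 C incl linear_maps_id])
  have inj: "inj_on (tensor_map K N2 C (\<lambda>x. x) (\<lambda>x. x)) (carrier ?T1)"
    using flat N1 N2 incl by (auto simp: flat_module_def)
  have z1: "(\<Oplus>\<^bsub>?T1\<^esub>s\<in>A. pure_tensor K N1 C (\<epsilon> s) (d s)) \<in> carrier ?T1"
    by (auto intro!: T1.finsum_closed pure_tensor_closed[OF N1 C] \<epsilon>1 d)
  have "tensor_map K N2 C (\<lambda>x. x) (\<lambda>x. x) (\<Oplus>\<^bsub>?T1\<^esub>s\<in>A. pure_tensor K N1 C (\<epsilon> s) (d s)) =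
      (\<Oplus>\<^bsub>?T2\<^esub>s\<in>A. tensor_map K N2 C (\<lambda>x. x) (\<lambda>x. x) (pure_tensor K N1 C (\<epsilon> s) (d s)))"
    by (rule linear_maps_finsum[OF T1.module_axioms T2.module_axioms map_lin A(1)])
      (auto intro!: pure_tensor_closed[OF N1 C] \<epsilon>1 d)
  also have "\<dots> = (\<Oplus>\<^bsub>?T2\<^esub>s\<in>A. pure_tensor K N2 C (\<epsilon> s) (d s))"
    using \<epsilon>A by (intro T2.finsum_cong')
      (auto intro!: pure_tensor_closed[OF N2 C] d tensor_map_pure[OF N1 C N2 C incl linear_maps_id] \<epsilon>1)
  also have "\<dots> = tensor_map K N2 C (\<lambda>x. x) (\<lambda>x. x) \<zero>\<^bsub>?T1\<^esub>"
    by (simp add: zero2 linear_maps_zero[OF T1.module_axioms T2.module_axioms map_lin])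
  finally have zero1: "(\<Oplus>\<^bsub>?T1\<^esub>s\<in>A. pure_tensor K N1 C (\<epsilon> s) (d s)) = \<zero>\<^bsub>?T1\<^esub>"
    using inj z1 by (auto dest: inj_onD)

  \<comment> \<open>Second use of the relation lemma, now with exactly \<open>A\<close> as the index
    set. The first use produced relations that could also involve auxiliary generators; the new ones
    translate back to \<open>N\<close> through \<open>\<epsilon>_zero_iff\<close>.\<close>
  have "(\<lambda>s. if s \<in> A then d s else \<zero>\<^bsub>C\<^esub>) \<in>
    relation_combinations {a \<in> carrier (free_module K A). free_ext K N1 \<epsilon> a = \<zero>\<^bsub>N1\<^esub>} C"
  proof (rule tensor_sum_zero_relations[OF N1 C _ _ A(1) subset_refl d zero1])
    show "\<epsilon> \<in> A \<rightarrow> carrier N1"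
      using \<epsilon>1 by blast
    show "\<exists>b\<in>carrier (free_module K A). free_ext K N1 \<epsilon> b = x" if "x \<in> carrier N1" for x
      using that ext1 by (auto simp: N1_def)
  qed
  then obtain L' :: nat and b c2
    where rel: "\<And>l. b l \<in> {a \<in> carrier (free_module K A). free_ext K N1 \<epsilon> a = \<zero>\<^bsub>N1\<^esub>}"
      and c2: "\<And>l. c2 l \<in> carrier C"
      and dd: "(\<lambda>s. if s \<in> A then d s else \<zero>\<^bsub>C\<^esub>) = (\<lambda>s. \<Oplus>\<^bsub>C\<^esub>l\<in>{..<L'}. b l s \<odot>\<^bsub>C\<^esub> c2 l)"
    by (rule relation_combinationsE) (rule that)
  have b: "b l \<in> carrier (free_module K A)" "free_ext K N1 \<epsilon> (b l) = \<zero>\<^bsub>N1\<^esub>" for l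
    using rel[of l] by auto
  have b_closed: "b l s \<in> carrier K" for l s
    using b(1)[of l] by (simp add: free_carrier)
  have "(\<Oplus>\<^bsub>N\<^esub>k\<in>{..<r}. b l (Inl k) \<odot>\<^bsub>N\<^esub> n k) = \<zero>\<^bsub>N\<^esub>" for l
  proof -
    have "(\<Oplus>\<^bsub>N2\<^esub>s\<in>A. b l s \<odot>\<^bsub>N2\<^esub> \<epsilon> s) = \<zero>\<^bsub>N2\<^esub>"
      using b(2)[of l] free_ext_eq[OF N2 \<epsilon>A b(1)[of l] A(1) free_support(2)[OF b(1)] subset_refl]
      by (simp add: ext1[OF b(1)] N1_simps)
    then have "(\<Oplus>\<^bsub>N\<^esub>s\<in>A. b l s \<odot>\<^bsub>N\<^esub> \<nu> s) = \<zero>\<^bsub>N\<^esub>"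
      by (simp add: \<epsilon>_zero_iff[OF S0(3) b_closed])
    moreover have "(\<Oplus>\<^bsub>N\<^esub>s\<in>A. b l s \<odot>\<^bsub>N\<^esub> \<nu> s) = (\<Oplus>\<^bsub>N\<^esub>k\<in>{..<r}. b l (Inl k) \<odot>\<^bsub>N\<^esub> \<nu> (Inl k))"
      unfolding A_def by (rule N.finsum_reindex) (auto simp: \<nu>_def n b_closed)
    ultimately show ?thesis
      by (simp add: \<nu>_def)
  qed
  moreover have "c k = (\<Oplus>\<^bsub>C\<^esub>l\<in>{..<L'}. b l (Inl k) \<odot>\<^bsub>C\<^esub> c2 l)" if "k < r" for k
    using fun_cong[OF dd, of "Inl k"] that by (auto simp: A_def d_def)
  ultimately show ?thesis
    using b_closed c2
    by (intro exI[of _ L'] exI[of _ "\<lambda>k l. b l (Inl k)"] exI[of _ c2]) auto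
qed

end

section \<open>Coefficient matrices and changes of second factors\<close>

lemma (in module) finsum_smult_rdistr:
  assumes "finite A" "\<And>i. i \<in> A \<Longrightarrow> f i \<in> carrier R" "x \<in> carrier M"
  shows "(\<Oplus>\<^bsub>R\<^esub>i\<in>A. f i) \<odot>\<^bsub>M\<^esub> x = (\<Oplus>\<^bsub>M\<^esub>i\<in>A. f i \<odot>\<^bsub>M\<^esub> x)"
  using assms
proof (induction rule: finite_induct)
  case empty
  then show ?case by simp
next
  case (insert a A)
  then have "f \<in> A \<rightarrow> carrier R" "(\<lambda>i. f i \<odot>\<^bsub>M\<^esub> x) \<in> A \<rightarrow> carrier M"
    by auto
  with insert show ?case
    by (simp add: smult_l_distr)
qed

text \<open>Associativity of the matrix product in coordinates. It composes two successive changes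
  of second factors.\<close>

lemma (in module) finsum_matrix_smult:
  assumes "finite A" "finite B" "\<And>i j. a i j \<in> carrier R" "\<And>j. b j \<in> carrier R" "\<And>i. x i \<in> carrier M"
  shows "(\<Oplus>\<^bsub>M\<^esub>i\<in>A. (\<Oplus>\<^bsub>R\<^esub>j\<in>B. a i j \<otimes>\<^bsub>R\<^esub> b j) \<odot>\<^bsub>M\<^esub> x i) =
    (\<Oplus>\<^bsub>M\<^esub>j\<in>B. b j \<odot>\<^bsub>M\<^esub> (\<Oplus>\<^bsub>M\<^esub>i\<in>A. a i j \<odot>\<^bsub>M\<^esub> x i))"
proof -
  have "(\<Oplus>\<^bsub>M\<^esub>i\<in>A. (\<Oplus>\<^bsub>R\<^esub>j\<in>B. a i j \<otimes>\<^bsub>R\<^esub> b j) \<odot>\<^bsub>M\<^esub> x i) =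
      (\<Oplus>\<^bsub>M\<^esub>i\<in>A. \<Oplus>\<^bsub>M\<^esub>j\<in>B. b j \<odot>\<^bsub>M\<^esub> (a i j \<odot>\<^bsub>M\<^esub> x i))"
  proof (rule M.finsum_cong'[OF refl])
    show "(\<lambda>i. \<Oplus>\<^bsub>M\<^esub>j\<in>B. b j \<odot>\<^bsub>M\<^esub> (a i j \<odot>\<^bsub>M\<^esub> x i)) \<in> A \<rightarrow> carrier M"
      using assms by (auto intro!: M.finsum_closed)
    fix i assume "i \<in> A"
    have "(\<Oplus>\<^bsub>R\<^esub>j\<in>B. a i j \<otimes>\<^bsub>R\<^esub> b j) \<odot>\<^bsub>M\<^esub> x i = (\<Oplus>\<^bsub>M\<^esub>j\<in>B. (a i j \<otimes>\<^bsub>R\<^esub> b j) \<odot>\<^bsub>M\<^esub> x i)"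
      using assms by (intro finsum_smult_rdistr) auto
    also have "\<dots> = (\<Oplus>\<^bsub>M\<^esub>j\<in>B. b j \<odot>\<^bsub>M\<^esub> (a i j \<odot>\<^bsub>M\<^esub> x i))"
      using assms by (intro M.finsum_cong') (auto simp: smult_assoc1[symmetric] m_comm)
    finally show "(\<Oplus>\<^bsub>R\<^esub>j\<in>B. a i j \<otimes>\<^bsub>R\<^esub> b j) \<odot>\<^bsub>M\<^esub> x i =
      (\<Oplus>\<^bsub>M\<^esub>j\<in>B. b j \<odot>\<^bsub>M\<^esub> (a i j \<odot>\<^bsub>M\<^esub> x i))" .
  qed
  also have "\<dots> = (\<Oplus>\<^bsub>M\<^esub>j\<in>B. \<Oplus>\<^bsub>M\<^esub>i\<in>A. b j \<odot>\<^bsub>M\<^esub> (a i j \<odot>\<^bsub>M\<^esub> x i))"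
    using assms by (intro M.finsum_swap) auto
  also have "\<dots> = (\<Oplus>\<^bsub>M\<^esub>j\<in>B. b j \<odot>\<^bsub>M\<^esub> (\<Oplus>\<^bsub>M\<^esub>i\<in>A. a i j \<odot>\<^bsub>M\<^esub> x i))"
    using assms by (intro M.finsum_cong' refl finsum_smult_ldistr[symmetric]) (auto intro!: M.finsum_closed)
  finally show ?thesis .
qed

text \<open>Coefficients move across the tensor sign: if the old second factors arise from the new
  ones by a matrix, the new first factors arise from the old ones by the transposed matrix.\<close>

lemma tensor_sum_change:
  fixes r L :: nat
  assumes M: "module K M" and C: "module K C"
    and p: "\<And>k. p k \<in> carrier M" and a: "\<And>k l. a k l \<in> carrier K" and c': "\<And>l. c' l \<in> carrier C"
    and c: "\<And>k. k < r \<Longrightarrow> c k = (\<Oplus>\<^bsub>C\<^esub>l\<in>{..<L}. a k l \<odot>\<^bsub>C\<^esub> c' l)"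
  shows "(\<Oplus>\<^bsub>tensor K M C\<^esub>k\<in>{..<r}. pure_tensor K M C (p k) (c k)) =
    (\<Oplus>\<^bsub>tensor K M C\<^esub>l\<in>{..<L}. pure_tensor K M C (\<Oplus>\<^bsub>M\<^esub>k\<in>{..<r}. a k l \<odot>\<^bsub>M\<^esub> p k) (c' l))"
proof -
  let ?T = "tensor K M C"
  interpret M: module K M by (rule M)
  interpret C: module K C by (rule C)
  interpret T: module K ?T by (rule tensor_module[OF M C])
  note pl = pure_tensor_linear[OF M C]
  note closed = pure_tensor_closed[OF M C]
  have "(\<Oplus>\<^bsub>?T\<^esub>k\<in>{..<r}. pure_tensor K M C (p k) (c k)) =
      (\<Oplus>\<^bsub>?T\<^esub>k\<in>{..<r}. \<Oplus>\<^bsub>?T\<^esub>l\<in>{..<L}. pure_tensor K M C (a k l \<odot>\<^bsub>M\<^esub> p k) (c' l))"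
  proof (rule T.finsum_cong'[OF refl])
    show "(\<lambda>k. \<Oplus>\<^bsub>?T\<^esub>l\<in>{..<L}. pure_tensor K M C (a k l \<odot>\<^bsub>M\<^esub> p k) (c' l)) \<in> {..<r} \<rightarrow> carrier ?T"
      using p a c' by (auto intro!: T.finsum_closed closed)
    fix k assume "k \<in> {..<r}"
    then have "pure_tensor K M C (p k) (c k) =
        (\<Oplus>\<^bsub>?T\<^esub>l\<in>{..<L}. pure_tensor K M C (p k) (a k l \<odot>\<^bsub>C\<^esub> c' l))"
      using p a c' by (simp add: c linear_maps_finsum[OF C T.module_axioms pl(2)])
    also have "\<dots> = (\<Oplus>\<^bsub>?T\<^esub>l\<in>{..<L}. pure_tensor K M C (a k l \<odot>\<^bsub>M\<^esub> p k) (c' l))"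
      using p a c'
      by (intro T.finsum_cong' refl) (auto intro!: closed simp: linear_maps_smult[OF pl(1)] linear_maps_smult[OF pl(2)])
    finally show "pure_tensor K M C (p k) (c k) =
      (\<Oplus>\<^bsub>?T\<^esub>l\<in>{..<L}. pure_tensor K M C (a k l \<odot>\<^bsub>M\<^esub> p k) (c' l))" .
  qed
  also have "\<dots> = (\<Oplus>\<^bsub>?T\<^esub>l\<in>{..<L}. \<Oplus>\<^bsub>?T\<^esub>k\<in>{..<r}. pure_tensor K M C (a k l \<odot>\<^bsub>M\<^esub> p k) (c' l))"
    using p a c' by (intro T.finsum_swap) (auto intro!: closed)
  also have "\<dots> = (\<Oplus>\<^bsub>?T\<^esub>l\<in>{..<L}. pure_tensor K M C (\<Oplus>\<^bsub>M\<^esub>k\<in>{..<r}. a k l \<odot>\<^bsub>M\<^esub> p k) (c' l))"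
    using p a c' by (intro T.finsum_cong' refl linear_maps_finsum[OF M T.module_axioms pl(1), symmetric])
      (auto intro!: closed M.finsum_closed)
  finally show ?thesis .
qed

text \<open>Relations obtained for some of the modules survive a further change of second factors,
  because the new first factors are linear combinations of those already known to vanish. One
  application of \<open>flat_relations\<close> for each member of \<open>T\<close> therefore yields
  a single change that works for all.\<close>

lemma flat_relations_family:
  fixes K :: "('k, 'r) ring_scheme" and N :: "'t \<Rightarrow> ('k, 'n, 'y) module_scheme"
    and C :: "('k, 'c, 'x) module_scheme" and r :: nat
  assumes flat: "flat_module K C" and "finite T"
    and "\<And>t. t \<in> T \<Longrightarrow> module K (N t)" "\<And>t k. t \<in> T \<Longrightarrow> n t k \<in> carrier (N t)"
    and c: "\<And>k. c k \<in> carrier C"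
    and "\<And>t. t \<in> T \<Longrightarrow>
      (\<Oplus>\<^bsub>tensor K (N t) C\<^esub>k\<in>{..<r}. pure_tensor K (N t) C (n t k) (c k)) = \<zero>\<^bsub>tensor K (N t) C\<^esub>"
  shows "\<exists>(L :: nat) a c'. (\<forall>k l. a k l \<in> carrier K) \<and> (\<forall>l. c' l \<in> carrier C) \<and>
    (\<forall>k<r. c k = (\<Oplus>\<^bsub>C\<^esub>l\<in>{..<L}. a k l \<odot>\<^bsub>C\<^esub> c' l)) \<and>
    (\<forall>t\<in>T. \<forall>l. (\<Oplus>\<^bsub>N t\<^esub>k\<in>{..<r}. a k l \<odot>\<^bsub>N t\<^esub> n t k) = \<zero>\<^bsub>N t\<^esub>)"
  using assms(2-4,6)
proof (induction rule: finite_induct)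
  case empty
  interpret C: module K C
    using flat by (simp add: flat_module_def)
  \<comment> \<open>With no relation to satisfy, the identity matrix leaves the second factors
    unchanged.\<close>
  let ?a = "\<lambda>k l. if k = l then \<one>\<^bsub>K\<^esub> else \<zero>\<^bsub>K\<^esub>"
  have "c k = (\<Oplus>\<^bsub>C\<^esub>l\<in>{..<r}. ?a k l \<odot>\<^bsub>C\<^esub> c l)" if "k < r" for k
  proof -
    have "(\<Oplus>\<^bsub>C\<^esub>l\<in>{..<r}. ?a k l \<odot>\<^bsub>C\<^esub> c l) = (\<Oplus>\<^bsub>C\<^esub>l\<in>{..<r}. if k = l then c l else \<zero>\<^bsub>C\<^esub>)"
      using c by (intro C.finsum_cong') auto
    then show ?thesis
      using c that by (simp add: C.finsum_delta)
  qed
  then show ?case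
    using c by (intro exI[of _ r] exI[of _ ?a] exI[of _ c]) auto
next
  case (insert t T)
  have C: "module K C"
    using flat by (simp add: flat_module_def)
  interpret C: module K C by (rule C)
  have Nt: "module K (N t)"
    using insert.prems by simp
  interpret Nt: module K "N t" by (rule Nt)
  have "\<exists>(L :: nat) a c'. (\<forall>k l. a k l \<in> carrier K) \<and> (\<forall>l. c' l \<in> carrier C) \<and>
    (\<forall>k<r. c k = (\<Oplus>\<^bsub>C\<^esub>l\<in>{..<L}. a k l \<odot>\<^bsub>C\<^esub> c' l)) \<and>
    (\<forall>t\<in>T. \<forall>l. (\<Oplus>\<^bsub>N t\<^esub>k\<in>{..<r}. a k l \<odot>\<^bsub>N t\<^esub> n t k) = \<zero>\<^bsub>N t\<^esub>)"
    by (rule insert.IH; rule insert.prems; rule insertI2)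
  then obtain L :: nat and a c' where "(\<forall>k l. a k l \<in> carrier K) \<and> (\<forall>l. c' l \<in> carrier C) \<and>
    (\<forall>k<r. c k = (\<Oplus>\<^bsub>C\<^esub>l\<in>{..<L}. a k l \<odot>\<^bsub>C\<^esub> c' l)) \<and>
    (\<forall>t\<in>T. \<forall>l. (\<Oplus>\<^bsub>N t\<^esub>k\<in>{..<r}. a k l \<odot>\<^bsub>N t\<^esub> n t k) = \<zero>\<^bsub>N t\<^esub>)"
    by (elim exE) (rule that)
  then have a: "\<And>k l. a k l \<in> carrier K" and c': "\<And>l. c' l \<in> carrier C"
    and ca: "\<And>k. k < r \<Longrightarrow> c k = (\<Oplus>\<^bsub>C\<^esub>l\<in>{..<L}. a k l \<odot>\<^bsub>C\<^esub> c' l)"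
    and aT: "\<And>t l. t \<in> T \<Longrightarrow> (\<Oplus>\<^bsub>N t\<^esub>k\<in>{..<r}. a k l \<odot>\<^bsub>N t\<^esub> n t k) = \<zero>\<^bsub>N t\<^esub>"
    by auto
  define m where "m l = (\<Oplus>\<^bsub>N t\<^esub>k\<in>{..<r}. a k l \<odot>\<^bsub>N t\<^esub> n t k)" for l
  have nt: "n t k \<in> carrier (N t)" for k
    using insert.prems(2) by simp
  have m: "m l \<in> carrier (N t)" for l
    unfolding m_def using a nt by (auto intro!: Nt.finsum_closed)
  have "(\<Oplus>\<^bsub>tensor K (N t) C\<^esub>l\<in>{..<L}. pure_tensor K (N t) C (m l) (c' l)) = \<zero>\<^bsub>tensor K (N t) C\<^esub>"
    unfolding m_def using insert.prems(3)[OF insertI1]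
      tensor_sum_change[where p = "n t" and a = a and c' = c' and c = c and r = r and L = L, OF Nt C nt a c' ca] by simp
  from flat_relations[OF flat Nt m c' this]
  obtain L' :: nat and b c'' where "(\<forall>k l. b k l \<in> carrier K) \<and> (\<forall>l. c'' l \<in> carrier C) \<and>
      (\<forall>k<L. c' k = (\<Oplus>\<^bsub>C\<^esub>l\<in>{..<L'}. b k l \<odot>\<^bsub>C\<^esub> c'' l)) \<and>
      (\<forall>l. (\<Oplus>\<^bsub>N t\<^esub>k\<in>{..<L}. b k l \<odot>\<^bsub>N t\<^esub> m k) = \<zero>\<^bsub>N t\<^esub>)"
    by (elim exE) (rule that)
  then have b: "\<And>k l. b k l \<in> carrier K" and c'': "\<And>l. c'' l \<in> carrier C"
    and cb: "\<And>k. k < L \<Longrightarrow> c' k = (\<Oplus>\<^bsub>C\<^esub>l\<in>{..<L'}. b k l \<odot>\<^bsub>C\<^esub> c'' l)"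
    and bm: "\<And>l. (\<Oplus>\<^bsub>N t\<^esub>k\<in>{..<L}. b k l \<odot>\<^bsub>N t\<^esub> m k) = \<zero>\<^bsub>N t\<^esub>"
    by auto
  \<comment> \<open>Product of the two coefficient matrices: \<open>a\<close> serves the members of
    \<open>T\<close>, and \<open>b\<close> then kills the remaining combinations \<open>m l\<close>
    in \<open>N t\<close>.\<close>
  define d where "d k q = (\<Oplus>\<^bsub>K\<^esub>l\<in>{..<L}. a k l \<otimes>\<^bsub>K\<^esub> b l q)" for k q
  have d: "d k q \<in> carrier K" for k q
    unfolding d_def using a b by (auto intro!: C.R.finsum_closed)
  have dN: "(\<Oplus>\<^bsub>N t'\<^esub>k\<in>{..<r}. d k q \<odot>\<^bsub>N t'\<^esub> n t' k) =
      (\<Oplus>\<^bsub>N t'\<^esub>l\<in>{..<L}. b l q \<odot>\<^bsub>N t'\<^esub> (\<Oplus>\<^bsub>N t'\<^esub>k\<in>{..<r}. a k l \<odot>\<^bsub>N t'\<^esub> n t' k))"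
    if "t' \<in> insert t T" for t' q
    unfolding d_def by (rule module.finsum_matrix_smult[OF insert.prems(1)[OF that]])
      (auto simp: a b insert.prems(2)[OF that])
  have "(\<Oplus>\<^bsub>N t'\<^esub>k\<in>{..<r}. d k q \<odot>\<^bsub>N t'\<^esub> n t' k) = \<zero>\<^bsub>N t'\<^esub>" if t': "t' \<in> insert t T" for t' q
  proof (cases "t' \<in> T")
    case True
    interpret Nt': module K "N t'" by (rule insert.prems(1)[OF t'])
    show ?thesis
      using b by (simp add: dN[OF t'] aT[OF True])
  next
    case False
    then have "t' = t"
      using t' by simp
    then show ?thesis
      using dN[OF t'] bm by (simp add: m_def)
  qed
  moreover have "c k = (\<Oplus>\<^bsub>C\<^esub>q\<in>{..<L'}. d k q \<odot>\<^bsub>C\<^esub> c'' q)" if "k < r" for k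
  proof -
    have "d k q = (\<Oplus>\<^bsub>K\<^esub>l\<in>{..<L}. b l q \<otimes>\<^bsub>K\<^esub> a k l)" for q
      unfolding d_def using a b by (intro C.R.finsum_cong' refl) (auto simp: C.m_comm)
    then have "(\<Oplus>\<^bsub>C\<^esub>q\<in>{..<L'}. d k q \<odot>\<^bsub>C\<^esub> c'' q) =
        (\<Oplus>\<^bsub>C\<^esub>l\<in>{..<L}. a k l \<odot>\<^bsub>C\<^esub> (\<Oplus>\<^bsub>C\<^esub>q\<in>{..<L'}. b l q \<odot>\<^bsub>C\<^esub> c'' q))"
      using C.finsum_matrix_smult[of "{..<L'}" "{..<L}" "\<lambda>q l. b l q" "\<lambda>l. a k l" c''] a b c'' by simp
    also have "\<dots> = (\<Oplus>\<^bsub>C\<^esub>l\<in>{..<L}. a k l \<odot>\<^bsub>C\<^esub> c' l)"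
      using a c' by (intro C.finsum_cong' refl) (auto simp: cb)
    finally show ?thesis
      using ca[OF that] by simp
  qed
  ultimately show ?case
    using d c'' by (intro exI[of _ L'] exI[of _ d] exI[of _ c'']) blast
qed

section \<open>Covers\<close>

lemma coset_union_eq:
  assumes "module K M" "submodule N K M" "submodule L K M" "N \<subseteq> L" "x \<in> carrier M"
  shows "(\<Union>y\<in>N +>\<^bsub>M\<^esub> x. L +>\<^bsub>M\<^esub> y) = L +>\<^bsub>M\<^esub> x"
  using assms by (intro UN_coset_const[OF assms(1,2,5)]) (auto simp: coset_eq_iff)

text \<open>Completeness as a Chinese remainder property of elements. Choosing representatives of
  the cosets and handling extensional families happens only here; all later arguments work with
  congruences.\<close>

lemma complete_cover_iff:
  assumes M: "module K M"
  shows "complete_cover K M I J \<longleftrightarrow> cover K M I J \<and>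
    (\<forall>x. (\<forall>i\<in>I. x i \<in> carrier M) \<and> (\<forall>i\<in>I. \<forall>j\<in>I. x i \<ominus>\<^bsub>M\<^esub> x j \<in> J i <+>\<^bsub>M\<^esub> J j) \<longrightarrow>
      (\<exists>y\<in>carrier M. \<forall>i\<in>I. y \<ominus>\<^bsub>M\<^esub> x i \<in> J i))"
proof (cases "cover K M I J")
  case False
  then show ?thesis
    by (simp add: complete_cover_def)
next
  case cover: True
  interpret M: module K M by (rule M)
  have J: "submodule (J i) K M" if "i \<in> I" for i
    using cover that by (simp add: cover_def)
  have JJ: "submodule (J i <+>\<^bsub>M\<^esub> J j) K M" if "i \<in> I" "j \<in> I" for i j
    using J that by (intro set_add_submodule[OF M])
  have glued: "(\<lambda>i\<in>I. J i +>\<^bsub>M\<^esub> x i) \<in> glued_families M I J \<longleftrightarrow>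
      (\<forall>i\<in>I. \<forall>j\<in>I. x i \<ominus>\<^bsub>M\<^esub> x j \<in> J i <+>\<^bsub>M\<^esub> J j)"
    if x: "\<And>i. i \<in> I \<Longrightarrow> x i \<in> carrier M" for x
  proof -
    have "(\<Union>y\<in>J i +>\<^bsub>M\<^esub> x i. (J i <+>\<^bsub>M\<^esub> J j) +>\<^bsub>M\<^esub> y) = (\<Union>y\<in>J j +>\<^bsub>M\<^esub> x j. (J i <+>\<^bsub>M\<^esub> J j) +>\<^bsub>M\<^esub> y) \<longleftrightarrow>
        x i \<ominus>\<^bsub>M\<^esub> x j \<in> J i <+>\<^bsub>M\<^esub> J j" if "i \<in> I" "j \<in> I" for i j
      using that x set_add_incl[OF M J J, of i j]
      by (simp add: coset_union_eq[OF M J JJ] coset_eq_iff[OF M JJ])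
    then show ?thesis
      using x by (auto simp: glued_families_def quot_carrier)
  qed
  have "(\<lambda>x. \<lambda>i\<in>I. J i +>\<^bsub>M\<^esub> x) ` carrier M \<subseteq> glued_families M I J"
  proof
    fix m assume "m \<in> (\<lambda>x. \<lambda>i\<in>I. J i +>\<^bsub>M\<^esub> x) ` carrier M"
    then obtain x where x: "x \<in> carrier M" "m = (\<lambda>i\<in>I. J i +>\<^bsub>M\<^esub> x)"
      by blast
    then show "m \<in> glued_families M I J"
      using glued[of "\<lambda>_. x"] M.minus_eq_zero_iff[OF x(1) x(1)] submodule_zero[OF JJ] by simp
  qed
  moreover have "glued_families M I J \<subseteq> (\<lambda>x. \<lambda>i\<in>I. J i +>\<^bsub>M\<^esub> x) ` carrier M \<longleftrightarrow>
    (\<forall>x. (\<forall>i\<in>I. x i \<in> carrier M) \<and> (\<forall>i\<in>I. \<forall>j\<in>I. x i \<ominus>\<^bsub>M\<^esub> x j \<in> J i <+>\<^bsub>M\<^esub> J j) \<longrightarrow>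
      (\<exists>y\<in>carrier M. \<forall>i\<in>I. y \<ominus>\<^bsub>M\<^esub> x i \<in> J i))" (is "?sub \<longleftrightarrow> ?R")
  proof
    assume sub: ?sub
    show ?R
    proof (intro allI impI)
      fix x assume x: "(\<forall>i\<in>I. x i \<in> carrier M) \<and> (\<forall>i\<in>I. \<forall>j\<in>I. x i \<ominus>\<^bsub>M\<^esub> x j \<in> J i <+>\<^bsub>M\<^esub> J j)"
      then have "(\<lambda>i\<in>I. J i +>\<^bsub>M\<^esub> x i) \<in> glued_families M I J"
        by (subst glued) auto
      with sub obtain y where y: "y \<in> carrier M" "(\<lambda>i\<in>I. J i +>\<^bsub>M\<^esub> x i) = (\<lambda>i\<in>I. J i +>\<^bsub>M\<^esub> y)"
        by blast
      have "y \<ominus>\<^bsub>M\<^esub> x i \<in> J i" if "i \<in> I" for i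
        using fun_cong[OF y(2), of i] that x y(1) coset_eq_iff[OF M J[OF that], of y "x i"] by simp
      with y show "\<exists>y\<in>carrier M. \<forall>i\<in>I. y \<ominus>\<^bsub>M\<^esub> x i \<in> J i"
        by blast
    qed
  next
    assume R: ?R
    show ?sub
    proof
      fix m assume m: "m \<in> glued_families M I J"
      then have mE: "m \<in> extensional I" and "\<forall>i\<in>I. \<exists>x. x \<in> carrier M \<and> m i = J i +>\<^bsub>M\<^esub> x"
        by (auto simp: glued_families_def quot_carrier PiE_def Pi_iff)
      then obtain x where x: "\<forall>i\<in>I. x i \<in> carrier M \<and> m i = J i +>\<^bsub>M\<^esub> x i"
        by (rule_tac bchoice[THEN exE]) auto
      then have m_eq: "m = (\<lambda>i\<in>I. J i +>\<^bsub>M\<^esub> x i)"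
        using mE by (intro extensionalityI[of _ I]) auto
      then have "\<exists>y\<in>carrier M. \<forall>i\<in>I. y \<ominus>\<^bsub>M\<^esub> x i \<in> J i"
        using R m x glued[of x] by auto
      then obtain y where y: "y \<in> carrier M" "\<forall>i\<in>I. y \<ominus>\<^bsub>M\<^esub> x i \<in> J i"
        by blast
      then have "m = (\<lambda>i\<in>I. J i +>\<^bsub>M\<^esub> y)"
        unfolding m_eq using x coset_eq_iff[OF M J y(1)] by (intro restrict_ext) metis
      with y show "m \<in> (\<lambda>x. \<lambda>i\<in>I. J i +>\<^bsub>M\<^esub> x) ` carrier M"
        by blast
    qed
  qed
  ultimately show ?thesis
    using cover by (auto simp: complete_cover_def)
qed

section \<open>Gluing in tensor products with a flat module\<close>

text \<open>The projection M \<rightarrow> M/N tensored with the identity of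
  \<open>C\<close>.\<close>

abbreviation proj_tensor ::
    "('k, 'r) ring_scheme \<Rightarrow> ('k, 'm, 'x) module_scheme \<Rightarrow> ('k, 'c, 'y) module_scheme \<Rightarrow> 'm set \<Rightarrow>
     ('k, 'm, 'c) tens \<Rightarrow> ('k, 'm set, 'c) tens"
  where "proj_tensor K M C N \<equiv> tensor_map K (quot_module M N) C (\<lambda>x. N +>\<^bsub>M\<^esub> x) (\<lambda>c. c)"

lemma (in abelian_group) finsum_minus:
  assumes "finite A" "u \<in> A \<rightarrow> carrier G" "v \<in> A \<rightarrow> carrier G"
  shows "(\<Oplus>i\<in>A. u i \<ominus> v i) = (\<Oplus>i\<in>A. u i) \<ominus> (\<Oplus>i\<in>A. v i)"
proof -
  have inv: "(\<lambda>i. \<ominus> v i) \<in> A \<rightarrow> carrier G"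
    using assms by auto
  have "(\<Oplus>i\<in>A. \<ominus> v i) \<oplus> (\<Oplus>i\<in>A. v i) = (\<Oplus>i\<in>A. \<ominus> v i \<oplus> v i)"
    using inv assms by (intro finsum_addf[symmetric])
  also have "\<dots> = (\<Oplus>i\<in>A. \<zero>)"
    using assms by (intro finsum_cong' refl) (auto simp: l_neg Pi_iff)
  finally have "(\<Oplus>i\<in>A. \<ominus> v i) = \<ominus> (\<Oplus>i\<in>A. v i)"
    using inv assms by (intro minus_equality[symmetric]) auto
  moreover have "(\<Oplus>i\<in>A. u i \<ominus> v i) = (\<Oplus>i\<in>A. u i) \<oplus> (\<Oplus>i\<in>A. \<ominus> v i)"
    unfolding a_minus_def using inv assms by (intro finsum_addf)
  ultimately show ?thesis
    by (simp add: a_minus_def)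
qed

lemma linear_maps_comb:
  assumes M: "module K M" and N: "module K N" and f: "f \<in> linear_maps K M N" and "finite A"
    and a: "\<And>k. a k \<in> carrier K" and p: "\<And>k. p k \<in> carrier M"
  shows "f (\<Oplus>\<^bsub>M\<^esub>k\<in>A. a k \<odot>\<^bsub>M\<^esub> p k) = (\<Oplus>\<^bsub>N\<^esub>k\<in>A. a k \<odot>\<^bsub>N\<^esub> f (p k))"
proof -
  interpret M: module K M by (rule M)
  interpret N: module K N by (rule N)
  have "f (\<Oplus>\<^bsub>M\<^esub>k\<in>A. a k \<odot>\<^bsub>M\<^esub> p k) = (\<Oplus>\<^bsub>N\<^esub>k\<in>A. f (a k \<odot>\<^bsub>M\<^esub> p k))"
    using a p by (intro linear_maps_finsum[OF M N f assms(4)]) auto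
  also have "\<dots> = (\<Oplus>\<^bsub>N\<^esub>k\<in>A. a k \<odot>\<^bsub>N\<^esub> f (p k))"
    using a p by (intro N.finsum_cong' refl) (auto simp: linear_maps_smult[OF f] linear_maps_closed[OF f])
  finally show ?thesis .
qed

context
  fixes K :: "('k, 'r) ring_scheme" and M :: "('k, 'm, 'x) module_scheme"
    and C :: "('k, 'c, 'y) module_scheme"
  assumes M: "module K M" and C: "module K C"
begin

lemma proj_tensor_linear:
  assumes "submodule N K M"
  shows "proj_tensor K M C N \<in> linear_maps K (tensor K M C) (tensor K (quot_module M N) C)"
  by (rule tensor_map_linear[OF M C quot_module_module[OF M assms] C coset_linear[OF M assms] linear_maps_id])

lemma proj_tensor_pure:
  assumes "submodule N K M" "m \<in> carrier M" "c \<in> carrier C"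
  shows "proj_tensor K M C N (pure_tensor K M C m c) = pure_tensor K (quot_module M N) C (N +>\<^bsub>M\<^esub> m) c"
  by (rule tensor_map_pure[OF M C quot_module_module[OF M assms(1)] C coset_linear[OF M assms(1)]
    linear_maps_id assms(2,3)])

text \<open>Right exactness with the identity as second map: the generators with second factor zero
  vanish, and those with first factor in \<open>N\<close> remain.\<close>

lemma proj_tensor_kernel:
  assumes N: "submodule N K M" and x: "x \<in> carrier (tensor K M C)"
    and zero: "proj_tensor K M C N x = \<zero>\<^bsub>tensor K (quot_module M N) C\<^esub>"
  shows "x \<in> submodule_span K (tensor K M C) {pure_tensor K M C m c | m c. m \<in> N \<and> c \<in> carrier C}"
    (is "x \<in> submodule_span K _ ?S")
proof -
  interpret M: module K M by (rule M)
  have span: "submodule (submodule_span K (tensor K M C) ?S) K (tensor K M C)"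
    using submodule_subset[OF N]
    by (intro span_submodule[OF tensor_module[OF M C]]) (auto intro: pure_tensor_closed[OF M C])
  have "x \<in> submodule_span K (tensor K M C) {pure_tensor K M C m c | m c. m \<in> carrier M \<and>
      c \<in> carrier C \<and> (N +>\<^bsub>M\<^esub> m = \<zero>\<^bsub>quot_module M N\<^esub> \<or> c = \<zero>\<^bsub>C\<^esub>)}"
    using x zero
    by (intro tensor_map_kernel[OF M C quot_module_module[OF M N] C coset_linear[OF M N] linear_maps_id])
      (auto simp: quot_carrier)
  also have "\<dots> \<subseteq> submodule_span K (tensor K M C) ?S"
  proof (rule span_least[OF span], safe)
    fix m c assume "m \<in> carrier M" "c \<in> carrier C" "N +>\<^bsub>M\<^esub> m = \<zero>\<^bsub>quot_module M N\<^esub>"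
    then show "pure_tensor K M C m c \<in> submodule_span K (tensor K M C) ?S"
      by (intro subsetD[OF span_incl]) (auto simp: coset_eq_zero_iff[OF M N])
  next
    fix m assume m: "m \<in> carrier M"
    have "pure_tensor K M C m \<zero>\<^bsub>C\<^esub> = \<zero>\<^bsub>tensor K M C\<^esub>"
      by (rule linear_maps_zero[OF C tensor_module[OF M C] pure_tensor_linear(2)[OF M C m]])
    then show "pure_tensor K M C m \<zero>\<^bsub>C\<^esub> \<in> submodule_span K (tensor K M C) ?S"
      using submodule_zero[OF span] by simp
  qed
  finally show ?thesis .
qed

lemma proj_tensor_sum:
  assumes N: "submodule N K M" and "finite A" and p: "\<And>k. p k \<in> carrier M" and c: "\<And>k. c k \<in> carrier C"
  shows "proj_tensor K M C N (\<Oplus>\<^bsub>tensor K M C\<^esub>k\<in>A. pure_tensor K M C (p k) (c k)) =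
    (\<Oplus>\<^bsub>tensor K (quot_module M N) C\<^esub>k\<in>A. pure_tensor K (quot_module M N) C (N +>\<^bsub>M\<^esub> p k) (c k))"
proof -
  note Q = quot_module_module[OF M N]
  interpret T': module K "tensor K (quot_module M N) C" by (rule tensor_module[OF Q C])
  have "proj_tensor K M C N (\<Oplus>\<^bsub>tensor K M C\<^esub>k\<in>A. pure_tensor K M C (p k) (c k)) =
      (\<Oplus>\<^bsub>tensor K (quot_module M N) C\<^esub>k\<in>A. proj_tensor K M C N (pure_tensor K M C (p k) (c k)))"
    using p c by (intro linear_maps_finsum[OF tensor_module[OF M C] T'.module_axioms
      proj_tensor_linear[OF N] assms(2)]) (auto intro: pure_tensor_closed[OF M C])
  also have "\<dots> = (\<Oplus>\<^bsub>tensor K (quot_module M N) C\<^esub>k\<in>A. pure_tensor K (quot_module M N) C (N +>\<^bsub>M\<^esub> p k) (c k))"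
    using p c by (intro T'.finsum_cong' refl)
      (auto simp: proj_tensor_pure[OF N] quot_carrier intro!: pure_tensor_closed[OF Q C])
  finally show ?thesis .
qed

text \<open>Tensoring with a flat module respects finite intersections. A common change of second
  factors turns the hypothesis into membership of every new first factor in all \<open>J i\<close>,
  and there only zero is left.\<close>

lemma flat_inter_eq_zero:
  assumes flat: "flat_module K C" and "finite I" and J: "\<And>i. i \<in> I \<Longrightarrow> submodule (J i) K M"
    and inter: "carrier M \<inter> (\<Inter>i\<in>I. J i) = {\<zero>\<^bsub>M\<^esub>}" and y: "y \<in> carrier (tensor K M C)"
    and zero: "\<And>i. i \<in> I \<Longrightarrow> proj_tensor K M C (J i) y = \<zero>\<^bsub>tensor K (quot_module M (J i)) C\<^esub>"
  shows "y = \<zero>\<^bsub>tensor K M C\<^esub>"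
proof -
  interpret M: module K M by (rule M)
  interpret C: module K C by (rule C)
  interpret T: module K "tensor K M C" by (rule tensor_module[OF M C])
  obtain r :: nat and p c where "(\<forall>k. p k \<in> carrier M) \<and> (\<forall>k. c k \<in> carrier C) \<and>
      y = (\<Oplus>\<^bsub>tensor K M C\<^esub>k\<in>{..<r}. pure_tensor K M C (p k) (c k))"
    using tensor_finite_sum[OF M C y] by (elim exE) (rule that)
  then have p: "\<And>k. p k \<in> carrier M" and c: "\<And>k. c k \<in> carrier C"
    and y_eq: "y = (\<Oplus>\<^bsub>tensor K M C\<^esub>k\<in>{..<r}. pure_tensor K M C (p k) (c k))"
    by auto
  have "\<exists>(L :: nat) a c'. (\<forall>k l. a k l \<in> carrier K) \<and> (\<forall>l. c' l \<in> carrier C) \<and>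
    (\<forall>k<r. c k = (\<Oplus>\<^bsub>C\<^esub>l\<in>{..<L}. a k l \<odot>\<^bsub>C\<^esub> c' l)) \<and>
    (\<forall>i\<in>I. \<forall>l. (\<Oplus>\<^bsub>quot_module M (J i)\<^esub>k\<in>{..<r}. a k l \<odot>\<^bsub>quot_module M (J i)\<^esub> (J i +>\<^bsub>M\<^esub> p k)) =
      \<zero>\<^bsub>quot_module M (J i)\<^esub>)"
    using zero by (intro flat_relations_family[OF flat assms(2)])
      (auto simp: y_eq proj_tensor_sum[OF J _ p c] quot_carrier p c intro: quot_module_module[OF M J])
  then obtain L :: nat and a c' where "(\<forall>k l. a k l \<in> carrier K) \<and> (\<forall>l. c' l \<in> carrier C) \<and>
    (\<forall>k<r. c k = (\<Oplus>\<^bsub>C\<^esub>l\<in>{..<L}. a k l \<odot>\<^bsub>C\<^esub> c' l)) \<and>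
    (\<forall>i\<in>I. \<forall>l. (\<Oplus>\<^bsub>quot_module M (J i)\<^esub>k\<in>{..<r}. a k l \<odot>\<^bsub>quot_module M (J i)\<^esub> (J i +>\<^bsub>M\<^esub> p k)) =
      \<zero>\<^bsub>quot_module M (J i)\<^esub>)"
    by (elim exE) (rule that)
  then have a: "\<And>k l. a k l \<in> carrier K" and c': "\<And>l. c' l \<in> carrier C"
    and ca: "\<And>k. k < r \<Longrightarrow> c k = (\<Oplus>\<^bsub>C\<^esub>l\<in>{..<L}. a k l \<odot>\<^bsub>C\<^esub> c' l)"
    and rel: "\<And>i l. i \<in> I \<Longrightarrow>
      (\<Oplus>\<^bsub>quot_module M (J i)\<^esub>k\<in>{..<r}. a k l \<odot>\<^bsub>quot_module M (J i)\<^esub> (J i +>\<^bsub>M\<^esub> p k)) = \<zero>\<^bsub>quot_module M (J i)\<^esub>"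
    by auto
  define q where "q l = (\<Oplus>\<^bsub>M\<^esub>k\<in>{..<r}. a k l \<odot>\<^bsub>M\<^esub> p k)" for l
  have q: "q l \<in> carrier M" for l
    unfolding q_def using a p by (auto intro!: M.finsum_closed)
  have "q l \<in> J i" if i: "i \<in> I" for i l
  proof -
    have "J i +>\<^bsub>M\<^esub> q l = \<zero>\<^bsub>quot_module M (J i)\<^esub>"
      unfolding q_def rel[OF i, symmetric, of l]
      by (rule linear_maps_comb[OF M quot_module_module[OF M J[OF i]] coset_linear[OF M J[OF i]]])
        (auto simp: a p)
    then show ?thesis
      by (simp add: coset_eq_zero_iff[OF M J[OF i] q])
  qed
  then have q0: "q l = \<zero>\<^bsub>M\<^esub>" for l
    using inter q[of l] by blast
  have "y = (\<Oplus>\<^bsub>tensor K M C\<^esub>l\<in>{..<L}. pure_tensor K M C (q l) (c' l))"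
    unfolding y_eq q_def by (rule tensor_sum_change[OF M C p a c' ca])
  also have "\<dots> = (\<Oplus>\<^bsub>tensor K M C\<^esub>l\<in>{..<L}. \<zero>\<^bsub>tensor K M C\<^esub>)"
    using linear_maps_zero[OF M T.module_axioms pure_tensor_linear(1)[OF M C c']]
    by (intro T.finsum_cong' refl) (auto simp: q0)
  finally show ?thesis
    by simp
qed

text \<open>With common second factors the compatibility of the \<open>y i\<close> becomes, after a
  change of these factors, compatibility of the first factors for each index \<open>l\<close>.
  Completeness in \<open>M\<close> glues those, and tensoring the results with the new second
  factors gives \<open>z\<close>.\<close>

lemma flat_glue:
  assumes flat: "flat_module K C" and J: "complete_cover K M I J"
    and y: "\<And>i. i \<in> I \<Longrightarrow> y i \<in> carrier (tensor K M C)"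
    and compat: "\<And>i j. i \<in> I \<Longrightarrow> j \<in> I \<Longrightarrow> proj_tensor K M C (J i <+>\<^bsub>M\<^esub> J j) (y i \<ominus>\<^bsub>tensor K M C\<^esub> y j) =
      \<zero>\<^bsub>tensor K (quot_module M (J i <+>\<^bsub>M\<^esub> J j)) C\<^esub>"
  shows "\<exists>z\<in>carrier (tensor K M C). \<forall>i\<in>I.
    proj_tensor K M C (J i) (z \<ominus>\<^bsub>tensor K M C\<^esub> y i) = \<zero>\<^bsub>tensor K (quot_module M (J i)) C\<^esub>"
proof -
  interpret M: module K M by (rule M)
  interpret C: module K C by (rule C)
  let ?T = "tensor K M C"
  interpret T: module K ?T by (rule tensor_module[OF M C])
  have I: "finite I" and Js: "\<And>i. i \<in> I \<Longrightarrow> submodule (J i) K M"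
    using J by (auto simp: complete_cover_def cover_def)
  have JJ: "submodule (J i <+>\<^bsub>M\<^esub> J j) K M" if "i \<in> I" "j \<in> I" for i j
    using Js that by (intro set_add_submodule[OF M])
  note pl = pure_tensor_linear[OF M C]
  note closed = pure_tensor_closed[OF M C]
  have "\<exists>(r :: nat) p c. (\<forall>i k. p i k \<in> carrier M) \<and> (\<forall>k. c k \<in> carrier C) \<and>
    (\<forall>i\<in>I. y i = (\<Oplus>\<^bsub>?T\<^esub>k\<in>{..<r}. pure_tensor K M C (p i k) (c k)))"
    by (rule tensor_common_finite_sum[OF M C I y])
  then obtain r :: nat and p c where "(\<forall>i k. p i k \<in> carrier M) \<and> (\<forall>k. c k \<in> carrier C) \<and>
    (\<forall>i\<in>I. y i = (\<Oplus>\<^bsub>?T\<^esub>k\<in>{..<r}. pure_tensor K M C (p i k) (c k)))"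
    by (elim exE) (rule that)
  then have p: "\<And>i k. p i k \<in> carrier M" and c: "\<And>k. c k \<in> carrier C"
    and y_eq: "\<And>i. i \<in> I \<Longrightarrow> y i = (\<Oplus>\<^bsub>?T\<^esub>k\<in>{..<r}. pure_tensor K M C (p i k) (c k))"
    by auto
  \<comment> \<open>The compatibility conditions are indexed by ordered pairs, so that one call of
    \<open>flat_relations_family\<close> over \<open>I \<times> I\<close> treats all of them with
    the same second factors.\<close>
  define N where "N t = (case t of (i, j) \<Rightarrow> J i <+>\<^bsub>M\<^esub> J j)" for t
  have N: "submodule (N t) K M" if "t \<in> I \<times> I" for t
    using that JJ by (auto simp: N_def)
  define s where "s t k = (case t of (i, j) \<Rightarrow> p i k \<ominus>\<^bsub>M\<^esub> p j k)" for t k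
  have s: "s t k \<in> carrier M" for t k
    using p by (auto simp: s_def split: prod.split)
  have zero: "(\<Oplus>\<^bsub>tensor K (quot_module M (N t)) C\<^esub>k\<in>{..<r}.
      pure_tensor K (quot_module M (N t)) C (N t +>\<^bsub>M\<^esub> s t k) (c k)) =
    \<zero>\<^bsub>tensor K (quot_module M (N t)) C\<^esub>" if t: "t \<in> I \<times> I" for t
  proof -
    obtain i j where ij: "t = (i, j)" "i \<in> I" "j \<in> I"
      using t by blast
    have "y i \<ominus>\<^bsub>?T\<^esub> y j =
        (\<Oplus>\<^bsub>?T\<^esub>k\<in>{..<r}. pure_tensor K M C (p i k) (c k) \<ominus>\<^bsub>?T\<^esub> pure_tensor K M C (p j k) (c k))"
      using ij p c by (simp add: y_eq T.finsum_minus Pi_iff closed)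
    also have "\<dots> = (\<Oplus>\<^bsub>?T\<^esub>k\<in>{..<r}. pure_tensor K M C (s t k) (c k))"
      using p c s by (intro T.finsum_cong' refl)
        (auto intro!: closed simp: s_def ij linear_maps_minus[OF M T.module_axioms pl(1)])
    finally show ?thesis
      using compat[OF ij(2,3)] proj_tensor_sum[OF N[OF t] _ s c, of "{..<r}"] ij by (simp add: N_def)
  qed
  have "\<exists>(L :: nat) a c'. (\<forall>k l. a k l \<in> carrier K) \<and> (\<forall>l. c' l \<in> carrier C) \<and>
    (\<forall>k<r. c k = (\<Oplus>\<^bsub>C\<^esub>l\<in>{..<L}. a k l \<odot>\<^bsub>C\<^esub> c' l)) \<and>
    (\<forall>t\<in>I \<times> I. \<forall>l. (\<Oplus>\<^bsub>quot_module M (N t)\<^esub>k\<in>{..<r}. a k l \<odot>\<^bsub>quot_module M (N t)\<^esub> (N t +>\<^bsub>M\<^esub> s t k)) =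
      \<zero>\<^bsub>quot_module M (N t)\<^esub>)"
    using I by (intro flat_relations_family[OF flat])
      (auto simp only: finite_cartesian_product quot_carrier s c zero intro: quot_module_module[OF M N])
  then obtain L :: nat and a c' where "(\<forall>k l. a k l \<in> carrier K) \<and> (\<forall>l. c' l \<in> carrier C) \<and>
    (\<forall>k<r. c k = (\<Oplus>\<^bsub>C\<^esub>l\<in>{..<L}. a k l \<odot>\<^bsub>C\<^esub> c' l)) \<and>
    (\<forall>t\<in>I \<times> I. \<forall>l. (\<Oplus>\<^bsub>quot_module M (N t)\<^esub>k\<in>{..<r}. a k l \<odot>\<^bsub>quot_module M (N t)\<^esub> (N t +>\<^bsub>M\<^esub> s t k)) =
      \<zero>\<^bsub>quot_module M (N t)\<^esub>)"
    by (elim exE) (rule that)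
  then have a: "\<And>k l. a k l \<in> carrier K" and c': "\<And>l. c' l \<in> carrier C"
    and ca: "\<And>k. k < r \<Longrightarrow> c k = (\<Oplus>\<^bsub>C\<^esub>l\<in>{..<L}. a k l \<odot>\<^bsub>C\<^esub> c' l)"
    and rel: "\<And>t l. t \<in> I \<times> I \<Longrightarrow>
      (\<Oplus>\<^bsub>quot_module M (N t)\<^esub>k\<in>{..<r}. a k l \<odot>\<^bsub>quot_module M (N t)\<^esub> (N t +>\<^bsub>M\<^esub> s t k)) = \<zero>\<^bsub>quot_module M (N t)\<^esub>"
    by auto
  define q where "q i l = (\<Oplus>\<^bsub>M\<^esub>k\<in>{..<r}. a k l \<odot>\<^bsub>M\<^esub> p i k)" for i l
  have q: "q i l \<in> carrier M" for i l
    unfolding q_def using a p by (auto intro!: M.finsum_closed)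
  have "q i l \<ominus>\<^bsub>M\<^esub> q j l \<in> J i <+>\<^bsub>M\<^esub> J j" if ij: "i \<in> I" "j \<in> I" for i j l
  proof -
    have t: "(i, j) \<in> I \<times> I"
      using ij by simp
    have "q i l \<ominus>\<^bsub>M\<^esub> q j l = (\<Oplus>\<^bsub>M\<^esub>k\<in>{..<r}. a k l \<odot>\<^bsub>M\<^esub> p i k \<ominus>\<^bsub>M\<^esub> a k l \<odot>\<^bsub>M\<^esub> p j k)"
      unfolding q_def using a p by (intro M.finsum_minus[symmetric]) auto
    also have "\<dots> = (\<Oplus>\<^bsub>M\<^esub>k\<in>{..<r}. a k l \<odot>\<^bsub>M\<^esub> s (i, j) k)"
      using a p by (intro M.finsum_cong' refl)
        (auto simp: s_def a_minus_def M.smult_r_distr M.smult_r_minus)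
    finally have eq: "q i l \<ominus>\<^bsub>M\<^esub> q j l = (\<Oplus>\<^bsub>M\<^esub>k\<in>{..<r}. a k l \<odot>\<^bsub>M\<^esub> s (i, j) k)" .
    have "N (i, j) +>\<^bsub>M\<^esub> (q i l \<ominus>\<^bsub>M\<^esub> q j l) = \<zero>\<^bsub>quot_module M (N (i, j))\<^esub>"
      unfolding eq rel[OF t, symmetric, of l]
      by (rule linear_maps_comb[OF M quot_module_module[OF M N[OF t]] coset_linear[OF M N[OF t]]])
        (auto simp: a s)
    then have "q i l \<ominus>\<^bsub>M\<^esub> q j l \<in> N (i, j)"
      using q by (simp add: coset_eq_zero_iff[OF M N[OF t]])
    then show ?thesis
      by (simp add: N_def)
  qed
  \<comment> \<open>For fixed \<open>l\<close> the family of the \<open>q i l\<close> is compatible,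
    so completeness of the cover applies to one coefficient index at a time.\<close>
  then have "\<exists>z\<in>carrier M. \<forall>i\<in>I. z \<ominus>\<^bsub>M\<^esub> q i l \<in> J i" for l
    using J[unfolded complete_cover_iff[OF M], THEN conjunct2, rule_format, of "\<lambda>i. q i l"] q by blast
  then obtain z where z: "\<And>l. z l \<in> carrier M" "\<And>l i. i \<in> I \<Longrightarrow> z l \<ominus>\<^bsub>M\<^esub> q i l \<in> J i"
    by metis
  let ?z = "\<Oplus>\<^bsub>?T\<^esub>l\<in>{..<L}. pure_tensor K M C (z l) (c' l)"
  have z_closed: "?z \<in> carrier ?T"
    using z c' by (auto intro!: T.finsum_closed closed)
  moreover have "proj_tensor K M C (J i) (?z \<ominus>\<^bsub>?T\<^esub> y i) = \<zero>\<^bsub>tensor K (quot_module M (J i)) C\<^esub>"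
    if i: "i \<in> I" for i
  proof -
    note Q = quot_module_module[OF M Js[OF i]]
    interpret TQ: module K "tensor K (quot_module M (J i)) C" by (rule tensor_module[OF Q C])
    note lin = proj_tensor_linear[OF Js[OF i]]
    have "y i = (\<Oplus>\<^bsub>?T\<^esub>l\<in>{..<L}. pure_tensor K M C (q i l) (c' l))"
      unfolding y_eq[OF i] q_def by (rule tensor_sum_change[OF M C p a c' ca])
    moreover have "J i +>\<^bsub>M\<^esub> z l = J i +>\<^bsub>M\<^esub> q i l" for l
      using z i q by (simp add: coset_eq_iff[OF M Js])
    ultimately have "proj_tensor K M C (J i) ?z = proj_tensor K M C (J i) (y i)"
      by (simp add: proj_tensor_sum[OF Js[OF i] _ _ c'] z q)
    then show ?thesis
      using z_closed y[OF i] linear_maps_closed[OF lin]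
      by (simp add: linear_maps_minus[OF T.module_axioms TQ.module_axioms lin] TQ.minus_eq_zero_iff)
  qed
  ultimately show ?thesis
    by blast
qed

end

section \<open>The canonical map\<close>

text \<open>Collects the structure behind the canonical map, an algebra with a linear coaction, in a
  form that passes to \<open>P/J\<close> by direct verification, so that \<open>P\<close> and its
  quotients are instances of the same locale.\<close>

locale comodule_algebra = C: module K C + P: module K P + A: ring P
  for K :: "('k, 'r) ring_scheme" and C :: "('k, 'c, 'x) coalg_scheme"
    and P :: "('k, 'p, 'c, 'y) comod_scheme" +
  assumes smult_mult: "k \<in> carrier K \<Longrightarrow> x \<in> carrier P \<Longrightarrow> y \<in> carrier P \<Longrightarrow>
      (k \<odot>\<^bsub>P\<^esub> x) \<otimes>\<^bsub>P\<^esub> y = k \<odot>\<^bsub>P\<^esub> (x \<otimes>\<^bsub>P\<^esub> y)"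
    and mult_smult: "k \<in> carrier K \<Longrightarrow> x \<in> carrier P \<Longrightarrow> y \<in> carrier P \<Longrightarrow>
      x \<otimes>\<^bsub>P\<^esub> (k \<odot>\<^bsub>P\<^esub> y) = k \<odot>\<^bsub>P\<^esub> (x \<otimes>\<^bsub>P\<^esub> y)"
    and coact_linear: "coact P \<in> linear_maps K P (tensor K P C)"
begin

lemmas C_module = C.module_axioms
lemmas P_module = P.module_axioms

sublocale PC: module K "tensor K P C"
  by (rule tensor_module[OF P_module C_module])

lemmas pure_linear = pure_tensor_linear[OF P_module C_module]
lemmas pure_closed = pure_tensor_closed[OF P_module C_module]

section \<open>The left module structure of P \<otimes> C\<close>

lemma left_mult_linear: "b \<in> carrier P \<Longrightarrow> (\<lambda>p. b \<otimes>\<^bsub>P\<^esub> p) \<in> linear_maps K P P"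
  by (intro linear_mapsI) (auto simp: A.r_distr mult_smult)

lemma left_act_linear: "b \<in> carrier P \<Longrightarrow> left_act K C P b \<in> linear_maps K (tensor K P C) (tensor K P C)"
  unfolding left_act_def
  by (intro tensor_map_linear P_module C_module left_mult_linear linear_maps_id)

lemma left_act_pure:
  "b \<in> carrier P \<Longrightarrow> p \<in> carrier P \<Longrightarrow> c \<in> carrier C \<Longrightarrow>
    left_act K C P b (pure_tensor K P C p c) = pure_tensor K P C (b \<otimes>\<^bsub>P\<^esub> p) c"
  unfolding left_act_def
  by (intro tensor_map_pure P_module C_module left_mult_linear linear_maps_id)

lemmas left_act_closed = linear_maps_closed[OF left_act_linear]
lemmas coact_closed = linear_maps_closed[OF coact_linear]
lemmas PC_induct = pure_tensor_induct[OF P_module C_module, consumes 1, case_names pure add]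

lemma left_act_add:
  assumes "p \<in> carrier P" "q \<in> carrier P" "y \<in> carrier (tensor K P C)"
  shows "left_act K C P (p \<oplus>\<^bsub>P\<^esub> q) y = left_act K C P p y \<oplus>\<^bsub>tensor K P C\<^esub> left_act K C P q y"
  using assms(3)
proof (induction rule: PC_induct)
  case (pure m c)
  then show ?case
    using assms by (simp add: left_act_pure A.l_distr linear_maps_add[OF pure_linear(1)])
next
  case (add x y)
  then show ?case
    using assms by (simp add: linear_maps_add[OF left_act_linear] left_act_closed PC.a_ac)
qed

lemma left_act_smult:
  assumes "p \<in> carrier P" "k \<in> carrier K" "y \<in> carrier (tensor K P C)"
  shows "left_act K C P (k \<odot>\<^bsub>P\<^esub> p) y = k \<odot>\<^bsub>tensor K P C\<^esub> left_act K C P p y"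
  using assms(3)
proof (induction rule: PC_induct)
  case (pure m c)
  then show ?case
    using assms by (simp add: left_act_pure smult_mult linear_maps_smult[OF pure_linear(1)])
next
  case (add x y)
  then show ?case
    using assms by (simp add: linear_maps_add[OF left_act_linear] left_act_closed PC.smult_r_distr)
qed

lemma left_act_mult:
  assumes "p \<in> carrier P" "q \<in> carrier P" "y \<in> carrier (tensor K P C)"
  shows "left_act K C P (p \<otimes>\<^bsub>P\<^esub> q) y = left_act K C P p (left_act K C P q y)"
  using assms(3)
proof (induction rule: PC_induct)
  case (pure m c)
  then show ?case
    using assms by (simp add: left_act_pure A.m_assoc)
next
  case (add x y)
  then show ?case
    using assms by (simp add: linear_maps_add[OF left_act_linear] left_act_closed)
qed

section \<open>Coinvariants and the canonical map\<close>

lemma coinvariants_closed: "b \<in> coinvariants K C P \<Longrightarrow> b \<in> carrier P"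
  by (simp add: coinvariants_def)

sublocale PP: balanced_pair K "coinvariants K C P" "\<lambda>x b. x \<otimes>\<^bsub>P\<^esub> b" "\<lambda>b y. b \<otimes>\<^bsub>P\<^esub> y" P P
  by unfold_locales (auto simp: coinvariants_closed)

lemma self_tensor_eq: "self_tensor K (coinvariants K C P) (\<lambda>b. b) P = PP.T"
  by (simp add: self_tensor_def)

text \<open>Balancedness over the coinvariants is their definition: p \<rho>(b p') = p (b
  \<rho>(p')) = (p b) \<rho>(p').\<close>

lemma canonical_bilinear:
  "balanced_bilinear K (coinvariants K C P) (\<lambda>x b. x \<otimes>\<^bsub>P\<^esub> b) (\<lambda>b y. b \<otimes>\<^bsub>P\<^esub> y) P P (tensor K P C)
    (\<lambda>p p'. left_act K C P p (coact P p'))"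
proof (rule balanced_bilinearI)
  show "(\<lambda>p. left_act K C P p (coact P p')) \<in> linear_maps K P (tensor K P C)" if "p' \<in> carrier P" for p'
    using that by (intro linear_mapsI) (auto simp: left_act_add left_act_smult left_act_closed coact_closed)
  show "(\<lambda>p'. left_act K C P p (coact P p')) \<in> linear_maps K P (tensor K P C)" if "p \<in> carrier P" for p
    using that by (intro linear_maps_comp[OF coact_linear left_act_linear])
  show "left_act K C P (p \<otimes>\<^bsub>P\<^esub> b) (coact P p') = left_act K C P p (coact P (b \<otimes>\<^bsub>P\<^esub> p'))"
    if "p \<in> carrier P" "b \<in> coinvariants K C P" "p' \<in> carrier P" for p b p'
    using that by (simp add: coinvariants_def left_act_mult coact_closed)
qed

lemma canonical_linear: "canonical_map K C P \<in> linear_maps K PP.T (tensor K P C)"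
  unfolding canonical_map_def by (rule PP.lift_linear[OF PC.module_axioms canonical_bilinear])

lemma canonical_pure:
  "p \<in> carrier P \<Longrightarrow> p' \<in> carrier P \<Longrightarrow> canonical_map K C P (PP.pure p p') = left_act K C P p (coact P p')"
  unfolding canonical_map_def by (rule PP.lift_pure[OF PC.module_axioms canonical_bilinear])

lemmas canonical_closed = linear_maps_closed[OF canonical_linear]

text \<open>The canonical map is left P-linear, as q can(p \<otimes> p') = can(qp \<otimes> p').
  Phrasing this through the image avoids constructing the left action on the balanced tensor
  product.\<close>

lemma canonical_range_left_act:
  assumes "q \<in> carrier P" "x \<in> carrier PP.T"
  shows "left_act K C P q (canonical_map K C P x) \<in> canonical_map K C P ` carrier PP.T"
  using assms(2)
proof (induction rule: PP.tensor_induct)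
  case (pure p p')
  then have "left_act K C P q (canonical_map K C P (PP.pure p p')) = canonical_map K C P (PP.pure (q \<otimes>\<^bsub>P\<^esub> p) p')"
    using assms(1) by (simp add: canonical_pure left_act_mult coact_closed)
  then show ?case
    using pure assms(1) by (auto intro: PP.pure_closed)
next
  case (add x y)
  then obtain x' y' where xy: "x' \<in> carrier PP.T" "left_act K C P q (canonical_map K C P x) = canonical_map K C P x'"
    "y' \<in> carrier PP.T" "left_act K C P q (canonical_map K C P y) = canonical_map K C P y'"
    by blast
  then have "left_act K C P q (canonical_map K C P (x \<oplus>\<^bsub>PP.T\<^esub> y)) = canonical_map K C P (x' \<oplus>\<^bsub>PP.T\<^esub> y')"
    using add(1,2) assms(1)
    by (simp add: linear_maps_add[OF canonical_linear] linear_maps_add[OF left_act_linear] canonical_closed)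
  then show ?case
    using xy by blast
qed

lemma canonical_range_submodule:
  "submodule (canonical_map K C P ` carrier PP.T) K (tensor K P C)"
  by (rule linear_image_submodule[OF PP.module_T PC.module_axioms canonical_linear])

end

lemma comodule_algebraI:
  assumes "unital_algebra K P" "module K C" "coact P \<in> linear_maps K P (tensor K P C)"
  shows "comodule_algebra K C P"
proof -
  interpret P: module K P
    using assms(1) by (simp add: unital_algebra_def)
  interpret A: ring P
    using assms(1) by (simp add: unital_algebra_def)
  interpret C: module K C
    by (rule assms(2))
  show ?thesis
    using assms(1,3) by unfold_locales (simp_all add: unital_algebra_def)
qed

subsection \<open>Quotients by ideals\<close>

context comodule_algebra
begin

abbreviation "tker \<equiv> proj_tensor_ker K P (coinvariants K C P)"

context
  fixes J :: "'p set"
  assumes ideal: "ideal J P" and sub: "submodule J K P"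
begin

lemma quot_mult:
  "x \<in> carrier P \<Longrightarrow> y \<in> carrier P \<Longrightarrow>
    (J +>\<^bsub>P\<^esub> x) \<otimes>\<^bsub>quot_module P J\<^esub> (J +>\<^bsub>P\<^esub> y) = J +>\<^bsub>P\<^esub> (x \<otimes>\<^bsub>P\<^esub> y)"
  using ideal.rcoset_mult_add[OF ideal] by (simp add: quot_module_def FactRing_def)

lemma proj_pair:
  "balanced_pair_map K (coinvariants K C P) (\<lambda>x b. x \<otimes>\<^bsub>P\<^esub> b) (\<lambda>b y. b \<otimes>\<^bsub>P\<^esub> y) P P
    (\<lambda>x b. x \<otimes>\<^bsub>quot_module P J\<^esub> (J +>\<^bsub>P\<^esub> b)) (\<lambda>b y. (J +>\<^bsub>P\<^esub> b) \<otimes>\<^bsub>quot_module P J\<^esub> y)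
    (quot_module P J) (quot_module P J) (\<lambda>x. J +>\<^bsub>P\<^esub> x) (\<lambda>x. J +>\<^bsub>P\<^esub> x)"
proof -
  interpret Q: module K "quot_module P J"
    by (rule quot_module_module[OF P_module sub])
  show ?thesis
    by unfold_locales
      (auto simp: quot_carrier quot_mult coinvariants_closed coset_linear[OF P_module sub])
qed

interpretation pp: balanced_pair_map K "coinvariants K C P" "\<lambda>x b. x \<otimes>\<^bsub>P\<^esub> b" "\<lambda>b y. b \<otimes>\<^bsub>P\<^esub> y" P P
  "\<lambda>x b. x \<otimes>\<^bsub>quot_module P J\<^esub> (J +>\<^bsub>P\<^esub> b)" "\<lambda>b y. (J +>\<^bsub>P\<^esub> b) \<otimes>\<^bsub>quot_module P J\<^esub> y"
  "quot_module P J" "quot_module P J" "\<lambda>x. J +>\<^bsub>P\<^esub> x" "\<lambda>x. J +>\<^bsub>P\<^esub> x"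
  by (rule proj_pair)

lemma ker_eq: "tker J = {x \<in> carrier PP.T. pp.tmap x = \<zero>\<^bsub>pp.P'.T\<^esub>}"
  by (simp add: proj_tensor_ker_def Let_def a_kernel_eq self_tensor_def self_pure_def pp.tmap_def)

lemma ker_submodule: "submodule (tker J) K PP.T"
  unfolding ker_eq by (rule linear_kernel_submodule[OF PP.module_T pp.P'.module_T pp.tmap_linear])

lemma pure_in_ker:
  assumes "p \<in> carrier P" "q \<in> carrier P" "p \<in> J \<or> q \<in> J"
  shows "PP.pure p q \<in> tker J"
proof -
  note pb = balanced_bilinearD[OF pp.P'.pure_bilinear]
  note Q = quot_module_module[OF P_module sub]
  have "pp.tmap (PP.pure p q) = pp.P'.pure (J +>\<^bsub>P\<^esub> p) (J +>\<^bsub>P\<^esub> q)"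
    using assms by (intro pp.tmap_pure)
  also have "\<dots> = \<zero>\<^bsub>pp.P'.T\<^esub>"
  proof (cases "p \<in> J")
    case True
    then have "J +>\<^bsub>P\<^esub> p = \<zero>\<^bsub>quot_module P J\<^esub>"
      using assms by (simp add: coset_eq_zero_iff[OF P_module sub])
    then show ?thesis
      using linear_maps_zero[OF Q pp.P'.module_T pb(1)] assms(2) by (simp add: quot_carrier)
  next
    case False
    then have "J +>\<^bsub>P\<^esub> q = \<zero>\<^bsub>quot_module P J\<^esub>"
      using assms by (simp add: coset_eq_zero_iff[OF P_module sub])
    then show ?thesis
      using linear_maps_zero[OF Q pp.P'.module_T pb(2)] assms(1) by (simp add: quot_carrier)
  qed
  finally show ?thesis
    using assms by (simp add: ker_eq PP.pure_closed)
qed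

text \<open>Right exactness in the form of a universal property: with \<open>pure_in_ker\<close> it
  characterizes the kernel as the submodule generated by pure tensors having a factor in
  \<open>J\<close>.\<close>

lemma ker_least:
  assumes "submodule Z K PP.T"
    and "\<And>p q. p \<in> carrier P \<Longrightarrow> q \<in> carrier P \<Longrightarrow> p \<in> J \<or> q \<in> J \<Longrightarrow> PP.pure p q \<in> Z"
  shows "tker J \<subseteq> Z"
proof
  fix x assume "x \<in> tker J"
  then have x: "x \<in> carrier PP.T" "pp.tmap x = \<zero>\<^bsub>pp.P'.T\<^esub>"
    by (auto simp: ker_eq)
  note pp.tmap_kernel[OF quot_carrier[symmetric] quot_carrier[symmetric] x]
  also have "submodule_span K PP.T {PP.pure m n | m n. m \<in> carrier P \<and> n \<in> carrier P \<and>
      (J +>\<^bsub>P\<^esub> m = \<zero>\<^bsub>quot_module P J\<^esub> \<or> J +>\<^bsub>P\<^esub> n = \<zero>\<^bsub>quot_module P J\<^esub>)} \<subseteq> Z"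
    by (rule span_least[OF assms(1)]) (auto simp: coset_eq_zero_iff[OF P_module sub] intro: assms(2))
  finally show "x \<in> Z" .
qed

end

text \<open>By right exactness, \<open>ker (\<pi>\<^sub>J \<otimes>\<^sub>B \<pi>\<^sub>J)\<close> is spanned by the \<open>p \<otimes> q\<close> with \<open>p \<in> J\<close> or \<open>q \<in> J\<close>,
  and this span is additive in \<open>J\<close>.\<close>

lemma ker_sum:
  assumes J: "ideal J P" "submodule J K P" and J': "ideal J' P" "submodule J' K P"
  shows "tker (J <+>\<^bsub>P\<^esub> J') = tker J <+>\<^bsub>PP.T\<^esub> tker J'"
proof
  have JJ: "ideal (J <+>\<^bsub>P\<^esub> J') P" "submodule (J <+>\<^bsub>P\<^esub> J') K P"
    using A.add_ideals[OF J(1) J'(1)] set_add_submodule[OF P_module J(2) J'(2)] by auto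
  note ker = ker_submodule[OF J] ker_submodule[OF J']
  note sum = set_add_submodule[OF PP.module_T ker]
  note incl = set_add_incl[OF P_module J(2) J'(2)]
  show "tker (J <+>\<^bsub>P\<^esub> J') \<subseteq> tker J <+>\<^bsub>PP.T\<^esub> tker J'"
  proof (rule ker_least[OF JJ sum])
    note pb = balanced_bilinearD[OF PP.pure_bilinear]
    fix p q assume pq: "p \<in> carrier P" "q \<in> carrier P" "p \<in> J <+>\<^bsub>P\<^esub> J' \<or> q \<in> J <+>\<^bsub>P\<^esub> J'"
    from pq(3) show "PP.pure p q \<in> tker J <+>\<^bsub>PP.T\<^esub> tker J'"
    proof
      assume "p \<in> J <+>\<^bsub>P\<^esub> J'"
      then obtain a b where ab: "a \<in> J" "b \<in> J'" "p = a \<oplus>\<^bsub>P\<^esub> b"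
        by (auto simp: set_add_iff)
      then have c: "a \<in> carrier P" "b \<in> carrier P"
        using submodule_subset[OF J(2)] submodule_subset[OF J'(2)] by auto
      have "PP.pure p q = PP.pure a q \<oplus>\<^bsub>PP.T\<^esub> PP.pure b q"
        unfolding ab(3) using c pq by (intro linear_maps_add[OF pb(1)])
      moreover have "PP.pure a q \<in> tker J" "PP.pure b q \<in> tker J'"
        using ab c pq by (auto intro!: pure_in_ker J J')
      ultimately show ?thesis
        by (auto simp: set_add_iff)
    next
      assume "q \<in> J <+>\<^bsub>P\<^esub> J'"
      then obtain a b where ab: "a \<in> J" "b \<in> J'" "q = a \<oplus>\<^bsub>P\<^esub> b"
        by (auto simp: set_add_iff)
      then have c: "a \<in> carrier P" "b \<in> carrier P"
        using submodule_subset[OF J(2)] submodule_subset[OF J'(2)] by auto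
      have "PP.pure p q = PP.pure p a \<oplus>\<^bsub>PP.T\<^esub> PP.pure p b"
        unfolding ab(3) using c pq by (intro linear_maps_add[OF pb(2)])
      moreover have "PP.pure p a \<in> tker J" "PP.pure p b \<in> tker J'"
        using ab c pq by (auto intro!: pure_in_ker J J')
      ultimately show ?thesis
        by (auto simp: set_add_iff)
    qed
  qed
  have "tker J \<subseteq> tker (J <+>\<^bsub>P\<^esub> J')"
    by (rule ker_least[OF J ker_submodule[OF JJ]]) (use incl in \<open>auto intro!: pure_in_ker JJ\<close>)
  moreover have "tker J' \<subseteq> tker (J <+>\<^bsub>P\<^esub> J')"
    by (rule ker_least[OF J' ker_submodule[OF JJ]]) (use incl in \<open>auto intro!: pure_in_ker JJ\<close>)
  ultimately show "tker J <+>\<^bsub>PP.T\<^esub> tker J' \<subseteq> tker (J <+>\<^bsub>P\<^esub> J')"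
    using submodule_add[OF ker_submodule[OF JJ]] by (auto simp: set_add_iff subset_iff)
qed

end

section \<open>Quotient comodules compared with quotient modules\<close>

lemma quot_comod_simps:
  "carrier (quot_comod K C P J) = carrier (quot_module P J)"
  "mult (quot_comod K C P J) = mult (quot_module P J)"
  "one (quot_comod K C P J) = one (quot_module P J)"
  "zero (quot_comod K C P J) = zero (quot_module P J)"
  "add (quot_comod K C P J) = add (quot_module P J)"
  "smult (quot_comod K C P J) = smult (quot_module P J)"
  "coact (quot_comod K C P J) = (\<lambda>X. the_elem ((\<lambda>p. proj_tensor K P C J (coact P p)) ` X))"
  by (simp_all add: quot_comod_def module.defs comod.defs)

text \<open>The two records have different types but share all fields that enter the construction of
  a tensor product, so the resulting modules are equal and not merely isomorphic.\<close>

lemma tensor_quot_comod: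
  "tensor K (quot_comod K C P J) D = tensor K (quot_module P J) D"
  "pure_tensor K (quot_comod K C P J) D = pure_tensor K (quot_module P J) D"
  by (simp_all add: tensor_def pure_tensor_def balanced_tensor_def balanced_pure_def tensor_kernel_def
      tensor_relations_def Let_def quot_comod_simps fun_eq_iff)

text \<open>Balancing over the image of \<open>B\<close> is balancing over \<open>B\<close> acting
  through \<open>h\<close>; only the last family of relators mentions scalars from \<open>B\<close>.
  This identifies the domain of the canonical map of a quotient with a tensor product over the
  original coinvariants.\<close>

lemma tensor_relations_image:
  "tensor_relations K (h ` B) ra la M N = tensor_relations K B (\<lambda>m b. ra m (h b)) (\<lambda>b n. la (h b) n) M N"
  unfolding tensor_relations_def Let_def by (rule arg_cong2[where f = "(\<union>)"], rule refl, blast)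

lemma self_tensor_quot_comod:
  "balanced_tensor K (h ` B) (\<lambda>x b. x \<otimes>\<^bsub>quot_comod K C P J\<^esub> b) (\<lambda>b y. b \<otimes>\<^bsub>quot_comod K C P J\<^esub> y)
      (quot_comod K C P J) (quot_comod K C P J) =
    balanced_tensor K B (\<lambda>x b. x \<otimes>\<^bsub>quot_module P J\<^esub> h b) (\<lambda>b y. h b \<otimes>\<^bsub>quot_module P J\<^esub> y)
      (quot_module P J) (quot_module P J)"
  "balanced_pure K (h ` B) (\<lambda>x b. x \<otimes>\<^bsub>quot_comod K C P J\<^esub> b) (\<lambda>b y. b \<otimes>\<^bsub>quot_comod K C P J\<^esub> y)
      (quot_comod K C P J) (quot_comod K C P J) =
    balanced_pure K B (\<lambda>x b. x \<otimes>\<^bsub>quot_module P J\<^esub> h b) (\<lambda>b y. h b \<otimes>\<^bsub>quot_module P J\<^esub> y)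
      (quot_module P J) (quot_module P J)"
  unfolding balanced_tensor_def balanced_pure_def tensor_kernel_def tensor_relations_image
  by (simp_all add: tensor_relations_def Let_def quot_comod_simps fun_eq_iff)

section \<open>The canonical maps of P and of P/J\<close>

context comodule_algebra
begin

context
  fixes J :: "'p set"
  assumes ideal: "ideal J P" and subcomod: "subcomodule K C P J"
begin

private lemma sub: "submodule J K P"
  using subcomod by (simp add: subcomodule_def)

private lemmas Qm = quot_module_module[OF P_module sub]
private lemmas proj_linear = proj_tensor_linear[OF P_module C_module sub]
private lemmas proj_pure = proj_tensor_pure[OF P_module C_module sub]

private lemma TQ: "module K (tensor K (quot_module P J) C)"
  by (rule tensor_module[OF Qm C_module])

interpretation Qm: module K "quot_module P J" by (rule Qm)
interpretation TQ: module K "tensor K (quot_module P J) C" by (rule TQ)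

text \<open>Generators of the image of J \<otimes> C have first factor zero after projection. This
  makes the coaction of \<open>P/J\<close> independent of representatives.\<close>

lemma proj_coact_ideal:
  assumes "p \<in> J"
  shows "proj_tensor K P C J (coact P p) = \<zero>\<^bsub>tensor K (quot_module P J) C\<^esub>"
proof -
  have "pure_tensor K (quot_module P J) C (J +>\<^bsub>P\<^esub> x) c = \<zero>\<^bsub>tensor K (quot_module P J) C\<^esub>"
    if "x \<in> J" "c \<in> carrier C" for x c
  proof -
    have "J +>\<^bsub>P\<^esub> x = \<zero>\<^bsub>quot_module P J\<^esub>"
      using that submodule_subset[OF sub] coset_eq_zero_iff[OF P_module sub] by blast
    then show ?thesis
      using linear_maps_zero[OF Qm TQ pure_tensor_linear(1)[OF Qm C_module that(2)]] by simp
  qed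
  then have "submodule_span K (tensor K P C) {pure_tensor K P C x c | x c. x \<in> J \<and> c \<in> carrier C}
    \<subseteq> {y \<in> carrier (tensor K P C). proj_tensor K P C J y = \<zero>\<^bsub>tensor K (quot_module P J) C\<^esub>}"
    using submodule_subset[OF sub]
    by (intro span_least linear_kernel_submodule[OF PC.module_axioms TQ proj_linear])
      (auto simp: proj_pure subset_iff intro!: pure_closed)
  then show ?thesis
    using subcomod assms by (auto simp: subcomodule_def)
qed

lemma coact_quot:
  assumes p: "p \<in> carrier P"
  shows "coact (quot_comod K C P J) (J +>\<^bsub>P\<^esub> p) = proj_tensor K P C J (coact P p)"
proof -
  have "proj_tensor K P C J (coact P q) = proj_tensor K P C J (coact P p)"
    if q: "q \<in> J +>\<^bsub>P\<^esub> p" for q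
  proof -
    have q': "q \<in> carrier P" "q \<ominus>\<^bsub>P\<^esub> p \<in> J"
      using q p mem_coset_iff[OF P_module sub p] coset_eq_iff[OF P_module sub] by auto
    then show ?thesis
      using proj_coact_ideal[OF q'(2)] p
      by (simp add: linear_maps_minus[OF P_module PC.module_axioms coact_linear] coact_closed
        linear_maps_minus[OF PC.module_axioms TQ proj_linear] linear_maps_closed[OF proj_linear]
        TQ.minus_eq_zero_iff)
  qed
  moreover have "p \<in> J +>\<^bsub>P\<^esub> p"
    using p mem_coset_iff[OF P_module sub p] by simp
  ultimately have "(\<lambda>q. proj_tensor K P C J (coact P q)) ` (J +>\<^bsub>P\<^esub> p) = {proj_tensor K P C J (coact P p)}"
    by blast
  then show ?thesis
    by (simp add: quot_comod_simps)
qed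

lemma quot_comodule_algebra: "comodule_algebra K C (quot_comod K C P J)"
proof -
  let ?Q = "quot_comod K C P J"
  have Q: "module K ?Q"
    by (rule moduleI[OF C.is_cring abelian_groupI])
      (auto simp: quot_comod_simps Qm.a_ac Qm.smult_l_distr Qm.smult_r_distr Qm.smult_assoc1
        intro: abelian_groupE(6)[OF Qm.abelian_group_axioms])
  interpret Q: module K ?Q by (rule Q)
  have one: "\<one>\<^bsub>quot_module P J\<^esub> = J +>\<^bsub>P\<^esub> \<one>\<^bsub>P\<^esub>"
    by (simp add: quot_module_def FactRing_def)
  note q = quot_comod_simps quot_carrier one quot_mult[OF ideal sub] quot_add[OF P_module sub]
    quot_smult[OF P_module sub]
  have ring: "ring ?Q"
    by (rule ringI[OF Q.abelian_group_axioms monoidI]) (auto simp: q A.m_assoc A.l_distr A.r_distr)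
  have co: "coact ?Q \<in> linear_maps K ?Q (tensor K ?Q C)"
    unfolding tensor_quot_comod
  proof (rule linear_mapsI)
    fix X assume "X \<in> carrier ?Q"
    then obtain x where x: "x \<in> carrier P" "X = J +>\<^bsub>P\<^esub> x"
      by (auto simp: q)
    show "coact ?Q X \<in> carrier (tensor K (quot_module P J) C)"
      using x by (simp add: coact_quot linear_maps_closed[OF proj_linear] coact_closed)
    show "coact ?Q (k \<odot>\<^bsub>?Q\<^esub> X) = k \<odot>\<^bsub>tensor K (quot_module P J) C\<^esub> coact ?Q X" if "k \<in> carrier K" for k
    proof -
      have "k \<odot>\<^bsub>?Q\<^esub> X = J +>\<^bsub>P\<^esub> (k \<odot>\<^bsub>P\<^esub> x)"
        using x that by (simp add: q)
      then show ?thesis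
        using x that by (simp add: coact_quot linear_maps_smult[OF coact_linear]
          linear_maps_smult[OF proj_linear] coact_closed)
    qed
    fix Y assume "Y \<in> carrier ?Q"
    then obtain y where y: "y \<in> carrier P" "Y = J +>\<^bsub>P\<^esub> y"
      by (auto simp: q)
    have "X \<oplus>\<^bsub>?Q\<^esub> Y = J +>\<^bsub>P\<^esub> (x \<oplus>\<^bsub>P\<^esub> y)"
      using x y by (simp add: q)
    then show "coact ?Q (X \<oplus>\<^bsub>?Q\<^esub> Y) = coact ?Q X \<oplus>\<^bsub>tensor K (quot_module P J) C\<^esub> coact ?Q Y"
      using x y by (simp add: coact_quot linear_maps_add[OF coact_linear]
        linear_maps_add[OF proj_linear] coact_closed)
  qed
  show ?thesis
  proof (rule comodule_algebraI[OF _ C_module co])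
    show "unital_algebra K ?Q"
      unfolding unital_algebra_def using Q ring by (auto simp: q smult_mult mult_smult)
  qed
qed

interpretation Q: comodule_algebra K C "quot_comod K C P J"
  by (rule quot_comodule_algebra)

text \<open>Multiplicativity of the projection P \<rightarrow> P/J, checked on pure tensors; it is
  needed for the commuting square \<open>canonical_proj\<close>.\<close>

lemma proj_left_act:
  assumes "p \<in> carrier P" "y \<in> carrier (tensor K P C)"
  shows "proj_tensor K P C J (left_act K C P p y) =
    left_act K C (quot_comod K C P J) (J +>\<^bsub>P\<^esub> p) (proj_tensor K P C J y)"
proof -
  have p: "J +>\<^bsub>P\<^esub> p \<in> carrier (quot_comod K C P J)"
    using assms(1) by (simp add: quot_comod_simps quot_carrier)
  note lin = Q.left_act_linear[OF p, unfolded tensor_quot_comod]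
  show ?thesis
    using assms(2)
  proof (induction rule: PC_induct)
    case (pure m c)
    then show ?case
      using assms(1) Q.left_act_pure[OF p, of "J +>\<^bsub>P\<^esub> m" c]
      by (simp add: left_act_pure proj_pure tensor_quot_comod quot_comod_simps quot_carrier quot_mult[OF ideal sub])
  next
    case (add x y)
    then show ?case
      using assms(1)
      by (simp add: linear_maps_add[OF left_act_linear] linear_maps_add[OF lin] left_act_closed
        linear_maps_add[OF proj_linear] linear_maps_closed[OF proj_linear])
  qed
qed

context
  assumes coinv: "(\<lambda>b. J +>\<^bsub>P\<^esub> b) ` coinvariants K C P = coinvariants K C (quot_comod K C P J)"
    and galois: "bij_betw (canonical_map K C (quot_comod K C P J)) (carrier Q.PP.T)
      (carrier (tensor K (quot_comod K C P J) C))"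
begin

interpretation pp: balanced_pair_map K "coinvariants K C P" "\<lambda>x b. x \<otimes>\<^bsub>P\<^esub> b" "\<lambda>b y. b \<otimes>\<^bsub>P\<^esub> y" P P
  "\<lambda>x b. x \<otimes>\<^bsub>quot_module P J\<^esub> (J +>\<^bsub>P\<^esub> b)" "\<lambda>b y. (J +>\<^bsub>P\<^esub> b) \<otimes>\<^bsub>quot_module P J\<^esub> y"
  "quot_module P J" "quot_module P J" "\<lambda>x. J +>\<^bsub>P\<^esub> x" "\<lambda>x. J +>\<^bsub>P\<^esub> x"
  by (rule proj_pair[OF ideal sub])

text \<open>Here the assumption on coinvariants enters: it makes the target of the projection on the
  balanced tensor product literally the domain of the canonical map of \<open>P/J\<close>.\<close>

private lemma T_eq: "Q.PP.T = pp.P'.T" "Q.PP.pure = pp.P'.pure"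
  unfolding coinv[symmetric] by (rule self_tensor_quot_comod)+

private lemmas can_linear = Q.canonical_linear[unfolded T_eq tensor_quot_comod]

text \<open>Commuting square between the canonical maps of \<open>P\<close> and \<open>P/J\<close>.
  On p \<otimes> q both ways give the class of p acting on the projected coaction of q.\<close>

lemma canonical_proj:
  assumes "x \<in> carrier PP.T"
  shows "canonical_map K C (quot_comod K C P J) (pp.tmap x) = proj_tensor K P C J (canonical_map K C P x)"
proof (rule PP.linear_eqI[OF TQ linear_maps_comp[OF pp.tmap_linear can_linear]
      linear_maps_comp[OF canonical_linear proj_linear] _ assms])
  fix p q assume pq: "p \<in> carrier P" "q \<in> carrier P"
  then have "J +>\<^bsub>P\<^esub> p \<in> carrier (quot_comod K C P J)" "J +>\<^bsub>P\<^esub> q \<in> carrier (quot_comod K C P J)"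
    by (auto simp: quot_comod_simps quot_carrier)
  then show "canonical_map K C (quot_comod K C P J) (pp.tmap (PP.pure p q)) =
      proj_tensor K P C J (canonical_map K C P (PP.pure p q))"
    using pq Q.canonical_pure[of "J +>\<^bsub>P\<^esub> p" "J +>\<^bsub>P\<^esub> q", unfolded T_eq]
    by (simp add: pp.tmap_pure canonical_pure coact_quot proj_left_act coact_closed)
qed

text \<open>In the square \<open>canonical_proj\<close> the canonical map of \<open>P/J\<close> is
  injective, so an element dies under \<open>pp.tmap\<close> exactly if it dies along the other
  path.\<close>

lemma ker_iff_proj_canonical:
  assumes x: "x \<in> carrier PP.T"
  shows "x \<in> tker J \<longleftrightarrow> proj_tensor K P C J (canonical_map K C P x) = \<zero>\<^bsub>tensor K (quot_module P J) C\<^esub>"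
proof -
  let ?can = "canonical_map K C (quot_comod K C P J)"
  have zero: "?can \<zero>\<^bsub>pp.P'.T\<^esub> = \<zero>\<^bsub>tensor K (quot_module P J) C\<^esub>"
    by (rule linear_maps_zero[OF pp.P'.module_T TQ can_linear])
  have "inj_on ?can (carrier pp.P'.T)"
    using galois by (simp add: T_eq bij_betw_def)
  moreover have "pp.tmap x \<in> carrier pp.P'.T" "\<zero>\<^bsub>pp.P'.T\<^esub> \<in> carrier pp.P'.T"
    using linear_maps_closed[OF pp.tmap_linear x] pp.P'.T.zero_closed by auto
  ultimately have "?can (pp.tmap x) = ?can \<zero>\<^bsub>pp.P'.T\<^esub> \<longleftrightarrow> pp.tmap x = \<zero>\<^bsub>pp.P'.T\<^esub>"
    by (auto dest: inj_onD)
  then show ?thesis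
    using x by (simp add: zero canonical_proj ker_eq[OF ideal sub])
qed

text \<open>The same square with surjectivity: the projection of \<open>y\<close> has a preimage
  under the canonical map of \<open>P/J\<close>, and this preimage lifts along the surjective
  \<open>pp.tmap\<close>.\<close>

lemma canonical_surj_mod:
  assumes y: "y \<in> carrier (tensor K P C)"
  shows "\<exists>x\<in>carrier PP.T. proj_tensor K P C J (y \<ominus>\<^bsub>tensor K P C\<^esub> canonical_map K C P x) =
    \<zero>\<^bsub>tensor K (quot_module P J) C\<^esub>"
proof -
  let ?can = "canonical_map K C (quot_comod K C P J)"
  have "proj_tensor K P C J y \<in> ?can ` carrier pp.P'.T"
    using galois linear_maps_closed[OF proj_linear y] by (simp add: T_eq bij_betw_def tensor_quot_comod)
  then obtain x' where x': "x' \<in> carrier pp.P'.T" "?can x' = proj_tensor K P C J y"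
    by force
  obtain x where x: "x \<in> carrier PP.T" "pp.tmap x = x'"
    using pp.tmap_surj[OF quot_carrier[symmetric] quot_carrier[symmetric] x'(1)] by blast
  then have "proj_tensor K P C J (canonical_map K C P x) = proj_tensor K P C J y"
    using x'(2) canonical_proj[OF x(1)] by metis
  then show ?thesis
    using x(1) y
    by (intro bexI[of _ x]) (simp_all add: linear_maps_minus[OF PC.module_axioms TQ proj_linear]
      canonical_closed linear_maps_closed[OF proj_linear] TQ.minus_eq_zero_iff)
qed

end

end

end

subsection \<open>Locally Galois extensions\<close>

context comodule_algebra
begin

context
  fixes I :: "'i set" and J :: "'i \<Rightarrow> 'p set"
  assumes loc: "locally_coalgebra_galois K C P (coinvariants K C P) I J"
begin

private lemma local_data:
  assumes "i \<in> I"
  shows "ideal (J i) P" "subcomodule K C P (J i)" "submodule (J i) K P"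
    and "(\<lambda>b. J i +>\<^bsub>P\<^esub> b) ` coinvariants K C P = coinvariants K C (quot_comod K C P (J i))"
  using loc assms by (auto simp: locally_coalgebra_galois_def subcomodule_def)

private lemma local_bij:
  assumes "i \<in> I"
  shows "bij_betw (canonical_map K C (quot_comod K C P (J i)))
    (carrier (balanced_tensor K (coinvariants K C (quot_comod K C P (J i)))
      (\<lambda>x b. x \<otimes>\<^bsub>quot_comod K C P (J i)\<^esub> b) (\<lambda>b y. b \<otimes>\<^bsub>quot_comod K C P (J i)\<^esub> y)
      (quot_comod K C P (J i)) (quot_comod K C P (J i))))
    (carrier (tensor K (quot_comod K C P (J i)) C))"
proof -
  have "coalgebra_galois K C (quot_comod K C P (J i)) ((\<lambda>b. J i +>\<^bsub>P\<^esub> b) ` coinvariants K C P)"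
    using loc assms unfolding locally_coalgebra_galois_def by blast
  then show ?thesis
    unfolding local_data(4)[OF assms] by (simp add: coalgebra_galois_def self_tensor_def)
qed

private lemma complete: "complete_cover K P I J"
  using loc by (simp add: locally_coalgebra_galois_def)

private lemma cov: "finite I" "carrier P \<inter> (\<Inter>i\<in>I. J i) = {\<zero>\<^bsub>P\<^esub>}"
  using complete by (auto simp: complete_cover_def cover_def)

lemma ker_iff:
  "i \<in> I \<Longrightarrow> x \<in> carrier PP.T \<Longrightarrow> x \<in> tker (J i) \<longleftrightarrow>
    proj_tensor K P C (J i) (canonical_map K C P x) = \<zero>\<^bsub>tensor K (quot_module P (J i)) C\<^esub>"
  using ker_iff_proj_canonical[OF local_data(1,2,4) local_bij] by blast

lemma ker_sub: "i \<in> I \<Longrightarrow> submodule (tker (J i)) K PP.T"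
  by (rule ker_submodule[OF local_data(1,3)])

lemma kernel_sum: "kernel_sum_condition K P (coinvariants K C P) I J"
  unfolding kernel_sum_condition_def self_tensor_eq by (auto simp: ker_sum local_data)

lemma canonical_inj_iff:
  "inj_on (canonical_map K C P) (carrier PP.T) \<longleftrightarrow>
    (\<forall>x\<in>carrier PP.T. canonical_map K C P x = \<zero>\<^bsub>tensor K P C\<^esub> \<longrightarrow> x = \<zero>\<^bsub>PP.T\<^esub>)"
proof
  assume inj: "inj_on (canonical_map K C P) (carrier PP.T)"
  show "\<forall>x\<in>carrier PP.T. canonical_map K C P x = \<zero>\<^bsub>tensor K P C\<^esub> \<longrightarrow> x = \<zero>\<^bsub>PP.T\<^esub>"
    using inj_onD[OF inj _ _ PP.T.zero_closed]
      linear_maps_zero[OF PP.module_T PC.module_axioms canonical_linear] by simp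
next
  assume zero: "\<forall>x\<in>carrier PP.T. canonical_map K C P x = \<zero>\<^bsub>tensor K P C\<^esub> \<longrightarrow> x = \<zero>\<^bsub>PP.T\<^esub>"
  show "inj_on (canonical_map K C P) (carrier PP.T)"
  proof (rule inj_onI)
    fix x y assume xy: "x \<in> carrier PP.T" "y \<in> carrier PP.T" "canonical_map K C P x = canonical_map K C P y"
    then have "canonical_map K C P (x \<ominus>\<^bsub>PP.T\<^esub> y) = \<zero>\<^bsub>tensor K P C\<^esub>"
      by (simp add: linear_maps_minus[OF PP.module_T PC.module_axioms canonical_linear]
        PC.minus_eq_zero_iff canonical_closed)
    then have "x \<ominus>\<^bsub>PP.T\<^esub> y = \<zero>\<^bsub>PP.T\<^esub>"
      using zero xy by simp
    then show "x = y"
      using xy by (simp add: PP.T.minus_eq_zero_iff)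
  qed
qed

text \<open>By \<open>ker_iff\<close> an element with canonical image zero lies in every
  \<open>tker (J i)\<close>, and these meet in zero.\<close>

lemma inj_if_cover:
  assumes "cover K PP.T I (\<lambda>i. tker (J i))"
  shows "inj_on (canonical_map K C P) (carrier PP.T)"
  unfolding canonical_inj_iff
proof (intro ballI impI)
  fix x assume x: "x \<in> carrier PP.T" "canonical_map K C P x = \<zero>\<^bsub>tensor K P C\<^esub>"
  have "x \<in> tker (J i)" if i: "i \<in> I" for i
    using ker_iff[OF i x(1)] x(2) linear_maps_zero[OF PC.module_axioms
      tensor_module[OF quot_module_module[OF P_module local_data(3)[OF i]] C_module]
      proj_tensor_linear[OF P_module C_module local_data(3)[OF i]]] by simp
  then show "x = \<zero>\<^bsub>PP.T\<^esub>"
    using x(1) assms by (auto simp: cover_def)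
qed

text \<open>If x lies in every \<open>tker (J i)\<close>, its canonical image dies in each (P/J)
  \<otimes> C with J = J(i). Flatness turns the trivial intersection of the \<open>J i\<close> into
  vanishing of that image.\<close>

lemma cover_if_inj:
  assumes flat: "flat_module K C" and inj: "inj_on (canonical_map K C P) (carrier PP.T)"
  shows "cover K PP.T I (\<lambda>i. tker (J i))"
proof -
  have "x = \<zero>\<^bsub>PP.T\<^esub>" if x: "x \<in> carrier PP.T" "\<And>i. i \<in> I \<Longrightarrow> x \<in> tker (J i)" for x
  proof -
    have "canonical_map K C P x = \<zero>\<^bsub>tensor K P C\<^esub>"
      using x canonical_closed ker_iff
      by (intro flat_inter_eq_zero[OF P_module C_module flat cov(1) local_data(3) cov(2)]) auto
    then show ?thesis
      using inj x(1) by (simp add: canonical_inj_iff)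
  qed
  moreover have "\<zero>\<^bsub>PP.T\<^esub> \<in> carrier PP.T \<inter> (\<Inter>i\<in>I. tker (J i))"
    using submodule_zero[OF ker_sub] by simp
  ultimately show ?thesis
    unfolding cover_def using cov(1) ker_sub by blast
qed

text \<open>The canonical map is always surjective: its image is a left \<open>P\<close>-submodule which together with
  each \<open>J\<^sub>i (P \<otimes> C)\<close> spans \<open>P \<otimes> C\<close>, hence also together with \<open>J\<^sub>1 \<cdots> J\<^sub>n (P \<otimes> C)\<close>.\<close>

lemma canonical_surj: "canonical_map K C P ` carrier PP.T = carrier (tensor K P C)"
proof -
  let ?T = "tensor K P C"
  let ?R = "canonical_map K C P ` carrier PP.T"
  \<comment> \<open>Intersections of the ideals stand in for products: the empty one is
    \<open>P\<close>, where the induction starts, and the one over \<open>I\<close> is zero because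
    the ideals form a cover.\<close>
  define S where "S F = {pure_tensor K P C p c | p c. p \<in> carrier P \<inter> (\<Inter>i\<in>F. J i) \<and> c \<in> carrier C}" for F
  define E where "E F = ?R <+>\<^bsub>?T\<^esub> submodule_span K ?T (S F)" for F
  have span: "submodule (submodule_span K ?T (S F)) K ?T" for F
    by (rule span_submodule[OF PC.module_axioms]) (auto simp: S_def intro: pure_closed)
  have E: "submodule (E F) K ?T" for F
    unfolding E_def by (rule set_add_submodule[OF PC.module_axioms canonical_range_submodule span])
  have R_E: "?R \<subseteq> E F" and S_E: "submodule_span K ?T (S F) \<subseteq> E F" for F
    unfolding E_def by (rule set_add_incl[OF PC.module_axioms canonical_range_submodule span])+
  have "carrier ?T \<subseteq> E F" if "finite F" "F \<subseteq> I" for F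
    using that
  proof (induction rule: finite_induct)
    case empty
    have "y \<in> E {}" if "y \<in> carrier ?T" for y
      using that
    proof (induction rule: PC_induct)
      case (pure m c)
      then show ?case
        by (intro subsetD[OF S_E] subsetD[OF span_incl]) (auto simp: S_def)
    next
      case (add x y)
      then show ?case
        by (intro submodule_add[OF E])
    qed
    then show ?case
      by blast
  next
    case (insert j F)
    have j: "j \<in> I"
      using insert.prems by simp
    have F: "ideal (J i) P" if "i \<in> F" for i
      using insert.prems that by (intro local_data(1)) auto
    have "S F \<subseteq> E (insert j F)"
    proof
      fix y assume "y \<in> S F"
      then obtain p c where p: "p \<in> carrier P" "\<And>i. i \<in> F \<Longrightarrow> p \<in> J i" and c: "c \<in> carrier C"
        and y: "y = pure_tensor K P C p c"
        by (auto simp: S_def)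
      \<comment> \<open>The tensor 1 \<otimes> c is approximated rather than p \<otimes> c:
        multiplying the error by p afterwards puts it into the ideals indexed by \<open>F\<close>
        too.\<close>
      have pc: "pure_tensor K P C \<one>\<^bsub>P\<^esub> c \<in> carrier ?T"
        using c by (intro pure_closed) auto
      obtain x where x: "x \<in> carrier PP.T"
        "proj_tensor K P C (J j) (pure_tensor K P C \<one>\<^bsub>P\<^esub> c \<ominus>\<^bsub>?T\<^esub> canonical_map K C P x) =
          \<zero>\<^bsub>tensor K (quot_module P (J j)) C\<^esub>"
        using canonical_surj_mod[OF local_data(1,2,4) local_bij, OF j j j j pc] by blast
      define t where "t = pure_tensor K P C \<one>\<^bsub>P\<^esub> c \<ominus>\<^bsub>?T\<^esub> canonical_map K C P x"
      have t: "t \<in> carrier ?T"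
        unfolding t_def using pc x canonical_closed by auto
      have "t \<in> submodule_span K ?T {pure_tensor K P C q c | q c. q \<in> J j \<and> c \<in> carrier C}"
        using proj_tensor_kernel[OF P_module C_module local_data(3)[OF j] t] x(2) by (simp add: t_def)
      also have "\<dots> \<subseteq> {z \<in> carrier ?T. left_act K C P p z \<in> submodule_span K ?T (S (insert j F))}"
      proof (rule span_least)
        show "submodule {z \<in> carrier ?T. left_act K C P p z \<in> submodule_span K ?T (S (insert j F))} K ?T"
          by (rule linear_preimage_submodule[OF PC.module_axioms PC.module_axioms left_act_linear[OF p(1)] span])
        show "{pure_tensor K P C q c | q c. q \<in> J j \<and> c \<in> carrier C} \<subseteq>
          {z \<in> carrier ?T. left_act K C P p z \<in> submodule_span K ?T (S (insert j F))}"
        proof safe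
          fix q d assume q: "q \<in> J j" and d: "d \<in> carrier C"
          have q': "q \<in> carrier P"
            using q submodule_subset[OF local_data(3)[OF j]] by auto
          show "pure_tensor K P C q d \<in> carrier ?T"
            using q' d by (rule pure_closed)
          \<comment> \<open>Both sides of the ideal property are used: \<open>J j\<close> contains q
            and absorbs p from the left, while the ideals indexed by \<open>F\<close> contain p and
            absorb q from the right.\<close>
          have "p \<otimes>\<^bsub>P\<^esub> q \<in> J i" if "i \<in> insert j F" for i
            using that p q q' ideal.I_l_closed[OF local_data(1)[OF j]] ideal.I_r_closed[OF F] by auto
          then have "pure_tensor K P C (p \<otimes>\<^bsub>P\<^esub> q) d \<in> S (insert j F)"
            using p(1) q' d by (auto simp: S_def)
          then show "left_act K C P p (pure_tensor K P C q d) \<in> submodule_span K ?T (S (insert j F))"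
            using p(1) q' d by (simp add: left_act_pure subsetD[OF span_incl])
        qed
      qed
      finally have pt: "left_act K C P p t \<in> E (insert j F)"
        using S_E by blast
      have "left_act K C P p (canonical_map K C P x) \<in> E (insert j F)"
        using canonical_range_left_act[OF p(1) x(1)] R_E by blast
      with pt have "left_act K C P p t \<oplus>\<^bsub>?T\<^esub> left_act K C P p (canonical_map K C P x) \<in> E (insert j F)"
        by (rule submodule_add[OF E])
      moreover have "t \<oplus>\<^bsub>?T\<^esub> canonical_map K C P x = pure_tensor K P C \<one>\<^bsub>P\<^esub> c"
        unfolding t_def using pc canonical_closed[OF x(1)] by (simp add: a_minus_def PC.a_assoc PC.l_neg)
      ultimately show "y \<in> E (insert j F)"
        using linear_maps_add[OF left_act_linear[OF p(1)] t canonical_closed[OF x(1)]] p(1) c y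
        by (simp add: left_act_pure)
    qed
    then have "submodule_span K ?T (S F) \<subseteq> E (insert j F)"
      by (rule span_least[OF E])
    then have "E F \<subseteq> E (insert j F)"
      using R_E[of "insert j F"] submodule_add[OF E[of "insert j F"]]
      by (auto simp: E_def[of F] set_add_iff subset_iff)
    with insert show ?case
      by auto
  qed
  from this[OF cov(1) subset_refl] have E_I: "carrier ?T \<subseteq> E I" .
  have "S I \<subseteq> ?R"
    using linear_maps_zero[OF P_module PC.module_axioms pure_linear(1)] submodule_zero[OF canonical_range_submodule]
    by (auto simp: S_def cov(2))
  then have "submodule_span K ?T (S I) \<subseteq> ?R"
    by (rule span_least[OF canonical_range_submodule])
  then have "E I \<subseteq> ?R"
    using submodule_add[OF canonical_range_submodule] by (auto simp: E_def set_add_iff subset_iff)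
  with E_I show ?thesis
    using submodule_subset[OF canonical_range_submodule] by blast
qed

text \<open>Surjectivity of the canonical map is available from \<open>canonical_surj\<close>. A
  compatible family is pushed to P \<otimes> C, glued there by \<open>flat_glue\<close> and pulled
  back; \<open>ker_iff\<close> translates the congruences in both directions.\<close>

lemma complete_cover_if_bij:
  assumes flat: "flat_module K C" and inj: "inj_on (canonical_map K C P) (carrier PP.T)"
  shows "complete_cover K PP.T I (\<lambda>i. tker (J i))"
  unfolding complete_cover_iff[OF PP.module_T]
proof (intro conjI allI impI)
  show "cover K PP.T I (\<lambda>i. tker (J i))"
    using assms by (rule cover_if_inj)
  fix x assume x: "(\<forall>i\<in>I. x i \<in> carrier PP.T) \<and>
    (\<forall>i\<in>I. \<forall>j\<in>I. x i \<ominus>\<^bsub>PP.T\<^esub> x j \<in> tker (J i) <+>\<^bsub>PP.T\<^esub> tker (J j))"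
  let ?can = "canonical_map K C P"
  let ?T = "tensor K P C"
  have can_minus: "?can (u \<ominus>\<^bsub>PP.T\<^esub> v) = ?can u \<ominus>\<^bsub>?T\<^esub> ?can v" if "u \<in> carrier PP.T" "v \<in> carrier PP.T" for u v
    using that by (rule linear_maps_minus[OF PP.module_T PC.module_axioms canonical_linear])
  have "\<exists>z\<in>carrier ?T. \<forall>i\<in>I. proj_tensor K P C (J i) (z \<ominus>\<^bsub>?T\<^esub> ?can (x i)) =
    \<zero>\<^bsub>tensor K (quot_module P (J i)) C\<^esub>"
  proof (rule flat_glue[OF P_module C_module flat complete])
    show "?can (x i) \<in> carrier ?T" if "i \<in> I" for i
      using x that by (intro canonical_closed) auto
    fix i j assume ij: "i \<in> I" "j \<in> I"
    have JJ: "submodule (J i <+>\<^bsub>P\<^esub> J j) K P"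
      using ij by (intro set_add_submodule[OF P_module] local_data)
    let ?p = "proj_tensor K P C (J i <+>\<^bsub>P\<^esub> J j)"
    let ?Z = "{y \<in> carrier ?T. ?p y = \<zero>\<^bsub>tensor K (quot_module P (J i <+>\<^bsub>P\<^esub> J j)) C\<^esub>}"
    note Q = quot_module_module[OF P_module JJ]
    have Z: "submodule ?Z K ?T"
      by (rule linear_kernel_submodule[OF PC.module_axioms tensor_module[OF Q C_module]
        proj_tensor_linear[OF P_module C_module JJ]])
    \<comment> \<open>The canonical image of u lies in the image of J(k) \<otimes> C, which dies
      modulo J(i) + J(j). For k = i and k = j this yields the compatibility that
      \<open>flat_glue\<close> requires.\<close>
    have kerZ: "?can u \<in> ?Z" if u: "u \<in> tker (J k)" and k: "k \<in> I" "J k \<subseteq> J i <+>\<^bsub>P\<^esub> J j" for u k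
    proof -
      have u': "u \<in> carrier PP.T"
        using u submodule_subset[OF ker_sub[OF k(1)]] by blast
      then have "?can u \<in> submodule_span K ?T {pure_tensor K P C q c | q c. q \<in> J k \<and> c \<in> carrier C}"
        using u k(1) ker_iff canonical_closed
        by (intro proj_tensor_kernel[OF P_module C_module local_data(3)]) auto
      also have "\<dots> \<subseteq> ?Z"
      proof (rule span_least[OF Z], rule subsetI)
        fix w assume "w \<in> {pure_tensor K P C q c | q c. q \<in> J k \<and> c \<in> carrier C}"
        then obtain q c where q: "q \<in> J k" and c: "c \<in> carrier C" and w: "w = pure_tensor K P C q c"
          by blast
        have q': "q \<in> carrier P"
          using q submodule_subset[OF local_data(3)[OF k(1)]] by auto
        have "(J i <+>\<^bsub>P\<^esub> J j) +>\<^bsub>P\<^esub> q = \<zero>\<^bsub>quot_module P (J i <+>\<^bsub>P\<^esub> J j)\<^esub>"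
          using q k(2) coset_eq_zero_iff[OF P_module JJ q'] by auto
        then have "?p w = \<zero>\<^bsub>tensor K (quot_module P (J i <+>\<^bsub>P\<^esub> J j)) C\<^esub>"
          using linear_maps_zero[OF Q tensor_module[OF Q C_module] pure_tensor_linear(1)[OF Q C_module c]]
          by (simp add: w proj_tensor_pure[OF P_module C_module JJ q' c])
        then show "w \<in> ?Z"
          using pure_closed[OF q' c] by (simp add: w)
      qed
      finally show ?thesis .
    qed
    have "x i \<ominus>\<^bsub>PP.T\<^esub> x j \<in> tker (J i) <+>\<^bsub>PP.T\<^esub> tker (J j)"
      using x ij by blast
    then obtain u v where uv: "u \<in> tker (J i)" "v \<in> tker (J j)" "x i \<ominus>\<^bsub>PP.T\<^esub> x j = u \<oplus>\<^bsub>PP.T\<^esub> v"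
      by (auto simp: set_add_iff)
    have uv': "u \<in> carrier PP.T" "v \<in> carrier PP.T"
      using uv submodule_subset[OF ker_sub] ij by blast+
    have "?can (x i) \<ominus>\<^bsub>?T\<^esub> ?can (x j) = ?can u \<oplus>\<^bsub>?T\<^esub> ?can v"
      using x ij uv uv' can_minus[of "x i" "x j"] by (simp add: linear_maps_add[OF canonical_linear])
    also have "\<dots> \<in> ?Z"
      using uv ij set_add_incl[OF P_module local_data(3)[OF ij(1)] local_data(3)[OF ij(2)]]
      by (intro submodule_add[OF Z] kerZ[of u i] kerZ[of v j])
    finally show "?p (?can (x i) \<ominus>\<^bsub>?T\<^esub> ?can (x j)) = \<zero>\<^bsub>tensor K (quot_module P (J i <+>\<^bsub>P\<^esub> J j)) C\<^esub>"
      by simp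
  qed
  then obtain z where z: "z \<in> carrier ?T" "\<forall>i\<in>I. proj_tensor K P C (J i) (z \<ominus>\<^bsub>?T\<^esub> ?can (x i)) =
    \<zero>\<^bsub>tensor K (quot_module P (J i)) C\<^esub>"
    by blast
  then obtain y where y: "y \<in> carrier PP.T" "z = ?can y"
    using canonical_surj by blast
  \<comment> \<open>The canonical map sends y - x(i) to z - can(x(i)), so \<open>ker_iff\<close>
    returns the congruence satisfied by z.\<close>
  have "y \<ominus>\<^bsub>PP.T\<^esub> x i \<in> tker (J i)" if i: "i \<in> I" for i
    using z(2) i x y by (simp add: ker_iff can_minus)
  with y show "\<exists>y\<in>carrier PP.T. \<forall>i\<in>I. y \<ominus>\<^bsub>PP.T\<^esub> x i \<in> tker (J i)"
    by blast
qed

end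

end

theorem theorem5p8:
  fixes K :: "('k, 'r) ring_scheme"
    and C :: "('k, 'c, 'x) coalg_scheme"
    and P :: "('k, 'p, 'c, 'y) comod_scheme"
    and B :: "'p set" and I :: "'i set" and J :: "'i \<Rightarrow> 'p set"
  assumes "cring K"
    and "add_pow K (2::nat) \<one>\<^bsub>K\<^esub> \<noteq> \<zero>\<^bsub>K\<^esub>" and "add_pow K (3::nat) \<one>\<^bsub>K\<^esub> \<noteq> \<zero>\<^bsub>K\<^esub>"
    and "multiples_exhaust 2 P" and "multiples_exhaust 3 P"
    and "multiples_exhaust 2 C" and "multiples_exhaust 3 C"
    and "coalgebra K C"
    and "locally_coalgebra_galois K C P B I J"
  shows "(complete_cover K (self_tensor K B (\<lambda>b. b) P) I (\<lambda>i. proj_tensor_ker K P B (J i)) \<and>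
          kernel_sum_condition K P B I J \<longrightarrow>
            coalgebra_galois K C P B) \<and>
         (flat_module K C \<longrightarrow>
            (cover K (self_tensor K B (\<lambda>b. b) P) I (\<lambda>i. proj_tensor_ker K P B (J i)) \<longleftrightarrow>
              inj_on (canonical_map K C P) (carrier (self_tensor K B (\<lambda>b. b) P)))) \<and>
         (coalgebra_galois K C P B \<and> flat_module K C \<longrightarrow>
            kernel_sum_condition K P B I J \<and>
            complete_cover K (self_tensor K B (\<lambda>b. b) P) I (\<lambda>i. proj_tensor_ker K P B (J i)))"
proof -
  have B: "B = coinvariants K C P" and alg: "algebra_comodule K C P"
    using assms(9) by (auto simp: locally_coalgebra_galois_def)
  interpret comodule_algebra K C P
    using alg assms(8)
    by (intro comodule_algebraI) (auto simp: algebra_comodule_def right_comodule_def coalgebra_def)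
  have loc: "locally_coalgebra_galois K C P (coinvariants K C P) I J"
    using assms(9) by (simp add: B)
  \<comment> \<open>Part (1) joins \<open>inj_if_cover\<close> with \<open>canonical_surj\<close>,
    part (2) consists of \<open>inj_if_cover\<close> and \<open>cover_if_inj\<close>, and part (3)
    of \<open>kernel_sum\<close> and \<open>complete_cover_if_bij\<close>.\<close>
  show ?thesis
    unfolding B self_tensor_eq
    using inj_if_cover[OF loc] cover_if_inj[OF loc] complete_cover_if_bij[OF loc] kernel_sum[OF loc]
      canonical_surj[OF loc] alg
    by (auto simp: coalgebra_galois_def self_tensor_eq bij_betw_def complete_cover_def)
qed

end
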